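(* Let $T_i=\mathrm{diag}(t_{i,1},t_{i,2},\dots,t_{i,d})$, $i=1,\dots,m$, with $\frac12>t_{i,1}>t_{i,2}>\dots>t_{i,d}>0$, and let $(p_1,\dots,p_m)$ be a probability vector with all $p_i>0$. With $D$, $\tau$, $\mu^{\mathbf a}$ and $E(\mu^{\mathbf a},\cdot)$ as defined in the context, let $q\ge2$ be such that $D(q)<q-1$ and $\tau(q)<1$, with $D(q)/(q-1)\in(0,1)$ (in this case $\alpha:=D'(q)$ exists) and $\alpha q-D(q)\in(0,1)$. Then for $\mathcal{L}^{md}$-a.e. $\mathbf a\in\mathbb{R}^{md}$, $E(\mu^{\mathbf a},\alpha)\ne\emptyset$ and $$\dim_H E(\mu^{\mathbf a},\alpha)=\alpha q-\tau(q).$$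
   Context: Here $d\ge1$, $m\ge2$; $\mathcal{L}^{n}$ is $n$-dimensional Lebesgue measure; $\dim_H$ is Hausdorff dimension; $B_r(x)$ is the closed Euclidean ball. For $\mathbf a=(a_1,\dots,a_m)\in\mathbb{R}^{md}$ (each $a_i\in\mathbb{R}^d$), $\mu^{\mathbf a}$ is the self-affine measure of the IFS $\{S_i=T_i+a_i\}_{i=1}^m$ and $(p_1,\dots,p_m)$, i.e. the unique Borel probability measure on $\mathbb{R}^d$ with $\mu^{\mathbf a}=\sum_{i=1}^m p_i\,\mu^{\mathbf a}\circ S_i^{-1}$. For a non-singular linear map $T$ with singular values $\alpha_1\ge\dots\ge\alpha_d>0$, the singular value function is $\phi^0(T)=1$, $\phi^s(T)=\alpha_1\cdots\alpha_{k-1}\alpha_k^{s-k+1}$ if $k-1<s\le k\le d$ ($k$ a positive integer), and $\phi^s(T)=(\alpha_1\cdots\alpha_d)^{s/d}$ if $s\ge d$. For $k\in\mathbb{N}$, $\Sigma_k=\{1,\dots,m\}^k$; for $I=i_1\dots i_k$, $T_I=T_{i_1}\circ\dots\circ T_{i_k}$ and $p_I=p_{i_1}\cdots p_{i_k}$. For $q>1$, $$D(q)=(q-1)\sup\Big\{s\ge0:\sum_{k=1}^\infty\sum_{I\in\Sigma_k}(\phi^s(T_I))^{1-q}p_I^q<\infty\Big\},\qquad \tau(q)=(q-1)\min\{D(q)/(q-1),d\}.$$ For a Borel probability measure $\mu$ on $\mathbb{R}^d$, $E(\mu,\alpha)=\big\{x\in\mathbb{R}^d:\lim_{r\to0}\frac{\log\mu(B_r(x))}{\log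 r}=\alpha\big\}$. *)

theory Defs
  imports "HOL-Probability.Probability"
begin

section \<open>Hausdorff dimension\<close>

text \<open>The summand |U|^s of the Hausdorff sums, with the conventions |{}|^s = 0 for all s
  and |U|^0 = 1 for nonempty U (note that \<open>0 powr 0 = 0\<close>).\<close>

definition diam_power :: "real \<Rightarrow> 'a::metric_space set \<Rightarrow> ennreal" where
  "diam_power s U =
     (if U = {} then 0 else if s = 0 then 1 else ennreal (diameter U powr s))"

text \<open>Coverings consist of bounded sets, because \<open>diameter\<close> is only meaningful for these.
  Finite coverings are included, since members may be empty.\<close>

definition hausdorff_pre :: "real \<Rightarrow> real \<Rightarrow> 'a::metric_space set \<Rightarrow> ennreal" where
  "hausdorff_pre s \<delta> E =
     (INF U \<in> {U :: nat \<Rightarrow> 'a set. E \<subseteq> (\<Union>i. U i) \<and> (\<forall>i. bounded (U i) \<and> diameter (U i) \<le> \<delta>)}.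
        (\<Sum>i. diam_power s (U i)))"

definition hausdorff_outer :: "real \<Rightarrow> 'a::metric_space set \<Rightarrow> ennreal" where
  "hausdorff_outer s E = (SUP \<delta>\<in>{0<..}. hausdorff_pre s \<delta> E)"

definition hausdorff_dim :: "'a::metric_space set \<Rightarrow> ereal" where
  "hausdorff_dim E = Inf (ereal ` {s. 0 \<le> s \<and> hausdorff_outer s E = 0})"


section \<open>Singular values and the singular value function\<close>

definition diag_matrix :: "('n \<Rightarrow> real) \<Rightarrow> real^'n^'n" where
  "diag_matrix t = (\<chi> i j. if i = j then t i else 0)"

definition sv_eigenspace :: "real^'n^'n \<Rightarrow> real \<Rightarrow> (real^'n) set" where
  "sv_eigenspace A s = {x. (transpose A ** A) *v x = s\<^sup>2 *\<^sub>R x}"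

text \<open>The nonnegative square roots of the eigenvalues of \<open>transpose A ** A\<close>, in decreasing
  order, each repeated according to its multiplicity. As \<open>transpose A ** A\<close> is symmetric,
  the multiplicity is the dimension of the eigenspace, and the list has length \<open>CARD('n)\<close>.\<close>

definition singular_values :: "real^'n^'n \<Rightarrow> real list" where
  "singular_values A =
     concat (map (\<lambda>s. replicate (dim (sv_eigenspace A s)) s)
       (rev (sorted_list_of_set {s. 0 \<le> s \<and> (\<exists>x\<in>sv_eigenspace A s. x \<noteq> 0)})))"

text \<open>For 0 < s < d, the integer k with k - 1 < s <= k is the ceiling of s; list positions
  start at 0, so \<open>singular_values A ! (k - 1)\<close> is the k-th singular value.\<close>

definition sv_function :: "real \<Rightarrow> real^'n^'n \<Rightarrow> real" where
  "sv_function s A =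
     (let \<alpha> = singular_values A; k = nat \<lceil>s\<rceil> in
      if s = 0 then 1
      else if s \<ge> real CARD('n) then prod_list \<alpha> powr (s / real CARD('n))
      else (\<Prod>i<k - 1. \<alpha> ! i) * (\<alpha> ! (k - 1)) powr (s - real k + 1))"


section \<open>The functions \<open>D\<close> and \<open>\<tau>\<close>\<close>

definition matrix_word :: "('m \<Rightarrow> real^'n^'n) \<Rightarrow> 'm list \<Rightarrow> real^'n^'n" where
  "matrix_word T I = foldr (\<lambda>i A. T i ** A) I (mat 1)"

definition prob_word :: "('m \<Rightarrow> real) \<Rightarrow> 'm list \<Rightarrow> real" where
  "prob_word p I = prod_list (map p I)"

text \<open>The series has nonnegative terms, so summability is finiteness of the sum; the outer
  sum starts at words of length 1. The supremum is taken in the reals: for \<open>q > 1\<close>, a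
  probability vector with at least two indices and all entries positive, and nonsingular
  contractions, the set contains 0 and is bounded above.\<close>

definition D_fun :: "('m::finite \<Rightarrow> real^'n^'n) \<Rightarrow> ('m \<Rightarrow> real) \<Rightarrow> real \<Rightarrow> real" where
  "D_fun T p q = (q - 1) * Sup {s. 0 \<le> s \<and>
     summable (\<lambda>k. \<Sum>I\<in>{I :: 'm list. length I = Suc k}.
       sv_function s (matrix_word T I) powr (1 - q) * prob_word p I powr q)}"

definition tau_fun :: "('m::finite \<Rightarrow> real^'n^'n) \<Rightarrow> ('m \<Rightarrow> real) \<Rightarrow> real \<Rightarrow> real" where
  "tau_fun T p q = (q - 1) * min (D_fun T p q / (q - 1)) (real CARD('n))"


section \<open>Self-affine measures and level sets of the local dimension\<close>

definition is_self_affine_measure ::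
  "('m::finite \<Rightarrow> real^'n^'n) \<Rightarrow> ('m \<Rightarrow> real) \<Rightarrow> (real^'n)^'m \<Rightarrow> (real^'n) measure \<Rightarrow> bool" where
  "is_self_affine_measure T p a \<mu> \<longleftrightarrow>
     prob_space \<mu> \<and> sets \<mu> = sets borel \<and>
     (\<forall>A\<in>sets borel.
        emeasure \<mu> A = (\<Sum>i\<in>UNIV. ennreal (p i) * emeasure \<mu> ((\<lambda>x. T i *v x + a $ i) -` A)))"

definition self_affine_measure ::
  "('m::finite \<Rightarrow> real^'n^'n) \<Rightarrow> ('m \<Rightarrow> real) \<Rightarrow> (real^'n)^'m \<Rightarrow> (real^'n) measure" where
  "self_affine_measure T p a = (THE \<mu>. is_self_affine_measure T p a \<mu>)"

text \<open>If some ball around x is a null set, the quotient is +infinity for small r, so x lies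
  in no level set; as \<open>ln 0 = 0\<close>, such x have to be excluded explicitly.\<close>

definition local_dim_level_set :: "'a::metric_space measure \<Rightarrow> real \<Rightarrow> 'a set" where
  "local_dim_level_set \<mu> \<alpha> =
     {x. (\<forall>r>0. measure \<mu> (cball x r) > 0) \<and>
         ((\<lambda>r. ln (measure \<mu> (cball x r)) / ln r) \<longlongrightarrow> \<alpha>) (at_right 0)}"

end

theory Submission
  imports Defs
begin

text \<open>
  Write \<open>u\<^sub>i\<close> for the largest entry of \<open>T\<^sub>i\<close>. Since \<open>\<phi>\<^sup>s(T\<^sub>I) \<le> u\<^sub>I\<^sup>s\<close>, with equality for
  \<open>s \<le> 1\<close>, the number \<open>D(q)\<close> is the root of \<open>\<Sum>\<^sub>i p\<^sub>i\<^sup>q u\<^sub>i powr (- D(q)) = 1\<close>. The weights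
  \<open>w\<^sub>i = p\<^sub>i\<^sup>q u\<^sub>i powr (- D(q))\<close> define a Bernoulli measure on codes, for which
  \<open>D'(q) = \<Sum> w\<^sub>i ln p\<^sub>i / \<Sum> w\<^sub>i ln u\<^sub>i\<close> and \<open>D'(q) q - D(q) = \<Sum> w\<^sub>i ln w\<^sub>i / \<Sum> w\<^sub>i ln u\<^sub>i\<close>.

  The points coded by \<open>I\<close> and \<open>J\<close> with common prefix \<open>K\<close> are within \<open>r\<close> of each other only for
  a set of translation vectors of measure \<open>O((r / u\<^sub>K) powr s)\<close>, for every \<open>s \<le> 1\<close>. Integrating over
  the translations, \<open>\<mu>(B\<^sub>r(x))\<close> is, at \<open>w\<close>-typical points, at most \<open>r powr (D'(q) - \<epsilon>)\<close>; here
  \<open>D'(q) < 1\<close> follows from \<open>D'(q) q - D(q) < 1\<close>, \<open>D(q) < 1\<close> and \<open>q \<ge> 2\<close>. The same argument applied to the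
  projection of the \<open>w\<close>-measure itself gives the lower bound by the mass distribution principle.
  For the upper bound, the integral of \<open>\<mu>(B\<^sub>r(x)) powr (q - 1)\<close> with respect to \<open>\<mu>\<close> is at most
  \<open>r powr (D(q) - \<epsilon>)\<close>: split the ball according to the length of the common prefix with \<open>x\<close>,
  bound \<open>q - 2\<close> of the factors by \<open>p\<^sub>K\<close> and one by transversality, using \<open>D(q) < 1\<close>.
\<close>

section \<open>Bernoulli measures on codes\<close>

text \<open>The estimates live on the code space: \<open>near a r I\<close> replaces the ball, so
  that translations and codes are independent variables and Tonelli's theorem applies. Only
  coordinate \<open>j0\<close> is compared in transversality. For exponents up to 1 the singular
  value function sees only the largest singular value, and the assumptions on D(q) and tau(q) keep
  the exponents within this range. The critical exponents are out of reach: there the weights per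
  digit have mean 1, or their logarithms have mean 0, and no geometric decay is left. Every estimate
  is therefore made at a strictly smaller s, and a second gap \<sigma> < s makes the sum over dyadic
  radii converge. The loss is \<open>1 / real (Suc n)\<close>, so that only countably many
  exceptional sets of translations are discarded. One functional, \<open>energy\<close>, is used in
  three ways, according to which measure weighs the balls and which one draws the centres: the given
  Bernoulli measure at w-typical codes, the w-measure at w-typical codes, and the given measure
  integrated against itself.\<close>

definition stream_prod :: "('m \<Rightarrow> real) \<Rightarrow> nat \<Rightarrow> 'm stream \<Rightarrow> real" where
  "stream_prod f n I = (\<Prod>k<n. f (I !! k))"

lemma stream_prod_0 [simp]: "stream_prod f 0 I = 1"
  by (simp add: stream_prod_def)

lemma stream_prod_Suc_Stream: "stream_prod f (Suc n) (i ## I) = f i * stream_prod f n I"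
  by (simp add: stream_prod_def prod.lessThan_Suc_shift del: prod.lessThan_Suc)

lemma stream_prod_Suc: "stream_prod f (Suc n) I = stream_prod f n I * f (I !! n)"
  by (simp add: stream_prod_def)

lemma stream_prod_pos: "(\<And>i. 0 < f i) \<Longrightarrow> 0 < stream_prod f n I"
  by (simp add: stream_prod_def prod_pos)

lemma stream_prod_nonneg: "(\<And>i. 0 \<le> f i) \<Longrightarrow> 0 \<le> stream_prod f n I"
  by (simp add: stream_prod_def prod_nonneg)

lemma stream_prod_mult: "stream_prod (\<lambda>i. f i * g i) n I = stream_prod f n I * stream_prod g n I"
  by (simp add: stream_prod_def prod.distrib)

lemma stream_prod_const: "stream_prod (\<lambda>i. c) n I = c ^ n"
  by (simp add: stream_prod_def)

lemma stream_prod_powr: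
  assumes "\<And>i. 0 \<le> f i"
  shows "stream_prod (\<lambda>i. f i powr s) n I = stream_prod f n I powr s"
  unfolding stream_prod_def using assms by (simp add: prod_powr_distrib)

lemma stream_prod_mono:
  assumes "\<And>i. 0 \<le> f i" "\<And>i. f i \<le> g i"
  shows "stream_prod f n I \<le> stream_prod g n I"
  unfolding stream_prod_def by (rule prod_mono) (use assms in auto)

lemma stream_prod_le_power:
  assumes "\<And>i. 0 \<le> f i" "\<And>i. f i \<le> c"
  shows "stream_prod f n I \<le> c ^ n"
  using stream_prod_mono[of f "\<lambda>_. c" n I] assms by (simp add: stream_prod_const)

lemma measurable_stream_prod [measurable]:
  "stream_prod f n \<in> borel_measurable (stream_space (count_space UNIV))"
  unfolding stream_prod_def
  by (intro borel_measurable_prod measurable_compose[OF measurable_snth]) simp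

lemma sets_stream_pmf [measurable_cong]:
  "sets (stream_space (measure_pmf P)) = sets (stream_space (count_space UNIV))"
  by (rule sets_stream_space_cong) simp

lemma space_stream_pmf [simp]: "space (stream_space (measure_pmf P)) = UNIV"
  by (simp add: space_stream_space)

lemma prob_space_stream_pmf: "prob_space (stream_space (measure_pmf P))"
  by (rule prob_space.prob_space_stream_space) (rule measure_pmf.prob_space_axioms)

lemma nn_integral_stream_pmf:
  fixes P :: "'m::finite pmf"
  assumes "f \<in> borel_measurable (stream_space (count_space UNIV))"
  shows "(\<integral>\<^sup>+I. f I \<partial>stream_space (measure_pmf P)) =
    (\<Sum>i\<in>UNIV. ennreal (pmf P i) * (\<integral>\<^sup>+I. f (i ## I) \<partial>stream_space (measure_pmf P)))"
proof -
  have f: "f \<in> borel_measurable (stream_space (measure_pmf P))"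
    using assms measurable_cong_sets[OF sets_stream_pmf refl] by blast
  show ?thesis
    unfolding prob_space.nn_integral_stream_space[OF measure_pmf.prob_space_axioms f]
    by (subst nn_integral_measure_pmf)
       (simp add: nn_integral_count_space_finite)
qed

text \<open>Digits are independent, so a multiplicative weight has a geometric expectation; series
  of such weights converge in mean once the one-digit mean is below 1.\<close>

lemma nn_integral_stream_prod:
  fixes P :: "'m::finite pmf"
  assumes "\<And>i. 0 \<le> f i"
  shows "(\<integral>\<^sup>+I. ennreal (stream_prod f n I) \<partial>stream_space (measure_pmf P)) =
    ennreal ((\<Sum>i\<in>UNIV. pmf P i * f i) ^ n)"
proof (induction n)
  case 0
  show ?case
    using prob_space.emeasure_space_1[OF prob_space_stream_pmf[of P]] by simp
next
  case (Suc n)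
  have "(\<integral>\<^sup>+I. ennreal (stream_prod f (Suc n) I) \<partial>stream_space (measure_pmf P)) =
    (\<Sum>i\<in>UNIV. ennreal (pmf P i) * (ennreal (f i) *
       (\<integral>\<^sup>+I. ennreal (stream_prod f n I) \<partial>stream_space (measure_pmf P))))"
    by (subst nn_integral_stream_pmf)
       (simp_all add: stream_prod_Suc_Stream ennreal_mult assms stream_prod_nonneg nn_integral_cmult)
  also have "\<dots> = (\<Sum>i\<in>UNIV. ennreal (pmf P i * f i * (\<Sum>i\<in>UNIV. pmf P i * f i) ^ n))"
    unfolding Suc by (simp add: assms sum_nonneg ennreal_mult mult.assoc)
  also have "\<dots> = ennreal ((\<Sum>i\<in>UNIV. pmf P i * f i) ^ Suc n)"
    by (subst sum_ennreal) (simp_all add: assms sum_nonneg sum_distrib_right)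
  finally show ?case .
qed

lemma sets_stream_prefix [measurable]:
  "{J. \<forall>k<n. J !! k = I !! k} \<in> sets (stream_space (count_space (UNIV :: 'm set)))"
proof -
  have "Measurable.pred (stream_space (count_space UNIV)) (\<lambda>J. \<forall>k<n. J !! k = (I::'m stream) !! k)"
    by measurable
  then show ?thesis
    by (simp add: pred_def space_stream_space)
qed

lemma emeasure_stream_prefix:
  fixes P :: "'m::finite pmf"
  shows "emeasure (stream_space (measure_pmf P)) {J. \<forall>k<n. J !! k = I !! k} =
    ennreal (stream_prod (pmf P) n I)"
proof -
  have "(\<integral>\<^sup>+J. indicator {J. \<forall>k<n. J !! k = I !! k} J \<partial>stream_space (measure_pmf P)) =
    ennreal (stream_prod (pmf P) n I)"
  proof (induction n arbitrary: I)
    case 0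
    show ?case
      using prob_space.emeasure_space_1[OF prob_space_stream_pmf[of P]] by simp
  next
    case (Suc n)
    obtain i I' where I: "I = i ## I'" by (metis stream.exhaust_sel)
    have eq: "indicator {J. \<forall>k<Suc n. J !! k = I !! k} (j ## J) =
      (if j = i then indicator {J. \<forall>k<n. J !! k = I' !! k} J else 0 :: ennreal)" for j J
      by (auto simp: I indicator_def All_less_Suc2)
    have "(\<integral>\<^sup>+J. indicator {J. \<forall>k<Suc n. J !! k = I !! k} J \<partial>stream_space (measure_pmf P)) =
      (\<Sum>j\<in>UNIV. ennreal (pmf P j) * (\<integral>\<^sup>+J. (if j = i then indicator {J. \<forall>k<n. J !! k = I' !! k} J else 0)
         \<partial>stream_space (measure_pmf P)))"
      by (subst nn_integral_stream_pmf) (simp_all only: eq, measurable)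
    also have "\<dots> = (\<Sum>j\<in>UNIV. if j = i then ennreal (pmf P j) * ennreal (stream_prod (pmf P) n I') else 0)"
      by (rule sum.cong) (simp_all add: Suc)
    also have "\<dots> = ennreal (stream_prod (pmf P) (Suc n) I)"
      by (simp add: I stream_prod_Suc_Stream ennreal_mult stream_prod_nonneg)
    finally show ?case .
  qed
  then show ?thesis
    by (subst (asm) nn_integral_indicator) simp_all
qed

lemma sets_split: "{J. (\<forall>k<n. J !! k = I !! k) \<and> J !! n \<noteq> I !! n} \<in> sets (stream_space (count_space (UNIV :: 'm set)))"
proof -
  have "{J. (\<forall>k<n. J !! k = I !! k) \<and> J !! n \<noteq> I !! n} =
    {J. \<forall>k<n. J !! k = I !! k} - {J. \<forall>k<Suc n. J !! k = I !! k}"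
    by (auto simp: less_Suc_eq)
  then show ?thesis by simp
qed

lemma stream_eqI: "(\<And>n. I !! n = J !! n) \<Longrightarrow> I = J"
  by (metis stream.map_ident stream_smap_nats ext smap_alt)

lemma sets_stream_singleton: "{I} \<in> sets (stream_space (count_space (UNIV :: 'm set)))"
proof -
  have "{I} = (\<Inter>n. {J. \<forall>k<n. J !! k = I !! k})"
    by (auto intro: stream_eqI)
  then show ?thesis
    by (simp only:) (rule sets.countable_INT, auto)
qed

text \<open>The code \<open>I\<close> itself belongs to every \<open>near a r I\<close> but to no
  \<open>near_split\<close>, so splitting a ball by the length of the common prefix loses it. It
  carries no mass because cylinders shrink geometrically.\<close>

lemma null_stream_singleton:
  fixes P :: "'m::finite pmf"
  assumes "\<And>i. pmf P i < 1"
  shows "emeasure (stream_space (measure_pmf P)) {I} = 0"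
proof -
  define b where "b = Max (range (pmf P))"
  have b: "pmf P i \<le> b" for i unfolding b_def by (rule Max_ge) auto
  have b1: "b < 1" unfolding b_def using assms by (subst Max_less_iff) auto
  have b0: "0 \<le> b" using b[of undefined] pmf_nonneg[of P undefined] by linarith
  have le: "emeasure (stream_space (measure_pmf P)) {I} \<le> ennreal (b ^ n)" for n
  proof -
    have "emeasure (stream_space (measure_pmf P)) {I} \<le> ennreal (stream_prod (pmf P) n I)"
      unfolding emeasure_stream_prefix[symmetric] by (rule emeasure_mono) auto
    also have "\<dots> \<le> ennreal (b ^ n)"
      by (intro ennreal_leI stream_prod_le_power b) simp
    finally show ?thesis .
  qed
  have "(\<lambda>n. ennreal (b ^ n)) \<longlonglongrightarrow> ennreal 0"
    using b0 b1 by (intro tendsto_ennrealI LIMSEQ_power_zero) auto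
  then have "emeasure (stream_space (measure_pmf P)) {I} \<le> ennreal 0"
    by (rule LIMSEQ_le_const) (use le in blast)
  then show ?thesis by simp
qed

text \<open>A Chernoff bound in place of the strong law of large numbers: for small \<open>\<lambda> > 0\<close> the sum
  \<open>\<Sum>i. w i * f i powr \<lambda>\<close> is less than 1, its derivative at \<open>\<lambda> = 0\<close> being negative.\<close>

lemma AE_summable_stream_prod:
  fixes P :: "'m::finite pmf"
  assumes pos: "\<And>i. 0 < f i" and neg: "(\<Sum>i\<in>UNIV. pmf P i * ln (f i)) < 0"
  shows "AE I in stream_space (measure_pmf P). summable (\<lambda>n. stream_prod f n I)"
proof -
  define g where "g l = (\<Sum>i\<in>UNIV. pmf P i * f i powr l)" for l
  have "(g has_real_derivative (\<Sum>i\<in>UNIV. pmf P i * (ln (f i) * f i powr 0))) (at 0)"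
    unfolding g_def using pos by (auto intro!: derivative_eq_intros sum.cong simp: less_imp_neq[THEN not_sym])
  then have "(g has_real_derivative (\<Sum>i\<in>UNIV. pmf P i * ln (f i))) (at 0)"
    using pos by (simp add: less_imp_neq[THEN not_sym])
  from DERIV_neg_dec_right[OF this neg] obtain d where d: "d > 0" "\<And>h. 0 < h \<Longrightarrow> h < d \<Longrightarrow> g h < g 0"
    by auto
  have g0: "g 0 = 1"
    using pos sum_pmf_eq_1[of UNIV P] by (simp add: g_def less_imp_neq[THEN not_sym])
  \<comment> \<open>The cap at 1 gives \<open>x \<le> x powr l\<close> for \<open>0 < x < 1\<close>,
    by which summability passes from the powers to the products themselves.\<close>
  define l where "l = min 1 (d / 2)"
  have l: "0 < l" "l \<le> 1" "g l < 1"
    using d(1) d(2)[of l] g0 by (auto simp: l_def min_def)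
  have g_nonneg: "0 \<le> g l"
    by (simp add: g_def sum_nonneg)
  have "(\<integral>\<^sup>+I. (\<Sum>n. ennreal (stream_prod (\<lambda>i. f i powr l) n I)) \<partial>stream_space (measure_pmf P)) =
     (\<Sum>n. ennreal (g l ^ n))"
    by (subst nn_integral_suminf) (simp_all add: nn_integral_stream_prod g_def)
  also have "\<dots> < \<infinity>"
    using l g_nonneg by (subst suminf_ennreal2) (auto intro!: summable_geometric)
  finally have "AE I in stream_space (measure_pmf P).
    (\<Sum>n. ennreal (stream_prod (\<lambda>i. f i powr l) n I)) \<noteq> \<infinity>"
    by (intro nn_integral_PInf_AE) auto
  then show ?thesis
  proof (rule AE_mp, intro AE_I2 impI)
    fix I assume "(\<Sum>n. ennreal (stream_prod (\<lambda>i. f i powr l) n I)) \<noteq> \<infinity>"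
    then have sm: "summable (\<lambda>n. stream_prod f n I powr l)"
      using summable_suminf_not_top[of "\<lambda>n. stream_prod f n I powr l"] pos
      by (simp add: stream_prod_powr less_imp_le)
    have ev: "\<forall>\<^sub>F n in sequentially. stream_prod f n I powr l < 1"
      using order_tendstoD(2)[OF summable_LIMSEQ_zero[OF sm]] by simp
    have "\<forall>\<^sub>F n in sequentially. norm (stream_prod f n I) \<le> stream_prod f n I powr l"
      using ev
    proof eventually_elim
      case (elim n)
      have p: "0 < stream_prod f n I" using pos by (rule stream_prod_pos)
      have "stream_prod f n I < 1"
        using elim p l(1) ge_one_powr_ge_zero[of "stream_prod f n I" l] by (cases "stream_prod f n I < 1") auto
      then have "stream_prod f n I powr 1 \<le> stream_prod f n I powr l"
        using p l by (intro powr_mono') auto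
      with p show ?case by simp
    qed
    then show "summable (\<lambda>n. stream_prod f n I)"
      using sm by (rule summable_comparison_test_ev)
  qed
qed

section \<open>The coding map and transversality\<close>

text \<open>The point coded by \<open>I\<close> for the maps \<open>u i * x + b i\<close> on the
  line, that is, one coordinate of the coded point. The translations are an argument because
  transversality moves them while the code stays fixed.\<close>

definition coding_series :: "('m \<Rightarrow> real) \<Rightarrow> ('m \<Rightarrow> real) \<Rightarrow> 'm stream \<Rightarrow> real" where
  "coding_series u b I = (\<Sum>n. stream_prod u n I * b (I !! n))"

context
  fixes u :: "'m::finite \<Rightarrow> real" and c :: real
  assumes u_nonneg: "\<And>i. 0 \<le> u i" and u_le: "\<And>i. u i \<le> c" and c_less: "c < 1"
begin

lemma c_nonneg: "0 \<le> c"
  using u_nonneg u_le order_trans by blast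

lemma norm_coding_term_le:
  assumes "\<And>i. \<bar>b i\<bar> \<le> B"
  shows "norm (stream_prod u n I * b (I !! n)) \<le> B * c ^ n"
proof -
  have "\<bar>stream_prod u n I\<bar> * \<bar>b (I !! n)\<bar> \<le> c ^ n * B"
    using stream_prod_le_power[of u c n I] stream_prod_nonneg[of u n I] u_nonneg u_le assms
    by (intro mult_mono) (auto simp: c_nonneg)
  then show ?thesis by (simp add: abs_mult mult.commute)
qed

lemma summable_coding_series: "summable (\<lambda>n. stream_prod u n I * b (I !! n))"
proof (rule summable_comparison_test')
  show "summable (\<lambda>n. (\<Sum>i\<in>UNIV. \<bar>b i\<bar>) * c ^ n)"
    using c_nonneg c_less by (intro summable_mult summable_geometric) auto
  show "norm (stream_prod u n I * b (I !! n)) \<le> (\<Sum>i\<in>UNIV. \<bar>b i\<bar>) * c ^ n" for n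
    by (rule norm_coding_term_le) (rule member_le_sum, auto)
qed

lemma coding_series_Stream:
  "coding_series u b (i ## I) = b i + u i * coding_series u b I"
proof -
  have "coding_series u b (i ## I) = (\<Sum>n. stream_prod u (Suc n) (i ## I) * b ((i ## I) !! Suc n)) + b i"
    unfolding coding_series_def using suminf_split_head[OF summable_coding_series[of "i ## I" b]] by simp
  also have "(\<Sum>n. stream_prod u (Suc n) (i ## I) * b ((i ## I) !! Suc n)) = u i * coding_series u b I"
    unfolding coding_series_def
    by (subst suminf_mult[OF summable_coding_series, symmetric]) (simp add: stream_prod_Suc_Stream mult.assoc)
  finally show ?thesis by simp
qed

lemma abs_coding_series_le:
  assumes "\<And>i. \<bar>b i\<bar> \<le> B"
  shows "\<bar>coding_series u b I\<bar> \<le> B / (1 - c)"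
proof -
  have s: "summable (\<lambda>n. B * c ^ n)"
    using c_nonneg c_less by (intro summable_mult summable_geometric) auto
  have "norm (coding_series u b I) \<le> (\<Sum>n. B * c ^ n)"
    unfolding coding_series_def using norm_coding_term_le[of b B] assms s by (intro norm_suminf_le) auto
  also have "\<dots> = B / (1 - c)"
    using c_nonneg c_less by (simp add: suminf_mult suminf_geometric)
  finally show ?thesis by simp
qed

lemma coding_series_nonneg:
  assumes "\<And>i. 0 \<le> b i"
  shows "0 \<le> coding_series u b I"
  unfolding coding_series_def
  using u_nonneg assms by (intro suminf_nonneg summable_coding_series) (simp add: stream_prod_nonneg)

text \<open>Moving the translations in a direction \<open>b'\<close> moves the coded point at a
  constant rate; transversality reduces to a lower bound for a difference of such rates.\<close>

lemma coding_series_linear: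
  "coding_series u (\<lambda>i. b i + h * b' i) I = coding_series u b I + h * coding_series u b' I"
proof -
  have "(\<lambda>n. stream_prod u n I * b (I !! n) + h * (stream_prod u n I * b' (I !! n)))
      sums (coding_series u b I + h * coding_series u b' I)"
    unfolding coding_series_def by (intro sums_add sums_mult summable_sums summable_coding_series)
  then show ?thesis
    unfolding coding_series_def[of u "\<lambda>i. b i + h * b' i"] by (simp add: sums_iff algebra_simps)
qed

text \<open>A common prefix acts on both tails by the same affine map, so its translations cancel
  and only the linear part remains.\<close>

lemma coding_series_prefix:
  assumes "\<forall>k<n. I !! k = J !! k"
  shows "coding_series u b I - coding_series u b J =
    stream_prod u n I * (coding_series u b (sdrop n I) - coding_series u b (sdrop n J))"
  using assms
proof (induction n arbitrary: I J)
  case (Suc n)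
  obtain i I' where I: "I = i ## I'" by (metis stream.exhaust_sel)
  obtain j J' where J: "J = j ## J'" by (metis stream.exhaust_sel)
  have [simp]: "j = i" using Suc.prems I J by auto
  have "\<forall>k<n. I' !! k = J' !! k" using Suc.prems I J by (auto simp: All_less_Suc2)
  from Suc.IH[OF this] show ?case
    by (simp add: I J coding_series_Stream stream_prod_Suc_Stream mult.assoc
        flip: right_diff_distrib)
qed simp

text \<open>Only the digit at which the two codes split contributes the 1; the digits of \<open>J\<close> after it
  contribute at most \<open>c + c\<^sup>2 + \<dots>\<close>, which is why \<open>c < 1/2\<close> is needed.\<close>

lemma coding_series_separation:
  assumes "shd I = i" "shd J \<noteq> i"
  shows "1 - c / (1 - c) \<le> coding_series u (indicator {i}) I - coding_series u (indicator {i}) J"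
proof -
  obtain i' I' where I: "I = i' ## I'" by (metis stream.exhaust_sel)
  obtain j J' where J: "J = j ## J'" by (metis stream.exhaust_sel)
  have [simp]: "i' = i" "j \<noteq> i" using assms I J by auto
  have "0 \<le> u i * coding_series u (indicator {i}) I'"
    using u_nonneg by (simp add: coding_series_nonneg)
  moreover have "u j * coding_series u (indicator {i}) J' \<le> c * (1 / (1 - c))"
  proof (rule mult_mono)
    have "\<bar>coding_series u (indicator {i}) J'\<bar> \<le> 1 / (1 - c)"
      by (rule abs_coding_series_le) (simp add: indicator_def)
    then show "coding_series u (indicator {i}) J' \<le> 1 / (1 - c)" by simp
  qed (use u_le c_nonneg coding_series_nonneg in auto)
  ultimately show ?thesis by (simp add: I J coding_series_Stream)
qed

end

section \<open>Volume of sublevel sets of functions that are affine along one direction\<close>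

lemma emeasure_translation_lborel:
  fixes v :: "'a::euclidean_space"
  assumes "S \<in> sets borel"
  shows "emeasure lborel ((\<lambda>x. v + x) ` S) = emeasure lborel S" and "(\<lambda>x. v + x) ` S \<in> sets borel"
proof -
  have eq: "(\<lambda>x. v + x) ` S = (\<lambda>x. -v + x) -` S"
    by (auto simp: image_iff intro!: bexI[of _ "-v + x" for x])
  have m: "(\<lambda>x. -v + x) \<in> measurable borel borel" by measurable
  have "(\<lambda>x. -v + x) -` S \<inter> space borel \<in> sets borel"
    by (rule measurable_sets[OF m assms])
  then show *: "(\<lambda>x. v + x) ` S \<in> sets borel" by (simp add: eq)
  have "emeasure lborel S = emeasure (distr lborel borel ((+) (-v))) S"
    by (simp add: lborel_distr_plus)
  also have "\<dots> = emeasure lborel ((\<lambda>x. -v + x) -` S)"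
    using assms by (subst emeasure_distr) auto
  finally show "emeasure lborel ((\<lambda>x. v + x) ` S) = emeasure lborel S" by (simp add: eq)
qed

text \<open>The sublevel set has \<open>\<lfloor>K / (3 r)\<rfloor>\<close> disjoint translates along \<open>e\<close> inside the ball
  of radius \<open>R + 1\<close>.\<close>

lemma emeasure_sublevel_le:
  fixes e :: "'a::euclidean_space" and f :: "'a \<Rightarrow> real"
  assumes f: "f \<in> borel_measurable borel" and e: "norm e = 1" and K: "0 < K" and r: "0 < r"
    and lin: "\<And>a h. f (a + h *\<^sub>R e) = f a + h * K"
  shows "emeasure lborel {a \<in> cball 0 R. \<bar>f a\<bar> \<le> r} \<le>
    ennreal (measure lborel (cball (0::'a) (R + 1)) * min 1 (6 * (r / K)))"
proof -
  define S where "S = {a \<in> cball 0 R. \<bar>f a\<bar> \<le> r}"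
  define V where "V = measure lborel (cball (0::'a) (R + 1))"
  have V: "emeasure lborel (cball (0::'a) (R + 1)) = ennreal V"
    unfolding V_def by (rule emeasure_eq_ennreal_measure) (use emeasure_lborel_cball_finite[of 0 "R+1"] in \<open>simp add: less_top[symmetric]\<close>)
  have V0: "0 \<le> V" by (simp add: V_def)
  have S: "S \<in> sets borel"
    unfolding S_def using f by measurable
  have SV: "S \<subseteq> cball 0 (R + 1)" by (auto simp: S_def)
  \<comment> \<open>For \<open>K < 3 * r\<close> the quantity \<open>6 * (r / K)\<close> exceeds 1
    and the trivial bound by the volume is enough.\<close>
  show ?thesis
  proof (cases "3 * r \<le> K")
    case False
    then have "min 1 (6 * (r / K)) = 1" using K by (simp add: min_def field_simps)
    moreover have "emeasure lborel S \<le> ennreal V"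
      unfolding V[symmetric] using SV by (intro emeasure_mono) auto
    ultimately show ?thesis by (simp add: S_def V_def)
  next
    case True
    define N where "N = nat \<lfloor>K / (3 * r)\<rfloor>"
    \<comment> \<open>A translation by \<open>h\<close> along \<open>e\<close> raises
      \<open>f\<close> by \<open>3 * r\<close>, while the band has width \<open>2 * r\<close>; this
      separates the translates.\<close>
    define h where "h = 3 * r / K"
    have x1: "1 \<le> K / (3 * r)" using True r by simp
    \<comment> \<open>For \<open>x \<ge> 1\<close> the floor is at least \<open>x / 2\<close>; this
      halving turns the 3 into the 6 of the statement.\<close>
    have N1: "K / (6 * r) \<le> real N"
    proof -
      have "K / (3 * r) < real N + 1"
        unfolding N_def using x1 by linarith
      moreover have "1 \<le> N" unfolding N_def using x1 by (simp add: le_nat_iff)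
      ultimately have "K / (3 * r) < 2 * real N" by linarith
      then show ?thesis by (simp add: field_simps)
    qed
    have N2: "real N * h \<le> 1"
    proof -
      have "real N \<le> K / (3 * r)" unfolding N_def using x1 by linarith
      then show ?thesis using r K by (simp add: h_def field_simps)
    qed
    have h0: "0 < h" using r K by (simp add: h_def)
    define A where "A k = (\<lambda>x. (real k * h) *\<^sub>R e + x) ` S" for k
    have A: "A k \<in> sets borel" "emeasure lborel (A k) = emeasure lborel S" for k
      unfolding A_def using emeasure_translation_lborel[OF S] by auto
    have fA: "\<bar>f x - real k * (3 * r)\<bar> \<le> r" if "x \<in> A k" for x k
    proof -
      from that obtain y where y: "y \<in> S" "x = (real k * h) *\<^sub>R e + y" by (auto simp: A_def)
      have "f x = f y + real k * h * K" using lin[of y "real k * h"] y by (simp add: add.commute)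
      then show ?thesis using y K by (simp add: S_def h_def)
    qed
    have "disjoint_family_on A {..<N}"
      unfolding disjoint_family_on_def
    proof (intro ballI impI, rule ccontr)
      fix k l assume kl: "k \<noteq> l" and "A k \<inter> A l \<noteq> {}"
      then obtain x where x: "x \<in> A k" "x \<in> A l" by auto
      have "\<bar>real k * (3 * r) - real l * (3 * r)\<bar> \<le> 2 * r"
        using fA[OF x(1)] fA[OF x(2)] by linarith
      then have "\<bar>real k - real l\<bar> * 3 * r \<le> 2 * r"
        using r by (simp add: abs_mult left_diff_distrib[symmetric] mult.assoc)
      moreover define z where "z = \<bar>real k - real l\<bar>"
      ultimately have "z * 3 \<le> 2" using r by simp
      moreover have "1 \<le> z" unfolding z_def using kl by linarith
      ultimately show False by simp
    qed
    then have "(\<Sum>k<N. emeasure lborel (A k)) = emeasure lborel (\<Union>k<N. A k)"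
      using A by (intro sum_emeasure) auto
    then have "ennreal (real N) * emeasure lborel S = emeasure lborel (\<Union>k<N. A k)"
      by (simp add: A ennreal_of_nat_eq_real_of_nat)
    also have "\<dots> \<le> ennreal V"
      unfolding V[symmetric]
    proof (rule emeasure_mono)
      show "(\<Union>k<N. A k) \<subseteq> cball 0 (R + 1)"
      proof safe
        fix k x assume k: "k < N" and "x \<in> A k"
        then obtain y where y: "y \<in> S" "x = (real k * h) *\<^sub>R e + y" by (auto simp: A_def)
        have "norm x \<le> norm ((real k * h) *\<^sub>R e) + norm y" unfolding y by (rule norm_triangle_ineq)
        also have "norm ((real k * h) *\<^sub>R e) \<le> 1"
        proof -
          have "real k * h \<le> real N * h" using h0 k by (intro mult_right_mono) auto
          from order_trans[OF this N2] h0 e show ?thesis by simp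
        qed
        also have "norm y \<le> R" using y by (simp add: S_def)
        finally show "x \<in> cball 0 (R + 1)" by (simp add: add.commute)
      qed
    qed simp
    finally have *: "ennreal (real N) * emeasure lborel S \<le> ennreal V" .
    have "emeasure lborel S < \<infinity>"
      by (rule order.strict_trans1[OF emeasure_mono[OF SV] emeasure_lborel_cball_finite]) simp
    then have Nf: "emeasure lborel S = ennreal (measure lborel S)"
      by (intro emeasure_eq_ennreal_measure) simp
    have "real N * measure lborel S \<le> V"
      using * V0 by (simp add: Nf ennreal_mult[symmetric] del: ennreal_mult)
    moreover have "K / (6 * r) * measure lborel S \<le> real N * measure lborel S"
      using N1 by (intro mult_right_mono) auto
    ultimately have "K / (6 * r) * measure lborel S \<le> V" by linarith
    then have m1: "measure lborel S \<le> V * (6 * (r / K))" using K r by (simp add: field_simps)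
    have "measure lborel S \<le> V"
      unfolding V_def using SV emeasure_lborel_cball_finite[of 0 "R+1"] S
      by (intro measure_mono_fmeasurable) (auto simp: fmeasurable_def)
    with m1 V0 have "measure lborel S \<le> V * min 1 (6 * (r / K))" by (auto simp: min_def)
    then have "emeasure lborel S \<le> ennreal (V * min 1 (6 * (r / K)))"
      unfolding Nf by (rule ennreal_leI)
    then show ?thesis unfolding S_def V_def .
  qed
qed

text \<open>Interpolates between the trivial bound at \<open>s = 0\<close> and the linear one at
  \<open>s = 1\<close>, so that transversality is available with any exponent in between.\<close>

lemma min_one_le_powr:
  fixes x C s :: real
  assumes "0 < x" "1 \<le> C" "0 \<le> s" "s \<le> 1"
  shows "min 1 (C * x) \<le> C * x powr s"
proof (cases "x \<le> 1")
  case True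
  have "x powr 1 \<le> x powr s" using assms True by (intro powr_mono') auto
  then have "C * x \<le> C * x powr s" using assms by simp
  then show ?thesis by simp
next
  case False
  then have "1 * 1 \<le> C * x powr s" using assms by (intro mult_mono ge_one_powr_ge_zero) auto
  then show ?thesis by (simp add: min_le_iff_disj)
qed

section \<open>Coded points of a diagonal system and their dependence on the translations\<close>

definition coding_map :: "('m::finite \<Rightarrow> 'd::finite \<Rightarrow> real) \<Rightarrow> (real^'d)^'m \<Rightarrow> 'm stream \<Rightarrow> real^'d" where
  "coding_map t a I = (\<chi> j. coding_series (\<lambda>i. t i j) (\<lambda>i. a $ i $ j) I)"

lemma diag_matrix_mult_vec_nth [simp]: "(diag_matrix u *v x) $ j = u j * x $ j"
  by (simp add: diag_matrix_def matrix_vector_mult_def if_distrib[of "\<lambda>y. y * _"] cong: if_cong)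

lemma abs_nth_nth_le_norm: "\<bar>a $ i $ j\<bar> \<le> norm (a :: (real^'d::finite)^'m::finite)"
  by (meson component_le_norm_cart Finite_Cartesian_Product.norm_nth_le order_trans)

text \<open>All maps have their largest entry in the same coordinate \<open>j0\<close>, so the
  largest entry of every product sits there too and is multiplicative along words.\<close>

locale diag_system =
  fixes t :: "'m::finite \<Rightarrow> 'd::finite \<Rightarrow> real" and j0 :: 'd and c :: real
  assumes t_pos: "0 < t i j"
    and t_le_first: "t i j \<le> t i j0"
    and first_le: "t i j0 \<le> c"
    and c_less_half: "c < 1 / 2"
begin

lemma t_le: "t i j \<le> c"
  using t_le_first first_le order_trans by blast

lemma c_pos: "0 < c"
  using t_pos[of undefined j0] first_le[of undefined] by linarith

lemma c_less_1: "c < 1"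
  using c_less_half by simp

abbreviation "ratio i \<equiv> t i j0"

lemmas series_facts = less_imp_le[OF t_pos] t_le c_less_1

lemma coding_map_Stream:
  "coding_map t a (i ## I) = diag_matrix (t i) *v coding_map t a I + a $ i"
  by (simp add: vec_eq_iff coding_map_def coding_series_Stream[OF series_facts])

lemma abs_coding_map_le: "\<bar>coding_map t a I $ j\<bar> \<le> norm a / (1 - c)"
  unfolding coding_map_def using abs_coding_series_le[OF series_facts, of "\<lambda>i. a $ i $ j" "norm a"]
  by (simp add: abs_nth_nth_le_norm)

lemma coding_map_prefix:
  assumes "\<forall>k<n. I !! k = J !! k"
  shows "coding_map t a I $ j - coding_map t a J $ j =
    stream_prod (\<lambda>i. t i j) n I * (coding_map t a (sdrop n I) $ j - coding_map t a (sdrop n J) $ j)"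
  using coding_series_prefix[OF series_facts assms] by (simp add: coding_map_def)

lemma dist_coding_map_le:
  assumes "\<forall>k<n. I !! k = J !! k"
  shows "dist (coding_map t a I) (coding_map t a J) \<le>
    real CARD('d) * (2 * norm a / (1 - c)) * stream_prod ratio n I"
proof -
  have "dist (coding_map t a I) (coding_map t a J) \<le> (\<Sum>j\<in>UNIV. \<bar>(coding_map t a I - coding_map t a J) $ j\<bar>)"
    unfolding dist_norm by (rule norm_le_l1_cart)
  also have "\<dots> \<le> (\<Sum>j\<in>(UNIV :: 'd set). stream_prod ratio n I * (2 * norm a / (1 - c)))"
  proof (rule sum_mono)
    fix j :: 'd
    have "\<bar>(coding_map t a I - coding_map t a J) $ j\<bar> = stream_prod (\<lambda>i. t i j) n I *
      \<bar>coding_map t a (sdrop n I) $ j - coding_map t a (sdrop n J) $ j\<bar>"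
      by (simp add: coding_map_prefix[OF assms] abs_mult stream_prod_nonneg t_pos less_imp_le)
    also have "\<dots> \<le> stream_prod ratio n I * (norm a / (1 - c) + norm a / (1 - c))"
    proof (rule mult_mono)
      show "stream_prod (\<lambda>i. t i j) n I \<le> stream_prod ratio n I"
        by (rule stream_prod_mono) (auto simp: t_pos less_imp_le t_le_first)
      show "\<bar>coding_map t a (sdrop n I) $ j - coding_map t a (sdrop n J) $ j\<bar> \<le> norm a / (1 - c) + norm a / (1 - c)"
        using abs_coding_map_le[of a "sdrop n I" j] abs_coding_map_le[of a "sdrop n J" j] by linarith
    qed (auto intro!: stream_prod_nonneg less_imp_le[OF t_pos])
    finally show "\<bar>(coding_map t a I - coding_map t a J) $ j\<bar> \<le> stream_prod ratio n I * (2 * norm a / (1 - c))"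
      by simp
  qed
  finally show ?thesis by (simp add: mult_ac)
qed

text \<open>Tonelli's theorem needs measurability jointly in the translations and the code. The
  digit selects the component of the translation vector, hence the composition over the countable
  set of digits.\<close>

lemma measurable_coding_map_pair [measurable]:
  "(\<lambda>(a, I). coding_map t a I) \<in> measurable (borel \<Otimes>\<^sub>M stream_space (count_space UNIV)) borel"
proof -
  have *: "(\<lambda>(a, I). coding_map t a I $ j) \<in> borel_measurable (borel \<Otimes>\<^sub>M stream_space (count_space UNIV))" for j
  proof -
    have 1: "(\<lambda>x. fst x $ i $ j) \<in> borel_measurable (borel \<Otimes>\<^sub>M stream_space (count_space UNIV))" for i :: 'm
      by (rule measurable_compose[OF measurable_fst]) (auto intro!: borel_measurable_continuous_onI continuous_intros)
    have 2: "(\<lambda>x. fst x $ (snd x !! n) $ j) \<in>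
        borel_measurable (borel \<Otimes>\<^sub>M stream_space (count_space (UNIV :: 'm set)))" for n
      by (rule measurable_compose_countable'[where g = "\<lambda>x. snd x !! n" and I = UNIV])
         (auto intro!: 1 measurable_compose[OF measurable_snd measurable_snth])
    have 3: "(\<lambda>x. stream_prod (\<lambda>i. t i j) n (snd x)) \<in>
        borel_measurable (borel \<Otimes>\<^sub>M stream_space (count_space (UNIV :: 'm set)))" for n
      by (rule measurable_compose[OF measurable_snd measurable_stream_prod])
    show ?thesis
      unfolding coding_map_def coding_series_def case_prod_beta vec_lambda_beta
      by (intro borel_measurable_suminf borel_measurable_times 2 3)
  qed
  show ?thesis
    unfolding borel_measurable_euclidean_space[of "\<lambda>(a, I). coding_map t a I"]
    using * by (auto simp: Basis_vec_def inner_axis case_prod_beta)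
qed

lemma measurable_coding_map [measurable]:
  "coding_map t a \<in> measurable (stream_space (count_space UNIV)) borel"
  using measurable_compose[OF measurable_Pair1' measurable_coding_map_pair, of a] by simp

lemma measurable_coding_map_left: "(\<lambda>a. coding_map t a I) \<in> measurable borel borel"
  using measurable_compose[OF measurable_Pair2' measurable_coding_map_pair, of I]
  by (simp add: space_stream_space)

text \<open>Equals \<open>(1 - 2 * c) / (1 - c)\<close>, the separation found in
  \<open>coding_series_separation\<close>.\<close>

definition sep_const :: real where "sep_const = 1 - c / (1 - c)"

lemma sep_const: "0 < sep_const" "sep_const \<le> 1"
  using c_pos c_less_half by (auto simp: sep_const_def field_simps)

text \<open>The volume and the 6 come from \<open>emeasure_sublevel_le\<close>;
  \<open>sep_const\<close> bounds the slope per unit of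
  \<open>stream_prod ratio n I\<close>.\<close>

definition transversality_const :: "real \<Rightarrow> real" where
  "transversality_const R = measure lborel (cball (0 :: (real^'d)^'m) (R + 1)) * (6 / sep_const)"

lemma transversality_const_nonneg: "0 \<le> transversality_const R"
  using sep_const by (simp add: transversality_const_def)

text \<open>In coordinate \<open>j0\<close> the two points differ by a function that is affine in
  the translation of the digit \<open>I !! n\<close>. Occurrences of this digit in the common prefix
  cancel, and what remains has slope at least \<open>sep_const\<close> times the ratio of the
  prefix.\<close>

lemma transversality:
  assumes pre: "\<forall>k<n. I !! k = J !! k" and neq: "I !! n \<noteq> J !! n" and r: "0 < r" and s: "0 \<le> s" "s \<le> 1"
  shows "emeasure lborel {a \<in> cball 0 R. dist (coding_map t a I) (coding_map t a J) \<le> r} \<le>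
    ennreal (transversality_const R * r powr s * stream_prod (\<lambda>i. ratio i powr - s) n I)"
proof -
  define W where "W = stream_prod ratio n I"
  have W: "0 < W" unfolding W_def by (intro stream_prod_pos t_pos)
  define f where "f a = coding_map t a I $ j0 - coding_map t a J $ j0" for a
  \<comment> \<open>Moves only the \<open>j0\<close> coordinate of the translation belonging to the
    digit by which \<open>I\<close> leaves \<open>J\<close>.\<close>
  define e :: "(real^'d)^'m" where "e = axis (I !! n) (axis j0 1)"
  define \<Delta> where "\<Delta> = coding_series ratio (indicator {I !! n}) (sdrop n I) -
    coding_series ratio (indicator {I !! n}) (sdrop n J)"
  have \<Delta>: "sep_const \<le> \<Delta>"
    unfolding \<Delta>_def sep_const_def
    by (rule coding_series_separation[OF series_facts]) (use neq in simp_all)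
  have nth: "(\<lambda>i. (a + h *\<^sub>R e) $ i $ j0) = (\<lambda>i. a $ i $ j0 + h * indicator {I !! n} i)" for a h
    by (auto simp: e_def axis_def indicator_def fun_eq_iff)
  have lin: "f (a + h *\<^sub>R e) = f a + h * (W * \<Delta>)" for a h
  proof -
    have "coding_series ratio (indicator {I !! n}) I - coding_series ratio (indicator {I !! n}) J = W * \<Delta>"
      unfolding W_def \<Delta>_def by (rule coding_series_prefix[OF series_facts pre])
    then show ?thesis
      unfolding f_def coding_map_def vec_lambda_beta nth coding_series_linear[OF series_facts]
      by (simp add: algebra_simps flip: distrib_left)
  qed
  have fm: "f \<in> borel_measurable borel"
    unfolding f_def
    by (intro borel_measurable_diff measurable_compose[OF measurable_coding_map_left]
        borel_measurable_continuous_onI continuous_intros)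
  have "emeasure lborel {a \<in> cball 0 R. dist (coding_map t a I) (coding_map t a J) \<le> r} \<le>
    emeasure lborel {a \<in> cball 0 R. \<bar>f a\<bar> \<le> r}"
  proof (rule emeasure_mono)
    have "\<bar>f a\<bar> \<le> dist (coding_map t a I) (coding_map t a J)" for a
      unfolding f_def dist_norm
      using component_le_norm_cart[of "coding_map t a I - coding_map t a J" j0] by simp
    then show "{a \<in> cball 0 R. dist (coding_map t a I) (coding_map t a J) \<le> r} \<subseteq> {a \<in> cball 0 R. \<bar>f a\<bar> \<le> r}"
      using order_trans by blast
    show "{a \<in> cball 0 R. \<bar>f a\<bar> \<le> r} \<in> sets lborel"
      using fm by measurable
  qed
  also have "\<dots> \<le> ennreal (measure lborel (cball (0 :: (real^'d)^'m) (R + 1)) * min 1 (6 * (r / (W * \<Delta>))))"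
    using W \<Delta> sep_const r
    by (intro emeasure_sublevel_le[where e = e] fm lin) (auto simp: e_def norm_eq_sqrt_inner inner_axis_axis intro!: mult_pos_pos)
  also have "\<dots> \<le> ennreal (measure lborel (cball (0 :: (real^'d)^'m) (R + 1)) *
      (6 / sep_const * (r powr s * stream_prod (\<lambda>i. ratio i powr - s) n I)))"
  proof (intro ennreal_leI mult_left_mono)
    have "6 * (r / (W * \<Delta>)) \<le> 6 * (r / (W * sep_const))"
      using W \<Delta> sep_const r by (intro mult_left_mono divide_left_mono) auto
    then have "min 1 (6 * (r / (W * \<Delta>))) \<le> min 1 (6 / sep_const * (r / W))"
      by (auto simp: min_le_iff_disj mult.commute)
    also have "\<dots> \<le> 6 / sep_const * (r / W) powr s"
      using W r sep_const s by (intro min_one_le_powr) (auto simp: field_simps)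
    also have "(r / W) powr s = r powr s * stream_prod (\<lambda>i. ratio i powr - s) n I"
    proof -
      have "stream_prod (\<lambda>i. ratio i powr - s) n I = W powr - s"
        unfolding W_def by (rule stream_prod_powr) (rule less_imp_le[OF t_pos])
      then show ?thesis using W r by (simp add: powr_divide powr_minus_divide)
    qed
    finally show "min 1 (6 * (r / (W * \<Delta>))) \<le> 6 / sep_const * (r powr s * stream_prod (\<lambda>i. ratio i powr - s) n I)" .
  qed simp
  finally show ?thesis by (simp add: transversality_const_def mult.assoc)
qed

end

section \<open>The self-affine measure\<close>

text \<open>Read as a mixture of its images, \<open>\<mu>\<close> is a bind over the digits, and in
  this form the identity for sets passes to integrals.\<close>

lemma nn_integral_self_affine:
  fixes T :: "'m::finite \<Rightarrow> real^'n^'n"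
  assumes sa: "is_self_affine_measure T (pmf P) a \<mu>" and f: "f \<in> borel_measurable borel"
  shows "(\<integral>\<^sup>+x. f x \<partial>\<mu>) = (\<Sum>i\<in>UNIV. ennreal (pmf P i) * (\<integral>\<^sup>+x. f (T i *v x + a $ i) \<partial>\<mu>))"
proof -
  have prob: "prob_space \<mu>" and sets: "sets \<mu> = sets borel"
    using sa by (auto simp: is_self_affine_measure_def)
  have space: "space \<mu> = UNIV" using sets_eq_imp_space_eq[OF sets] by simp
  have S: "(\<lambda>x. T i *v x + a $ i) \<in> measurable \<mu> borel" for i
    unfolding measurable_cong_sets[OF sets refl]
    by (intro borel_measurable_continuous_onI continuous_intros linear_continuous_on
        matrix_vector_mul_bounded_linear)
  define K where "K i = distr \<mu> borel (\<lambda>x. T i *v x + a $ i)" for i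
  have K: "K \<in> measurable (measure_pmf P) (subprob_algebra borel)"
    by (auto simp: K_def space_subprob_algebra intro!: prob_space_imp_subprob_space
        prob_space.prob_space_distr prob S)
  have "\<mu> = measure_pmf P \<bind> K"
  proof (rule measure_eqI)
    show "sets \<mu> = sets (measure_pmf P \<bind> K)"
      by (subst sets_bind[where N = borel]) (auto simp: sets K_def)
    fix A assume A: "A \<in> sets \<mu>"
    have "emeasure (measure_pmf P \<bind> K) A = (\<integral>\<^sup>+i. emeasure (K i) A \<partial>measure_pmf P)"
      using A sets by (intro emeasure_bind[OF _ K]) auto
    also have "\<dots> = (\<Sum>i\<in>UNIV. ennreal (pmf P i) * emeasure \<mu> ((\<lambda>x. T i *v x + a $ i) -` A))"
      using A sets by (subst nn_integral_measure_pmf)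
        (auto simp: nn_integral_count_space_finite K_def emeasure_distr S space)
    also have "\<dots> = emeasure \<mu> A"
      using sa A sets by (simp add: is_self_affine_measure_def)
    finally show "emeasure \<mu> A = emeasure (measure_pmf P \<bind> K) A" by simp
  qed
  then have "(\<integral>\<^sup>+x. f x \<partial>\<mu>) = (\<integral>\<^sup>+i. \<integral>\<^sup>+x. f x \<partial>K i \<partial>measure_pmf P)"
    using nn_integral_bind[OF f K] by simp
  also have "\<dots> = (\<Sum>i\<in>UNIV. ennreal (pmf P i) * (\<integral>\<^sup>+x. f (T i *v x + a $ i) \<partial>\<mu>))"
    by (subst nn_integral_measure_pmf)
       (auto simp: nn_integral_count_space_finite K_def nn_integral_distr S f)
  finally show ?thesis .
qed

text \<open>Orbits converge only pointwise, so it is continuous test functions that pass to the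
  limit. They determine the measure because the indicator of a closed set is a limit of functions of
  the distance to it.\<close>

lemma measure_eqI_closed:
  fixes M N :: "'a::metric_space measure"
  assumes "finite_measure M" "finite_measure N" "sets M = sets borel" "sets N = sets borel"
    and eq: "\<And>f. continuous_on UNIV f \<Longrightarrow> (\<And>x. 0 \<le> f x) \<Longrightarrow> (\<And>x. f x \<le> 1) \<Longrightarrow>
      (\<integral>\<^sup>+x. ennreal (f x) \<partial>M) = (\<integral>\<^sup>+x. ennreal (f x) \<partial>N)"
  shows "M = N"
proof -
  define f where "f C k x = max 0 (1 - real k * infdist x C)" for C k and x :: 'a
  have cont: "continuous_on UNIV (f C k)" for C k
    unfolding f_def by (intro continuous_intros)
  have bds: "0 \<le> f C k x" "f C k x \<le> 1" for C k x
    by (auto simp: f_def infdist_nonneg)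
  \<comment> \<open>For empty \<open>C\<close> this fails: \<open>infdist\<close> to the empty set
    is 0 by convention and \<open>f\<close> would be constantly 1. Hence the separate case of the
    empty set below.\<close>
  have lim: "(\<lambda>k. ennreal (f C k x)) \<longlonglongrightarrow> indicator C x" if "closed C" "C \<noteq> {}" for C x
  proof (cases "x \<in> C")
    case True
    then show ?thesis by (simp add: f_def)
  next
    case False
    then have pos: "0 < infdist x C"
      using in_closed_iff_infdist_zero[OF that] infdist_nonneg[of x C] by (simp add: less_le)
    obtain k0 where k0: "1 < real k0 * infdist x C" using reals_Archimedean3[OF pos] by blast
    have "\<forall>\<^sub>F k in sequentially. ennreal (f C k x) = 0"
      using eventually_ge_at_top[of k0]
    proof eventually_elim
      case (elim k)
      then have "real k0 * infdist x C \<le> real k * infdist x C" using pos by (intro mult_right_mono) auto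
      with k0 show ?case by (simp add: f_def max_def)
    qed
    then show ?thesis using False by (simp add: tendsto_eventually)
  qed
  have em: "(\<lambda>k. \<integral>\<^sup>+x. ennreal (f C k x) \<partial>L) \<longlonglongrightarrow> emeasure L C"
    if "closed C" "C \<noteq> {}" "finite_measure L" "sets L = sets borel" for C L
  proof -
    have m: "(\<lambda>x. ennreal (f C k x)) \<in> borel_measurable L" for k
      unfolding measurable_cong_sets[OF that(4) refl]
      by (intro measurable_compose[OF _ measurable_ennreal] borel_measurable_continuous_onI cont)
    have C: "C \<in> sets L" using that by simp
    have "(\<lambda>k. \<integral>\<^sup>+x. ennreal (f C k x) \<partial>L) \<longlonglongrightarrow> (\<integral>\<^sup>+x. indicator C x \<partial>L)"
    proof (rule nn_integral_dominated_convergence[where w = "\<lambda>_. 1"])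
      show "(\<integral>\<^sup>+x. 1 \<partial>L) < \<infinity>"
        using finite_measure.emeasure_finite[OF that(3)] by (simp add: top.not_eq_extremum)
    qed (use m borel_measurable_indicator[OF C] bds lim that in \<open>auto simp: ennreal_le_1\<close>)
    then show ?thesis using C by simp
  qed
  show ?thesis
  proof (rule measure_eqI_generator_eq[where E = "Collect closed" and \<Omega> = UNIV and A = "\<lambda>_. UNIV"])
    show "Int_stable (Collect closed :: 'a set set)" by (auto simp: Int_stable_def)
    show "emeasure M X = emeasure N X" if "X \<in> Collect closed" for X
    proof (cases "X = {}")
      case False
      have "(\<lambda>k. \<integral>\<^sup>+x. ennreal (f X k x) \<partial>M) \<longlonglongrightarrow> emeasure N X"
        using em[of X N] assms(2,4) that False eq[OF cont bds] by simp
      with em[of X M] assms(1,3) that False show ?thesis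
        using LIMSEQ_unique by blast
    qed simp
    show "emeasure M UNIV \<noteq> \<infinity>"
      using finite_measure.emeasure_finite[OF assms(1), of UNIV] by simp
  qed (use assms in \<open>auto simp: borel_eq_closed\<close>)
qed

text \<open>The first digit is applied last, so each further digit acts innermost, where the
  contractions of all earlier digits damp it. This makes the orbit converge for every code.\<close>

primrec ifs_orbit :: "('m \<Rightarrow> 'a \<Rightarrow> 'a) \<Rightarrow> nat \<Rightarrow> 'm stream \<Rightarrow> 'a \<Rightarrow> 'a" where
  "ifs_orbit S 0 I y = y"
| "ifs_orbit S (Suc n) I y = S (shd I) (ifs_orbit S n (stl I) y)"

lemma measurable_ifs_orbit:
  fixes S :: "'m::finite \<Rightarrow> 'a::topological_space \<Rightarrow> 'a"
  assumes S: "\<And>i. S i \<in> measurable borel borel"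
  shows "(\<lambda>(I, y). ifs_orbit S n I y) \<in> measurable (stream_space (count_space UNIV) \<Otimes>\<^sub>M borel) borel"
proof (induction n)
  case 0
  show ?case by simp
next
  case (Suc n)
  have "(\<lambda>x. (stl (fst x), snd x)) \<in>
    measurable (stream_space (count_space (UNIV :: 'm set)) \<Otimes>\<^sub>M borel) (stream_space (count_space UNIV) \<Otimes>\<^sub>M (borel :: 'a measure))"
    by measurable
  from measurable_compose[OF this Suc]
  have 1: "(\<lambda>x. ifs_orbit S n (stl (fst x)) (snd x)) \<in>
    measurable (stream_space (count_space UNIV) \<Otimes>\<^sub>M borel) borel"
    by simp
  have "(\<lambda>x. S (shd (fst x)) (ifs_orbit S n (stl (fst x)) (snd x))) \<in>
    measurable (stream_space (count_space UNIV) \<Otimes>\<^sub>M borel) borel"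
    by (rule measurable_compose_countable'[where g = "\<lambda>x. shd (fst x)" and I = UNIV])
       (auto intro!: measurable_compose[OF 1 S] measurable_compose[OF measurable_fst measurable_shd])
  then show ?case by (simp add: case_prod_beta)
qed

context diag_system
begin

abbreviation "ifs_map a i x \<equiv> diag_matrix (t i) *v x + a $ i"

lemma measurable_ifs_map: "ifs_map a i \<in> measurable borel borel"
  by (intro borel_measurable_continuous_onI continuous_intros linear_continuous_on
        matrix_vector_mul_bounded_linear)

text \<open>Existence: dropping the first digit of a random code leaves a code of the same
  law.\<close>

lemma is_self_affine_coding:
  "is_self_affine_measure (\<lambda>i. diag_matrix (t i)) (pmf P) a
     (distr (stream_space (measure_pmf P)) borel (coding_map t a))"
  unfolding is_self_affine_measure_def
proof (intro conjI ballI)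
  let ?\<mu> = "distr (stream_space (measure_pmf P)) borel (coding_map t a)"
  show "prob_space ?\<mu>"
    by (intro prob_space.prob_space_distr prob_space_stream_pmf) measurable
  show "sets ?\<mu> = sets borel" by simp
  fix A :: "(real^'d) set" assume A [measurable]: "A \<in> sets borel"
  have pre: "ifs_map a i -` A \<in> sets borel" for i
    using measurable_sets[OF measurable_ifs_map A] by simp
  have em: "emeasure ?\<mu> B = (\<integral>\<^sup>+I. indicator B (coding_map t a I) \<partial>stream_space (measure_pmf P))"
    if "B \<in> sets borel" for B
    using that by (subst nn_integral_distr[symmetric, where M' = borel]) auto
  show "emeasure ?\<mu> A = (\<Sum>i\<in>UNIV. ennreal (pmf P i) * emeasure ?\<mu> (ifs_map a i -` A))"
    unfolding em[OF A] em[OF pre]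
    by (subst nn_integral_stream_pmf) (auto simp: coding_map_Stream indicator_def intro!: sum.cong)
qed

lemma ifs_orbit_nth:
  "ifs_orbit (ifs_map a) n I y $ j - coding_map t a I $ j =
    stream_prod (\<lambda>i. t i j) n I * (y $ j - coding_map t a (sdrop n I) $ j)"
proof (induction n arbitrary: I)
  case (Suc n)
  obtain i I' where I: "I = i ## I'" by (metis stream.exhaust_sel)
  show ?case
    using Suc[of I']
    by (simp add: I coding_map_Stream stream_prod_Suc_Stream mult.assoc flip: right_diff_distrib)
qed simp

lemma ifs_orbit_tendsto: "(\<lambda>n. ifs_orbit (ifs_map a) n I y) \<longlonglongrightarrow> coding_map t a I"
proof (rule vec_tendstoI)
  fix j
  have "(\<lambda>n. ifs_orbit (ifs_map a) n I y $ j - coding_map t a I $ j) \<longlonglongrightarrow> 0"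
  proof (rule Lim_null_comparison)
    show "\<forall>\<^sub>F n in sequentially. norm (ifs_orbit (ifs_map a) n I y $ j - coding_map t a I $ j)
        \<le> c ^ n * (\<bar>y $ j\<bar> + norm a / (1 - c))"
    proof (intro always_eventually allI)
      fix n
      show "norm (ifs_orbit (ifs_map a) n I y $ j - coding_map t a I $ j)
        \<le> c ^ n * (\<bar>y $ j\<bar> + norm a / (1 - c))"
        unfolding ifs_orbit_nth real_norm_def abs_mult
      proof (rule mult_mono)
        show "\<bar>stream_prod (\<lambda>i. t i j) n I\<bar> \<le> c ^ n"
          using stream_prod_nonneg[of "\<lambda>i. t i j" n I] stream_prod_le_power[of "\<lambda>i. t i j" c n I]
          by (simp add: less_imp_le[OF t_pos] t_le)
        show "\<bar>y $ j - coding_map t a (sdrop n I) $ j\<bar> \<le> \<bar>y $ j\<bar> + norm a / (1 - c)"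
          using abs_coding_map_le[of a "sdrop n I" j] by linarith
      qed (use c_pos in auto)
    qed
    have "(\<lambda>n. c ^ n) \<longlonglongrightarrow> 0" using c_pos c_less_1 by (intro LIMSEQ_power_zero) auto
    then show "(\<lambda>n. c ^ n * (\<bar>y $ j\<bar> + norm a / (1 - c))) \<longlonglongrightarrow> 0"
      by (rule tendsto_mult_left_zero)
  qed
  then show "(\<lambda>n. ifs_orbit (ifs_map a) n I y $ j) \<longlonglongrightarrow> coding_map t a I $ j"
    by (simp add: LIM_zero_iff)
qed

text \<open>If \<open>y\<close> has law \<open>\<mu>\<close> and the digits are independent with law
  \<open>P\<close>, the orbit point again has law \<open>\<mu>\<close>, for every \<open>n\<close>.
  The induction absorbs the outermost map into the test function.\<close>

lemma nn_integral_ifs_orbit: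
  assumes sa: "is_self_affine_measure (\<lambda>i. diag_matrix (t i)) (pmf P) a \<mu>"
    and f: "f \<in> borel_measurable borel"
  shows "(\<integral>\<^sup>+I. \<integral>\<^sup>+y. f (ifs_orbit (ifs_map a) n I y) \<partial>\<mu> \<partial>stream_space (measure_pmf P)) = (\<integral>\<^sup>+x. f x \<partial>\<mu>)"
  using f
proof (induction n arbitrary: f)
  case 0
  show ?case
    using prob_space.emeasure_space_1[OF prob_space_stream_pmf[of P]] by simp
next
  case (Suc n)
  have prob: "prob_space \<mu>" and sets: "sets \<mu> = sets borel"
    using sa by (auto simp: is_self_affine_measure_def)
  interpret prob_space \<mu> by (rule prob)
  have m: "(\<lambda>(I, y). f (ifs_orbit (ifs_map a) (Suc n) I y)) \<in>
      borel_measurable (stream_space (count_space UNIV) \<Otimes>\<^sub>M \<mu>)"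
    using measurable_compose[OF measurable_ifs_orbit[where n = "Suc n" and S = "ifs_map a", OF measurable_ifs_map] Suc.prems]
    unfolding measurable_cong_sets[OF sets_pair_measure_cong[OF refl sets] refl]
    by (simp only: split_beta')
  have "(\<integral>\<^sup>+I. \<integral>\<^sup>+y. f (ifs_orbit (ifs_map a) (Suc n) I y) \<partial>\<mu> \<partial>stream_space (measure_pmf P)) =
    (\<Sum>i\<in>UNIV. ennreal (pmf P i) *
      (\<integral>\<^sup>+I. \<integral>\<^sup>+y. f (ifs_map a i (ifs_orbit (ifs_map a) n I y)) \<partial>\<mu> \<partial>stream_space (measure_pmf P)))"
    by (subst nn_integral_stream_pmf) (use borel_measurable_nn_integral[OF m] in simp_all)
  also have "\<dots> = (\<Sum>i\<in>UNIV. ennreal (pmf P i) * (\<integral>\<^sup>+y. f (ifs_map a i y) \<partial>\<mu>))"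
    by (intro sum.cong refl arg_cong2[of _ _ _ _ "(*)"]
        Suc.IH[OF measurable_compose[OF measurable_ifs_map Suc.prems]])
  also have "\<dots> = (\<integral>\<^sup>+x. f x \<partial>\<mu>)"
    by (rule nn_integral_self_affine[OF sa Suc.prems, symmetric])
  finally show ?case .
qed

text \<open>Each finite orbit has law \<open>\<mu>\<close>, while its limit no longer depends on the
  starting point; dominated convergence identifies the integrals of continuous functions. This
  justifies the definite description in \<open>self_affine_measure\<close>.\<close>

lemma self_affine_unique:
  assumes sa: "is_self_affine_measure (\<lambda>i. diag_matrix (t i)) (pmf P) a \<mu>"
  shows "\<mu> = distr (stream_space (measure_pmf P)) borel (coding_map t a)"
proof (rule measure_eqI_closed)
  let ?P = "stream_space (measure_pmf P)"
  have prob: "prob_space \<mu>" and sets: "sets \<mu> = sets borel"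
    using sa by (auto simp: is_self_affine_measure_def)
  interpret \<mu>: prob_space \<mu> by (rule prob)
  interpret Q: prob_space ?P by (rule prob_space_stream_pmf)
  interpret pair_prob_space ?P \<mu> ..
  show "sets \<mu> = sets borel" by (rule sets)
  show "finite_measure \<mu>" by (rule \<mu>.finite_measure_axioms)
  show "finite_measure (distr ?P borel (coding_map t a))"
    by (intro Q.finite_measure_distr) measurable
  fix f :: "real^'d \<Rightarrow> real"
  assume cont: "continuous_on UNIV f" and f: "\<And>x. 0 \<le> f x" "\<And>x. f x \<le> 1"
  have fm [measurable]: "f \<in> borel_measurable borel"
    by (rule borel_measurable_continuous_onI[OF cont])
  have m: "(\<lambda>(I, y). ennreal (f (ifs_orbit (ifs_map a) n I y))) \<in> borel_measurable (?P \<Otimes>\<^sub>M \<mu>)" for n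
    using measurable_compose[OF measurable_ifs_orbit[where n = n and S = "ifs_map a", OF measurable_ifs_map]
        measurable_compose[OF fm measurable_ennreal]]
    unfolding measurable_cong_sets[OF sets_pair_measure_cong[OF sets_stream_pmf sets] refl]
    by (simp only: split_beta')
  have m': "(\<lambda>(I, y). ennreal (f (coding_map t a I))) \<in> borel_measurable (?P \<Otimes>\<^sub>M \<mu>)"
    by measurable
  have "(\<lambda>n. \<integral>\<^sup>+z. (case z of (I, y) \<Rightarrow> ennreal (f (ifs_orbit (ifs_map a) n I y))) \<partial>(?P \<Otimes>\<^sub>M \<mu>))
      \<longlonglongrightarrow> (\<integral>\<^sup>+z. (case z of (I, y) \<Rightarrow> ennreal (f (coding_map t a I))) \<partial>(?P \<Otimes>\<^sub>M \<mu>))"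
  proof (rule nn_integral_dominated_convergence[where w = "\<lambda>_. 1"])
    show "AE z in ?P \<Otimes>\<^sub>M \<mu>. (\<lambda>n. case z of (I, y) \<Rightarrow> ennreal (f (ifs_orbit (ifs_map a) n I y)))
        \<longlonglongrightarrow> (case z of (I, y) \<Rightarrow> ennreal (f (coding_map t a I)))"
      by (intro AE_I2) (auto simp: case_prod_beta
          intro!: tendsto_ennrealI continuous_on_tendsto_compose[OF cont] ifs_orbit_tendsto)
  qed (use m m' f P.emeasure_space_1 in \<open>auto simp: ennreal_le_1\<close>)
  moreover have "(\<integral>\<^sup>+z. (case z of (I, y) \<Rightarrow> ennreal (f (ifs_orbit (ifs_map a) n I y))) \<partial>(?P \<Otimes>\<^sub>M \<mu>)) =
      (\<integral>\<^sup>+x. ennreal (f x) \<partial>\<mu>)" for n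
    using \<mu>.nn_integral_fst[OF m, of n] nn_integral_ifs_orbit[OF sa measurable_compose[OF fm measurable_ennreal], of n]
    by simp
  moreover have "(\<integral>\<^sup>+z. (case z of (I, y) \<Rightarrow> ennreal (f (coding_map t a I))) \<partial>(?P \<Otimes>\<^sub>M \<mu>)) =
      (\<integral>\<^sup>+x. ennreal (f x) \<partial>distr ?P borel (coding_map t a))"
    using \<mu>.nn_integral_fst[OF m'] \<mu>.emeasure_space_1 by (simp add: nn_integral_distr)
  ultimately show "(\<integral>\<^sup>+x. ennreal (f x) \<partial>\<mu>) = (\<integral>\<^sup>+x. ennreal (f x) \<partial>distr ?P borel (coding_map t a))"
    by (simp add: LIMSEQ_const_iff)
qed simp

lemma self_affine_measure_eq:
  "self_affine_measure (\<lambda>i. diag_matrix (t i)) (pmf P) a =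
     distr (stream_space (measure_pmf P)) borel (coding_map t a)"
  unfolding self_affine_measure_def
  using is_self_affine_coding self_affine_unique by (rule the_equality)

end

section \<open>Expected mass of balls\<close>

context diag_system
begin

text \<open>The ball around the coded point, pulled back to the codes. Its Bernoulli mass is the
  mass of the ball under the self-affine measure, while \<open>I\<close> may be drawn from a
  different law.\<close>

definition near :: "(real^'d)^'m \<Rightarrow> real \<Rightarrow> 'm stream \<Rightarrow> 'm stream set" where
  "near a r I = {J. dist (coding_map t a I) (coding_map t a J) \<le> r}"

definition near_split :: "nat \<Rightarrow> (real^'d)^'m \<Rightarrow> real \<Rightarrow> 'm stream \<Rightarrow> 'm stream set" where
  "near_split n a r I = {J \<in> near a r I. (\<forall>k<n. J !! k = I !! k) \<and> J !! n \<noteq> I !! n}"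

lemma measurable_dist_coding:
  "(\<lambda>((a, I), J). dist (coding_map t a I) (coding_map t a J)) \<in>
     borel_measurable ((borel \<Otimes>\<^sub>M stream_space (count_space UNIV)) \<Otimes>\<^sub>M stream_space (count_space UNIV))"
proof -
  have 1: "(\<lambda>x. coding_map t (fst (fst x)) (snd (fst x))) \<in>
    measurable ((borel \<Otimes>\<^sub>M stream_space (count_space UNIV)) \<Otimes>\<^sub>M stream_space (count_space (UNIV::'m set))) borel"
    using measurable_compose[OF measurable_fst measurable_coding_map_pair] by (simp add: split_beta')
  have "(\<lambda>x. (fst (fst x), snd x)) \<in>
    measurable ((borel \<Otimes>\<^sub>M stream_space (count_space UNIV)) \<Otimes>\<^sub>M stream_space (count_space (UNIV::'m set)))
      ((borel :: ((real^'d)^'m) measure) \<Otimes>\<^sub>M stream_space (count_space UNIV))"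
    by measurable
  from measurable_compose[OF this measurable_coding_map_pair]
  have 2: "(\<lambda>x. coding_map t (fst (fst x)) (snd x)) \<in>
    measurable ((borel \<Otimes>\<^sub>M stream_space (count_space UNIV)) \<Otimes>\<^sub>M stream_space (count_space (UNIV::'m set))) borel"
    by simp
  show ?thesis
    unfolding split_beta' by (rule borel_measurable_dist[OF 1 2])
qed

lemma sets_near_pair:
  "{x. snd x \<in> near (fst (fst x)) r (snd (fst x))} \<in>
     sets ((borel \<Otimes>\<^sub>M stream_space (count_space UNIV)) \<Otimes>\<^sub>M stream_space (count_space UNIV))"
  using measurable_sets[OF measurable_dist_coding, of "{..r}"]
  by (simp add: near_def split_beta' vimage_def space_pair_measure space_stream_space)

lemma sets_near [measurable]: "near a r I \<in> sets (stream_space (count_space UNIV))"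
  using sets_Pair1[OF sets_near_pair, of "(a, I)" r] by (simp add: vimage_def)

lemma near_split_eq: "near_split n a r I = near a r I \<inter> {J. (\<forall>k<n. J !! k = I !! k) \<and> J !! n \<noteq> I !! n}"
  by (auto simp: near_split_def)

lemma sets_near_split [measurable]: "near_split n a r I \<in> sets (stream_space (count_space UNIV))"
  unfolding near_split_eq by (intro sets.Int sets_near sets_split)

lemma measurable_measure_near [measurable]:
  "(\<lambda>(a, I). measure (stream_space (measure_pmf P)) (near a r I)) \<in>
     borel_measurable (borel \<Otimes>\<^sub>M stream_space (count_space UNIV))"
proof -
  interpret prob_space "stream_space (measure_pmf P)" by (rule prob_space_stream_pmf)
  have "(\<lambda>x. emeasure (stream_space (measure_pmf P)) (Pair x -` {x. snd x \<in> near (fst (fst x)) r (snd (fst x))}))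
      \<in> borel_measurable (borel \<Otimes>\<^sub>M stream_space (count_space UNIV))"
    using sets_near_pair[of r] unfolding sets_pair_measure_cong[OF refl sets_stream_pmf[of P, symmetric]]
    by (rule measurable_emeasure_Pair)
  then show ?thesis
    unfolding measure_def by (simp add: split_beta' vimage_def)
qed

lemma sets_near_pair_left:
  "{x. snd x \<in> near (fst x) r I} \<in> sets (borel \<Otimes>\<^sub>M stream_space (count_space UNIV))"
proof -
  have "(\<lambda>x. ((fst x, I), snd x)) \<in> measurable (borel \<Otimes>\<^sub>M stream_space (count_space UNIV))
    ((borel \<Otimes>\<^sub>M stream_space (count_space UNIV)) \<Otimes>\<^sub>M stream_space (count_space (UNIV::'m set)))"
    by (intro measurable_Pair measurable_fst measurable_snd measurable_const) (auto simp: space_stream_space)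
  from measurable_sets[OF this sets_near_pair[of r]] show ?thesis
    by (simp add: vimage_def space_pair_measure space_stream_space)
qed

lemma measurable_emeasure_near_split:
  "(\<lambda>a. emeasure (stream_space (measure_pmf P)) (near_split n a r I)) \<in> borel_measurable borel"
proof -
  let ?D = "{J. (\<forall>k<n. J !! k = I !! k) \<and> J !! n \<noteq> I !! n}"
  interpret prob_space "stream_space (measure_pmf P)" by (rule prob_space_stream_pmf)
  have "{x. snd x \<in> near (fst x) r I} \<inter> (UNIV \<times> ?D) \<in> sets (borel \<Otimes>\<^sub>M stream_space (count_space UNIV))"
    by (intro sets.Int sets_near_pair_left pair_measureI sets_split) simp
  then have "{x. snd x \<in> near (fst x) r I} \<inter> (UNIV \<times> ?D) \<in> sets (borel \<Otimes>\<^sub>M stream_space (measure_pmf P))"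
    by (simp add: sets_pair_measure_cong[OF refl sets_stream_pmf])
  from measurable_emeasure_Pair[OF this] show ?thesis
    by (simp add: near_split_eq vimage_def Int_def)
qed

lemma emeasure_near_split_le:
  "emeasure (stream_space (measure_pmf P)) (near_split n a r I) \<le> ennreal (stream_prod (pmf P) n I)"
  unfolding emeasure_stream_prefix[symmetric]
  by (rule emeasure_mono) (auto simp: near_split_def)

lemma emeasure_near_le_suminf:
  assumes "\<And>i. pmf P i < 1"
  shows "emeasure (stream_space (measure_pmf P)) (near a r I) \<le>
    (\<Sum>n. emeasure (stream_space (measure_pmf P)) (near_split n a r I))"
proof -
  have cover: "near a r I - {I} \<subseteq> (\<Union>n. near_split n a r I)"
  proof
    fix J assume J: "J \<in> near a r I - {I}"
    have "\<exists>n. J !! n \<noteq> I !! n"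
      using J by (auto intro: stream_eqI)
    then have "\<exists>n. J !! n \<noteq> I !! n \<and> (\<forall>k<n. J !! k = I !! k)"
      using exists_least_iff[of "\<lambda>n. J !! n \<noteq> I !! n"] by auto
    with J show "J \<in> (\<Union>n. near_split n a r I)" by (auto simp: near_split_def)
  qed
  have un: "(\<Union>n. near_split n a r I) \<in> sets (stream_space (measure_pmf P))"
    unfolding sets_stream_pmf by (intro sets.countable_UN) (auto simp: sets_near_split)
  have "emeasure (stream_space (measure_pmf P)) (near a r I) \<le>
    emeasure (stream_space (measure_pmf P)) ({I} \<union> (\<Union>n. near_split n a r I))"
  proof (rule emeasure_mono)
    have "{I} \<in> sets (stream_space (measure_pmf P))"
      by (simp add: sets_stream_pmf sets_stream_singleton)
    then show "{I} \<union> (\<Union>n. near_split n a r I) \<in> sets (stream_space (measure_pmf P))" using un by blast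
  qed (use cover in blast)
  also have "\<dots> \<le> emeasure (stream_space (measure_pmf P)) {I} +
    emeasure (stream_space (measure_pmf P)) (\<Union>n. near_split n a r I)"
    using un by (intro emeasure_subadditive) (simp_all add: sets_stream_pmf sets_stream_singleton)
  also have "\<dots> \<le> 0 + (\<Sum>n. emeasure (stream_space (measure_pmf P)) (near_split n a r I))"
    unfolding null_stream_singleton[OF assms]
    by (intro add_left_mono emeasure_subadditive_countably) (auto simp: sets_stream_pmf sets_near_split)
  finally show ?thesis by simp
qed

text \<open>With \<open>J\<close> fixed, the integral over the translations is bounded by
  \<open>transversality\<close> uniformly in \<open>J\<close>; the remaining integral over
  \<open>J\<close> is at most the mass of the cylinder, which supplies the factors
  \<open>pmf P i\<close>.\<close>

lemma expected_near_split:
  assumes r: "0 < r" and s: "0 \<le> s" "s \<le> 1"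
  shows "(\<integral>\<^sup>+a. emeasure (stream_space (measure_pmf P)) (near_split n a r I) * indicator (cball 0 R) a \<partial>lborel) \<le>
    ennreal (transversality_const R * r powr s * stream_prod (\<lambda>i. pmf P i * ratio i powr - s) n I)"
proof -
  let ?P = "stream_space (measure_pmf P)"
  let ?D = "{J. (\<forall>k<n. J !! k = I !! k) \<and> J !! n \<noteq> I !! n}"
  let ?C = "transversality_const R * r powr s * stream_prod (\<lambda>i. ratio i powr - s) n I"
  interpret Q: prob_space ?P by (rule prob_space_stream_pmf)
  interpret pair_sigma_finite lborel ?P ..
  have D: "?D \<in> sets ?P" by (simp add: sets_stream_pmf sets_split)
  have m: "(\<lambda>(a, J). indicator (near a r I) J :: ennreal) \<in> borel_measurable (lborel \<Otimes>\<^sub>M ?P)"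
  proof -
    have "(indicator {x. snd x \<in> near (fst x) r I} :: _ \<Rightarrow> ennreal) \<in> borel_measurable (lborel \<Otimes>\<^sub>M ?P)"
      using sets_near_pair_left by (intro borel_measurable_indicator)
        (simp add: sets_pair_measure_cong[OF sets_lborel sets_stream_pmf])
    moreover have "(\<lambda>(a, J). indicator (near a r I) J) = (indicator {x. snd x \<in> near (fst x) r I} :: _ \<Rightarrow> ennreal)"
      by (auto simp: fun_eq_iff indicator_def)
    ultimately show ?thesis by simp
  qed
  have mD: "(\<lambda>(a, J). indicator (near a r I) J * indicator ?D J * indicator (cball 0 R) a :: ennreal)
      \<in> borel_measurable (lborel \<Otimes>\<^sub>M ?P)"
  proof -
    have 1: "(\<lambda>x. indicator ?D (snd x) :: ennreal) \<in> borel_measurable (lborel \<Otimes>\<^sub>M ?P)"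
      by (rule measurable_compose[OF measurable_snd borel_measurable_indicator[OF D]])
    have 2: "(\<lambda>x. indicator (cball 0 R) (fst x) :: ennreal) \<in> borel_measurable (lborel \<Otimes>\<^sub>M ?P)"
      by (rule measurable_compose[OF measurable_fst borel_measurable_indicator]) simp
    show ?thesis
      using borel_measurable_times_ennreal[OF borel_measurable_times_ennreal[OF m 1] 2]
      by (simp only: split_beta')
  qed
  have "(\<integral>\<^sup>+a. emeasure ?P (near_split n a r I) * indicator (cball 0 R) a \<partial>lborel) =
    (\<integral>\<^sup>+a. \<integral>\<^sup>+J. indicator (near a r I) J * indicator ?D J * indicator (cball 0 R) a \<partial>?P \<partial>lborel)"
  proof (rule nn_integral_cong)
    fix a
    have "(\<lambda>J. indicator (near a r I) J * indicator ?D J) = (indicator (near_split n a r I) :: _ \<Rightarrow> ennreal)"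
      by (auto simp: near_split_eq indicator_def fun_eq_iff)
    moreover have "near_split n a r I \<in> sets ?P" by (simp add: sets_stream_pmf sets_near_split)
    ultimately show "emeasure ?P (near_split n a r I) * indicator (cball 0 R) a =
      (\<integral>\<^sup>+J. indicator (near a r I) J * indicator ?D J * indicator (cball 0 R) a \<partial>?P)"
      by (simp add: nn_integral_multc)
  qed
  also have "\<dots> = (\<integral>\<^sup>+J. \<integral>\<^sup>+a. indicator (near a r I) J * indicator ?D J * indicator (cball 0 R) a \<partial>lborel \<partial>?P)"
    using Fubini'[OF mD] by simp
  also have "\<dots> \<le> (\<integral>\<^sup>+J. ennreal ?C * indicator ?D J \<partial>?P)"
  proof (rule nn_integral_mono)
    fix J
    show "(\<integral>\<^sup>+a. indicator (near a r I) J * indicator ?D J * indicator (cball 0 R) a \<partial>lborel) \<le> ennreal ?C * indicator ?D J"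
    proof (cases "J \<in> ?D")
      case True
      define S where "S = {a \<in> cball 0 R. dist (coding_map t a I) (coding_map t a J) \<le> r}"
      have "S \<in> sets borel"
        unfolding S_def using measurable_coding_map_left[of I] measurable_coding_map_left[of J] by measurable
      have "(\<lambda>a. indicator (near a r I) J * indicator ?D J * indicator (cball 0 R) a) = (indicator S :: _ \<Rightarrow> ennreal)"
        using True by (auto simp: S_def near_def indicator_def fun_eq_iff)
      then have "(\<integral>\<^sup>+a. indicator (near a r I) J * indicator ?D J * indicator (cball 0 R) a \<partial>lborel) = emeasure lborel S"
        using \<open>S \<in> sets borel\<close> by simp
      also have "\<dots> \<le> ennreal ?C"
        unfolding S_def using True by (intro transversality r s) auto
      finally show ?thesis using True by simp
    qed simp
  qed
  also have "\<dots> = ennreal ?C * emeasure ?P ?D"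
    using D by (simp add: nn_integral_cmult)
  also have "\<dots> \<le> ennreal ?C * ennreal (stream_prod (pmf P) n I)"
    unfolding emeasure_stream_prefix[symmetric]
    by (intro mult_left_mono emeasure_mono) auto
  also have "\<dots> = ennreal (transversality_const R * r powr s * stream_prod (\<lambda>i. pmf P i * ratio i powr - s) n I)"
    by (simp add: stream_prod_mult stream_prod_nonneg transversality_const_nonneg mult_ac flip: ennreal_mult)
  finally show ?thesis .
qed


text \<open>With \<open>c\<^sub>n = (1 - \<gamma>) / 2 * \<gamma> ^ n\<close>, which sum to 1/2, a countable union of mass \<open>A > 0\<close>
  has a piece of mass at least \<open>c\<^sub>n * A\<close>; this replaces Minkowski's inequality.\<close>

lemma measure_near_powr_le:
  assumes P: "\<And>i. 0 < pmf P i" "\<And>i. pmf P i < 1" and q: "2 \<le> q" and \<gamma>: "0 < \<gamma>" "\<gamma> < 1"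
  shows "ennreal (measure (stream_space (measure_pmf P)) (near a r I) powr (q - 1)) \<le>
    (\<Sum>n. ennreal (((1 - \<gamma>) / 2 * \<gamma> ^ n) powr (1 - q) * stream_prod (pmf P) n I powr (q - 2)) *
      emeasure (stream_space (measure_pmf P)) (near_split n a r I))"
proof -
  let ?P = "stream_space (measure_pmf P)"
  interpret prob_space ?P by (rule prob_space_stream_pmf)
  define A where "A = measure ?P (near a r I)"
  define F where "F n = measure ?P (near_split n a r I)" for n
  define d where "d n = (1 - \<gamma>) / 2 * \<gamma> ^ n" for n
  have d: "0 < d n" for n using \<gamma> by (simp add: d_def)
  have d_sums: "d sums (1 / 2)"
  proof -
    have "(1 - \<gamma>) / 2 * (1 / (1 - \<gamma>)) = 1 / 2" using \<gamma> by simp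
    moreover have "d sums ((1 - \<gamma>) / 2 * (1 / (1 - \<gamma>)))"
      unfolding d_def using \<gamma> by (intro sums_mult geometric_sums) auto
    ultimately show ?thesis by (simp only:)
  qed
  show ?thesis
  proof (cases "A = 0")
    case True
    then show ?thesis by (simp add: A_def)
  next
    case False
    then have A: "0 < A" using measure_nonneg[of ?P "near a r I"] by (simp add: A_def less_le)
    have "\<exists>n. d n * A \<le> F n"
    proof (rule ccontr)
      assume "\<not> ?thesis"
      then have F: "F n \<le> d n * A" for n by (meson linorder_not_le less_imp_le)
      have "ennreal A \<le> (\<Sum>n. ennreal (F n))"
        using emeasure_near_le_suminf[OF P(2)] by (simp add: A_def F_def emeasure_eq_measure)
      also have "\<dots> \<le> (\<Sum>n. ennreal (d n * A))"
        by (intro suminf_le ennreal_leI F) auto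
      also have "\<dots> = ennreal (1 / 2 * A)"
        using sums_mult2[OF d_sums, of A] d A
        by (intro suminf_ennreal_eq) (auto intro: less_imp_le)
      finally show False using A by simp
    qed
    then obtain n where n: "d n * A \<le> F n" by blast
    have F: "0 < F n" using n d[of n] A by (meson mult_pos_pos less_le_trans)
    have Fle: "F n \<le> stream_prod (pmf P) n I"
      using emeasure_near_split_le[of P n a r I]
      by (simp add: F_def emeasure_eq_measure stream_prod_nonneg)
    have "A powr (q - 1) = (d n) powr (1 - q) * (d n * A) powr (q - 1)"
      using d[of n] A by (simp add: powr_mult powr_minus_divide[of "d n" "q - 1", simplified])
    also have "\<dots> \<le> (d n) powr (1 - q) * F n powr (q - 1)"
      using n q d[of n] A by (intro mult_left_mono powr_mono2) auto
    also have "F n powr (q - 1) = F n powr (q - 2) * F n"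
    proof -
      have "F n powr (q - 1) = F n powr (q - 2) * F n powr 1" by (subst powr_add[symmetric]) simp
      then show ?thesis using F by simp
    qed
    also have "d n powr (1 - q) * (F n powr (q - 2) * F n) \<le> d n powr (1 - q) * (stream_prod (pmf P) n I powr (q - 2) * F n)"
      using F Fle q by (intro mult_left_mono mult_right_mono powr_mono2) auto
    finally have "A powr (q - 1) \<le> (d n powr (1 - q) * stream_prod (pmf P) n I powr (q - 2)) * F n"
      by (simp add: mult.assoc)
    then have "ennreal (A powr (q - 1)) \<le> ennreal (d n powr (1 - q) * stream_prod (pmf P) n I powr (q - 2)) * emeasure ?P (near_split n a r I)"
      by (simp add: F_def emeasure_eq_measure flip: ennreal_mult)
    also have "\<dots> \<le> (\<Sum>n. ennreal (d n powr (1 - q) * stream_prod (pmf P) n I powr (q - 2)) * emeasure ?P (near_split n a r I))"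
      using sum_le_suminf[of "\<lambda>n. ennreal (d n powr (1 - q) * stream_prod (pmf P) n I powr (q - 2)) * emeasure ?P (near_split n a r I)" "{n}"]
      by simp
    finally show ?thesis by (simp add: A_def d_def)
  qed
qed

text \<open>The geometric weights cost a factor \<open>\<gamma> powr (1 - q)\<close>, larger than 1,
  for each digit. Later \<open>\<gamma>\<close> is taken so close to 1 that the weights per digit
  keep their decay.\<close>

lemma expected_measure_near:
  assumes P: "\<And>i. 0 < pmf P i" "\<And>i. pmf P i < 1" and q: "2 \<le> q" and \<gamma>: "0 < \<gamma>" "\<gamma> < 1"
    and r: "0 < r" and s: "0 \<le> s" "s \<le> 1"
  shows "(\<integral>\<^sup>+a. ennreal (measure (stream_space (measure_pmf P)) (near a r I) powr (q - 1)) * indicator (cball 0 R) a \<partial>lborel) \<le>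
    ennreal (transversality_const R * ((1 - \<gamma>) / 2) powr (1 - q) * r powr s) *
      (\<Sum>n. ennreal (stream_prod (\<lambda>i. \<gamma> powr (1 - q) * (pmf P i powr (q - 1) * ratio i powr - s)) n I))"
proof -
  let ?P = "stream_space (measure_pmf P)"
  define w where "w n = ((1 - \<gamma>) / 2 * \<gamma> ^ n) powr (1 - q) * stream_prod (pmf P) n I powr (q - 2)" for n
  have "(\<integral>\<^sup>+a. ennreal (measure ?P (near a r I) powr (q - 1)) * indicator (cball 0 R) a \<partial>lborel) \<le>
    (\<integral>\<^sup>+a. (\<Sum>n. ennreal (w n) * (emeasure ?P (near_split n a r I) * indicator (cball 0 R) a)) \<partial>lborel)"
  proof (rule nn_integral_mono)
    fix a
    show "ennreal (measure ?P (near a r I) powr (q - 1)) * indicator (cball 0 R) a \<le>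
      (\<Sum>n. ennreal (w n) * (emeasure ?P (near_split n a r I) * indicator (cball 0 R) a))"
      using measure_near_powr_le[OF P q \<gamma>, of a r I] by (auto simp: indicator_def w_def)
  qed
  also have "\<dots> = (\<Sum>n. ennreal (w n) * (\<integral>\<^sup>+a. emeasure ?P (near_split n a r I) * indicator (cball 0 R) a \<partial>lborel))"
    using measurable_emeasure_near_split[of P _ r I]
    by (subst nn_integral_suminf)
       (auto intro!: suminf_cong nn_integral_cmult borel_measurable_times_ennreal borel_measurable_indicator)
  also have "\<dots> \<le> (\<Sum>n. ennreal (w n) * ennreal (transversality_const R * r powr s * stream_prod (\<lambda>i. pmf P i * ratio i powr - s) n I))"
    by (intro suminf_le mult_left_mono expected_near_split r s) auto
  also have "\<dots> = (\<Sum>n. ennreal (transversality_const R * ((1 - \<gamma>) / 2) powr (1 - q) * r powr s) *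
      ennreal (stream_prod (\<lambda>i. \<gamma> powr (1 - q) * (pmf P i powr (q - 1) * ratio i powr - s)) n I))"
  proof (rule suminf_cong)
    fix n
    define p where "p = stream_prod (pmf P) n I"
    have p: "0 < p" unfolding p_def by (rule stream_prod_pos) (rule P)
    \<comment> \<open>\<open>q - 2\<close> powers come from the bound by the prefix mass, the last
      one from the expectation of the split set.\<close>
    have p1: "stream_prod (\<lambda>i. pmf P i powr (q - 1)) n I = p powr (q - 2) * p"
    proof -
      have "stream_prod (\<lambda>i. pmf P i powr (q - 1)) n I = p powr (q - 1)"
        unfolding p_def by (rule stream_prod_powr) simp
      also have "\<dots> = p powr (q - 2) * p powr 1" by (subst powr_add[symmetric]) simp
      finally show ?thesis using p by simp
    qed
    have g: "stream_prod (\<lambda>i. \<gamma> powr (1 - q)) n I = (\<gamma> ^ n) powr (1 - q)"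
      unfolding stream_prod_const using \<gamma> by (simp add: powr_powr mult.commute flip: powr_realpow)
    have "w n * (transversality_const R * r powr s * stream_prod (\<lambda>i. pmf P i * ratio i powr - s) n I) =
      (transversality_const R * ((1 - \<gamma>) / 2) powr (1 - q) * r powr s) *
      stream_prod (\<lambda>i. \<gamma> powr (1 - q) * (pmf P i powr (q - 1) * ratio i powr - s)) n I"
    proof -
      have "((1 - \<gamma>) / 2 * \<gamma> ^ n) powr (1 - q) = ((1 - \<gamma>) / 2) powr (1 - q) * (\<gamma> ^ n) powr (1 - q)"
        by (rule powr_mult)
      then show ?thesis
        unfolding stream_prod_mult p1 g w_def p_def[symmetric] by (simp only: mult_ac)
    qed
    then show "ennreal (w n) * ennreal (transversality_const R * r powr s * stream_prod (\<lambda>i. pmf P i * ratio i powr - s) n I) =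
      ennreal (transversality_const R * ((1 - \<gamma>) / 2) powr (1 - q) * r powr s) *
      ennreal (stream_prod (\<lambda>i. \<gamma> powr (1 - q) * (pmf P i powr (q - 1) * ratio i powr - s)) n I)"
      using transversality_const_nonneg[of R]
      by (subst (1 2) ennreal_mult[symmetric])
         (auto simp only: w_def intro!: mult_nonneg_nonneg stream_prod_nonneg powr_ge_zero pmf_nonneg)
  qed
  also have "\<dots> = ennreal (transversality_const R * ((1 - \<gamma>) / 2) powr (1 - q) * r powr s) *
      (\<Sum>n. ennreal (stream_prod (\<lambda>i. \<gamma> powr (1 - q) * (pmf P i powr (q - 1) * ratio i powr - s)) n I))"
    by simp
  finally show ?thesis .
qed

text \<open>For \<open>q = 2\<close> and \<sigma> > 0 a dyadic form of the Riesz potential of order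
  \<sigma> at the coded point. Finiteness bounds all dyadic balls with one constant, and a sum over
  scales, unlike a supremum, commutes with integration.\<close>

definition energy :: "'m pmf \<Rightarrow> real \<Rightarrow> real \<Rightarrow> (real^'d)^'m \<Rightarrow> 'm stream \<Rightarrow> ennreal" where
  "energy P q \<sigma> a I = (\<Sum>k. ennreal ((2 ^ k) powr \<sigma>) *
     ennreal (measure (stream_space (measure_pmf P)) (near a (1 / 2 ^ k) I) powr (q - 1)))"

lemma measurable_energy [measurable]:
  "(\<lambda>(a, I). energy P q \<sigma> a I) \<in> borel_measurable (borel \<Otimes>\<^sub>M stream_space (count_space UNIV))"
  using measurable_measure_near unfolding energy_def split_beta' by measurable

lemma measurable_energy_right [measurable]:
  "energy P q \<sigma> a \<in> borel_measurable (stream_space (count_space UNIV))"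
  using measurable_compose[OF measurable_Pair1' measurable_energy, of a] by simp

lemma measurable_energy_left:
  "(\<lambda>a. energy P q \<sigma> a I) \<in> borel_measurable borel"
  using measurable_compose[OF measurable_Pair2' measurable_energy, of I] by (simp add: space_stream_space)

lemma energy_bound:
  assumes "energy P q \<sigma> a I \<noteq> \<infinity>"
  shows "measure (stream_space (measure_pmf P)) (near a (1 / 2 ^ k) I) powr (q - 1) \<le>
    enn2real (energy P q \<sigma> a I) * (1 / 2 ^ k) powr \<sigma>"
proof -
  let ?m = "measure (stream_space (measure_pmf P)) (near a (1 / 2 ^ k) I) powr (q - 1)"
  have "ennreal ((2 ^ k) powr \<sigma> * ?m) \<le> energy P q \<sigma> a I"
    unfolding energy_def
    using sum_le_suminf[of "\<lambda>k. ennreal ((2 ^ k) powr \<sigma>) *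
     ennreal (measure (stream_space (measure_pmf P)) (near a (1 / 2 ^ k) I) powr (q - 1))" "{k}"]
    by (simp add: ennreal_mult)
  then have "(2 ^ k) powr \<sigma> * ?m \<le> enn2real (energy P q \<sigma> a I)"
    using assms enn2real_mono[of "ennreal ((2 ^ k) powr \<sigma> * ?m)" "energy P q \<sigma> a I"]
    by (simp add: top.not_eq_extremum)
  then show ?thesis by (simp add: powr_divide field_simps)
qed

text \<open>The gap \<sigma> < s makes the scales sum like a geometric series. The constant is the
  same for all codes, so the bound can be used at almost every code or be integrated over the
  codes.\<close>

lemma expected_energy:
  assumes P: "\<And>i. 0 < pmf P i" "\<And>i. pmf P i < 1" and q: "2 \<le> q" and \<gamma>: "0 < \<gamma>" "\<gamma> < 1"
    and s: "0 \<le> s" "s \<le> 1" "\<sigma> < s"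
  shows "\<exists>C. \<forall>I. (\<integral>\<^sup>+a. energy P q \<sigma> a I * indicator (cball 0 R) a \<partial>lborel) \<le> ennreal C *
    (\<Sum>n. ennreal (stream_prod (\<lambda>i. \<gamma> powr (1 - q) * (pmf P i powr (q - 1) * ratio i powr - s)) n I))"
proof -
  define B where "B = transversality_const R * ((1 - \<gamma>) / 2) powr (1 - q)"
  have B: "0 \<le> B" using transversality_const_nonneg by (simp add: B_def)
  have sm: "summable (\<lambda>k. (2 powr (\<sigma> - s)) ^ k)"
    using s powr_less_mono[of "\<sigma> - s" 0 2] by (intro summable_geometric) auto
  have geo: "(2 ^ k) powr \<sigma> * (1 / 2 ^ k) powr s = (2 powr (\<sigma> - s)) ^ k" for k
    by (simp add: powr_divide powr_diff powr_powr mult.commute field_simps flip: powr_realpow)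
  have "(\<integral>\<^sup>+a. energy P q \<sigma> a I * indicator (cball 0 R) a \<partial>lborel) \<le> ennreal (B * (\<Sum>k. (2 powr (\<sigma> - s)) ^ k)) *
    (\<Sum>n. ennreal (stream_prod (\<lambda>i. \<gamma> powr (1 - q) * (pmf P i powr (q - 1) * ratio i powr - s)) n I))"
    (is "?L \<le> _ * ?S") for I
  proof -
    have m: "(\<lambda>a. ennreal (measure (stream_space (measure_pmf P)) (near a (1 / 2 ^ k) I) powr (q - 1)) * indicator (cball 0 R) a)
        \<in> borel_measurable lborel" for k
      using measurable_compose[OF measurable_Pair2' measurable_measure_near, of I]
      by (intro borel_measurable_times_ennreal borel_measurable_indicator)
         (auto simp: space_stream_space)
    have "?L = (\<integral>\<^sup>+a. (\<Sum>k. ennreal ((2 ^ k) powr \<sigma>) *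
        (ennreal (measure (stream_space (measure_pmf P)) (near a (1 / 2 ^ k) I) powr (q - 1)) * indicator (cball 0 R) a)) \<partial>lborel)"
      by (intro nn_integral_cong) (simp add: energy_def mult.assoc flip: ennreal_suminf_multc)
    also have "\<dots> = (\<Sum>k. ennreal ((2 ^ k) powr \<sigma>) *
        (\<integral>\<^sup>+a. ennreal (measure (stream_space (measure_pmf P)) (near a (1 / 2 ^ k) I) powr (q - 1)) * indicator (cball 0 R) a \<partial>lborel))"
      using m by (subst nn_integral_suminf) (auto intro!: suminf_cong nn_integral_cmult)
    also have "\<dots> \<le> (\<Sum>k. ennreal ((2 ^ k) powr \<sigma>) * (ennreal (B * (1 / 2 ^ k) powr s) * ?S))"
      unfolding B_def by (intro suminf_le mult_left_mono expected_measure_near P q \<gamma> s) auto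
    also have "\<dots> = (\<Sum>k. ennreal (B * (2 powr (\<sigma> - s)) ^ k) * ?S)"
    proof (rule suminf_cong)
      fix k
      have e: "(2 ^ k) powr \<sigma> * (B * (1 / 2 ^ k) powr s) = B * (2 powr (\<sigma> - s)) ^ k"
        unfolding geo[symmetric] by (simp only: mult_ac)
      have "ennreal ((2 ^ k) powr \<sigma>) * ennreal (B * (1 / 2 ^ k) powr s) = ennreal (B * (2 powr (\<sigma> - s)) ^ k)"
        unfolding e[symmetric] using B by (intro ennreal_mult[symmetric]) auto
      then show "ennreal ((2 ^ k) powr \<sigma>) * (ennreal (B * (1 / 2 ^ k) powr s) * ?S) = ennreal (B * (2 powr (\<sigma> - s)) ^ k) * ?S"
        by (simp only: mult.assoc[symmetric])
    qed
    also have "\<dots> = (\<Sum>k. ennreal (B * (2 powr (\<sigma> - s)) ^ k)) * ?S"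
      by simp
    also have "(\<Sum>k. ennreal (B * (2 powr (\<sigma> - s)) ^ k)) = ennreal (B * (\<Sum>k. (2 powr (\<sigma> - s)) ^ k))"
      using B sm by (subst suminf_ennreal2) (auto intro!: summable_mult simp: suminf_mult)
    finally show ?thesis .
  qed
  then show ?thesis by blast
qed

text \<open>\<open>P\<close> weighs the balls and \<open>W\<close> draws the centres. The hypothesis
  puts \<open>s\<close> below the quotient of the \<open>W\<close>-means of
  \<open>ln (pmf P i)\<close> and \<open>ln (ratio i)\<close>, the expected local dimension; the
  weights along a typical code are then summable.\<close>

lemma AE_AE_energy_finite:
  assumes P: "\<And>i. 0 < pmf P i" "\<And>i. pmf P i < 1" and s: "0 \<le> s" "s \<le> 1" "\<sigma> < s"
    and neg: "(\<Sum>i\<in>UNIV. pmf W i * ln (pmf P i * ratio i powr - s)) < 0"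
  shows "AE a in lborel. AE I in stream_space (measure_pmf W). energy P 2 \<sigma> a I \<noteq> \<infinity>"
proof -
  let ?W = "stream_space (measure_pmf W)"
  define x where "x = (\<Sum>i\<in>UNIV. pmf W i * ln (pmf P i * ratio i powr - s))"
  \<comment> \<open>Half of the negative mean pays for the factor \<open>inverse \<gamma>\<close>
    per digit; the logarithms still have mean \<open>x / 2\<close>.\<close>
  define \<gamma> where "\<gamma> = exp (x / 2)"
  have \<gamma>: "0 < \<gamma>" "\<gamma> < 1" using neg by (auto simp: \<gamma>_def x_def)
  \<comment> \<open>The exponents \<open>1 - 2\<close> and \<open>2 - 1\<close> are left unevaluated
    to match \<open>expected_energy\<close> at \<open>q = 2\<close>.\<close>
  define h where "h i = \<gamma> powr (1 - 2) * (pmf P i powr (2 - 1) * ratio i powr - s)" for i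
  have h: "0 < h i" for i using \<gamma> P t_pos by (simp add: h_def less_imp_neq[THEN not_sym])
  have "(\<Sum>i\<in>UNIV. pmf W i * ln (h i)) = (\<Sum>i\<in>UNIV. pmf W i * (- x / 2) + pmf W i * ln (pmf P i * ratio i powr - s))"
  proof (rule sum.cong[OF refl])
    fix i
    have "h i = inverse \<gamma> * (pmf P i * ratio i powr - s)"
      using \<gamma> P(1)[of i] by (simp add: h_def powr_minus)
    then have "ln (h i) = - x / 2 + ln (pmf P i * ratio i powr - s)"
      using \<gamma> P(1)[of i] t_pos[of i j0] by (simp add: ln_mult ln_inverse \<gamma>_def)
    then show "pmf W i * ln (h i) = pmf W i * (- x / 2) + pmf W i * ln (pmf P i * ratio i powr - s)"
      by (simp only: distrib_left)
  qed
  also have "\<dots> = x / 2"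
    unfolding sum.distrib x_def[symmetric] sum_distrib_right[symmetric]
    using sum_pmf_eq_1[of UNIV W] by simp
  also have "\<dots> < 0" using neg by (simp add: x_def)
  finally have sm: "AE I in ?W. summable (\<lambda>n. stream_prod h n I)"
    using h by (intro AE_summable_stream_prod)
  interpret W: prob_space ?W by (rule prob_space_stream_pmf)
  interpret pair_sigma_finite lborel ?W ..
  \<comment> \<open>The constants depend on \<open>R\<close>, so the translations are exhausted by
    countably many balls. For a typical code almost every translation is good; the two quantifiers
    are then exchanged.\<close>
  have "AE a in lborel. AE I in ?W. a \<in> cball 0 (real R) \<longrightarrow> energy P 2 \<sigma> a I \<noteq> \<infinity>" for R :: nat
  proof -
    obtain C where C: "\<And>I. (\<integral>\<^sup>+a. energy P 2 \<sigma> a I * indicator (cball 0 (real R)) a \<partial>lborel) \<le>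
        ennreal C * (\<Sum>n. ennreal (stream_prod h n I))"
      using expected_energy[OF P order_refl \<gamma> s, of "real R"] unfolding h_def by blast
    have "AE I in ?W. AE a in lborel. a \<in> cball 0 (real R) \<longrightarrow> energy P 2 \<sigma> a I \<noteq> \<infinity>"
      using sm
    proof eventually_elim
      case (elim I)
      have "(\<Sum>n. ennreal (stream_prod h n I)) < \<infinity>"
        using elim h by (subst suminf_ennreal2) (auto intro!: less_imp_le[OF stream_prod_pos])
      then have "(\<integral>\<^sup>+a. energy P 2 \<sigma> a I * indicator (cball 0 (real R)) a \<partial>lborel) < \<infinity>"
        using C[of I] by (auto simp: ennreal_mult_less_top intro: le_less_trans)
      then have "AE a in lborel. energy P 2 \<sigma> a I * indicator (cball 0 (real R)) a \<noteq> \<infinity>"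
        using measurable_energy_left
        by (intro nn_integral_PInf_AE borel_measurable_times_ennreal borel_measurable_indicator) auto
      then show ?case by (rule AE_mp) (auto simp: indicator_def)
    qed
    moreover have "{x \<in> space (lborel \<Otimes>\<^sub>M ?W). fst x \<in> cball 0 (real R) \<longrightarrow> energy P 2 \<sigma> (fst x) (snd x) \<noteq> \<infinity>}
        \<in> sets (lborel \<Otimes>\<^sub>M ?W)"
    proof -
      have [measurable]: "(\<lambda>x. energy P 2 \<sigma> (fst x) (snd x)) \<in> borel_measurable (borel \<Otimes>\<^sub>M stream_space (count_space UNIV))"
        using measurable_energy[of P 2 \<sigma>] by (simp only: split_beta')
      have "{x \<in> space (borel \<Otimes>\<^sub>M stream_space (count_space UNIV)). norm (fst x) \<le> real R \<longrightarrow> energy P 2 \<sigma> (fst x) (snd x) \<noteq> \<infinity>}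
        \<in> sets (borel \<Otimes>\<^sub>M stream_space (count_space UNIV))"
        by measurable
      then show ?thesis
        by (simp only: sets_pair_measure_cong[OF sets_lborel sets_stream_pmf] space_pair_measure
            space_stream_pmf space_stream_space space_lborel space_borel streams_UNIV mem_cball_0 space_count_space space_measure_pmf)
    qed
    ultimately show ?thesis
      by (subst AE_commute) simp_all
  qed
  then have "AE a in lborel. \<forall>R::nat. AE I in ?W. a \<in> cball 0 (real R) \<longrightarrow> energy P 2 \<sigma> a I \<noteq> \<infinity>"
    by (simp only: AE_all_countable) blast
  then show ?thesis
  proof eventually_elim
    case (elim a)
    obtain R :: nat where "norm a \<le> real R" using real_arch_simple by blast
    then show ?case using elim[rule_format, of R] by simp
  qed
qed

text \<open>Here codes are averaged instead of being typical, so the mean of the weight per digit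
  itself must be below 1, rather than the mean of its logarithm below 0.\<close>

lemma AE_integral_energy_finite:
  assumes P: "\<And>i. 0 < pmf P i" "\<And>i. pmf P i < 1" and q: "2 \<le> q" and s: "0 \<le> s" "s \<le> 1" "\<sigma> < s"
    and less: "(\<Sum>i\<in>UNIV. pmf P i powr q * ratio i powr - s) < 1"
  shows "AE a in lborel. (\<integral>\<^sup>+I. energy P q \<sigma> a I \<partial>stream_space (measure_pmf P)) \<noteq> \<infinity>"
proof -
  let ?P = "stream_space (measure_pmf P)"
  define \<theta> where "\<theta> = (\<Sum>i\<in>UNIV. pmf P i powr q * ratio i powr - s)"
  have \<theta>: "0 \<le> \<theta>" "\<theta> < 1" using less by (auto simp: \<theta>_def intro: sum_nonneg)
  \<comment> \<open>Chosen so that \<open>\<gamma> powr (1 - q) = 2 / (1 + \<theta>)\<close>; the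
    mean per digit becomes \<open>2 * \<theta> / (1 + \<theta>)\<close>, still below 1.\<close>
  define \<gamma> where "\<gamma> = ((1 + \<theta>) / 2) powr (1 / (q - 1))"
  have \<gamma>0: "0 < \<gamma>" using \<theta> by (simp add: \<gamma>_def)
  have "\<gamma> < 1 powr (1 / (q - 1))"
    unfolding \<gamma>_def using \<theta> q by (intro powr_less_mono2) auto
  then have \<gamma>: "0 < \<gamma>" "\<gamma> < 1" using \<gamma>0 by auto
  have \<gamma>q: "\<gamma> powr (1 - q) = 2 / (1 + \<theta>)"
  proof -
    have "1 / (q - 1) * (1 - q) = -1" using q by (simp add: field_simps)
    then have "\<gamma> powr (1 - q) = ((1 + \<theta>) / 2) powr (-1)"
      unfolding \<gamma>_def powr_powr by (simp only:)
    then show ?thesis using \<theta> by (simp add: powr_minus divide_simps)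
  qed
  define h where "h i = \<gamma> powr (1 - q) * (pmf P i powr (q - 1) * ratio i powr - s)" for i
  have h: "0 \<le> h i" for i by (simp add: h_def)
  have sum_h: "(\<Sum>i\<in>UNIV. pmf P i * h i) = 2 * \<theta> / (1 + \<theta>)"
  proof -
    have "pmf P i * h i = \<gamma> powr (1 - q) * (pmf P i powr q * ratio i powr - s)" for i
    proof -
      have "pmf P i powr q = pmf P i powr 1 * pmf P i powr (q - 1)" by (subst powr_add[symmetric]) simp
      then show ?thesis by (simp add: h_def)
    qed
    then show ?thesis by (simp only: \<gamma>q sum_distrib_left[symmetric] \<theta>_def[symmetric]) simp
  qed
  have "(\<integral>\<^sup>+I. (\<Sum>n. ennreal (stream_prod h n I)) \<partial>?P) = (\<Sum>n. ennreal ((2 * \<theta> / (1 + \<theta>)) ^ n))"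
    by (subst nn_integral_suminf) (simp_all add: nn_integral_stream_prod h sum_h)
  also have "\<dots> < \<infinity>"
    using \<theta> by (subst suminf_ennreal2) (auto intro!: summable_geometric simp: divide_less_eq)
  finally have fin: "(\<integral>\<^sup>+I. (\<Sum>n. ennreal (stream_prod h n I)) \<partial>?P) < \<infinity>" .
  interpret Q: prob_space ?P by (rule prob_space_stream_pmf)
  interpret pair_sigma_finite lborel ?P ..
  have me: "(\<lambda>x. energy P q \<sigma> (fst x) (snd x)) \<in> borel_measurable (lborel \<Otimes>\<^sub>M ?P)"
    using measurable_energy[of P q \<sigma>]
    unfolding measurable_cong_sets[OF sets_pair_measure_cong[OF sets_lborel[symmetric] sets_stream_pmf[of P, symmetric]] refl]
    by (simp add: split_beta')
  have "AE a in lborel. a \<in> cball 0 (real R) \<longrightarrow> (\<integral>\<^sup>+I. energy P q \<sigma> a I \<partial>?P) \<noteq> \<infinity>" for R :: nat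
  proof -
    obtain C where C: "\<And>I. (\<integral>\<^sup>+a. energy P q \<sigma> a I * indicator (cball 0 (real R)) a \<partial>lborel) \<le>
        ennreal C * (\<Sum>n. ennreal (stream_prod h n I))"
      using expected_energy[OF P q \<gamma> s, of "real R"] unfolding h_def by blast
    have m: "(\<lambda>(a, I). energy P q \<sigma> a I * indicator (cball 0 (real R)) a) \<in> borel_measurable (lborel \<Otimes>\<^sub>M ?P)"
    proof -
      have "(\<lambda>x. indicator (cball 0 (real R)) (fst x) :: ennreal) \<in> borel_measurable (lborel \<Otimes>\<^sub>M ?P)"
        by (rule measurable_compose[OF measurable_fst borel_measurable_indicator]) simp
      from borel_measurable_times_ennreal[OF me this] show ?thesis
        by (simp only: split_beta')
    qed
    have mI: "(\<lambda>a. \<integral>\<^sup>+I. energy P q \<sigma> a I \<partial>?P) \<in> borel_measurable lborel"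
      by (rule Q.borel_measurable_nn_integral) (use me in \<open>simp add: split_beta'\<close>)
    have "(\<integral>\<^sup>+a. (\<integral>\<^sup>+I. energy P q \<sigma> a I \<partial>?P) * indicator (cball 0 (real R)) a \<partial>lborel) =
        (\<integral>\<^sup>+a. \<integral>\<^sup>+I. energy P q \<sigma> a I * indicator (cball 0 (real R)) a \<partial>?P \<partial>lborel)"
      by (intro nn_integral_cong nn_integral_multc[symmetric]) (simp add: measurable_cong_sets[OF sets_stream_pmf refl])
    also have "\<dots> = (\<integral>\<^sup>+I. \<integral>\<^sup>+a. energy P q \<sigma> a I * indicator (cball 0 (real R)) a \<partial>lborel \<partial>?P)"
      using Fubini'[OF m] by simp
    also have "\<dots> \<le> (\<integral>\<^sup>+I. ennreal C * (\<Sum>n. ennreal (stream_prod h n I)) \<partial>?P)"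
      by (intro nn_integral_mono C)
    also have "\<dots> = ennreal C * (\<integral>\<^sup>+I. (\<Sum>n. ennreal (stream_prod h n I)) \<partial>?P)"
      by (rule nn_integral_cmult) (intro borel_measurable_suminf_order measurable_compose[OF _ measurable_ennreal], simp add: measurable_cong_sets[OF sets_stream_pmf refl])
    also have "\<dots> < \<infinity>" using fin by (simp add: ennreal_mult_less_top)
    finally have "AE a in lborel. (\<integral>\<^sup>+I. energy P q \<sigma> a I \<partial>?P) * indicator (cball 0 (real R)) a \<noteq> \<infinity>"
      using mI by (intro nn_integral_PInf_AE borel_measurable_times_ennreal borel_measurable_indicator) auto
    then show ?thesis by (rule AE_mp) (auto simp: indicator_def)
  qed
  then have "AE a in lborel. \<forall>R::nat. a \<in> cball 0 (real R) \<longrightarrow> (\<integral>\<^sup>+I. energy P q \<sigma> a I \<partial>?P) \<noteq> \<infinity>"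
    by (simp only: AE_all_countable) blast
  then show ?thesis
  proof eventually_elim
    case (elim a)
    obtain R :: nat where "norm a \<le> real R" using real_arch_simple by blast
    then show ?case using elim[rule_format, of R] by simp
  qed
qed

end

section \<open>Bounds for the Hausdorff dimension\<close>

lemma hausdorff_pre_mono: "E \<subseteq> F \<Longrightarrow> hausdorff_pre s \<delta> E \<le> hausdorff_pre s \<delta> F"
  unfolding hausdorff_pre_def by (rule INF_superset_mono) auto

lemma hausdorff_outer_mono: "E \<subseteq> F \<Longrightarrow> hausdorff_outer s E \<le> hausdorff_outer s F"
  unfolding hausdorff_outer_def by (intro SUP_mono') (rule hausdorff_pre_mono)

lemma hausdorff_outer_eq_0_iff: "hausdorff_outer s E = 0 \<longleftrightarrow> (\<forall>\<delta>>0. hausdorff_pre s \<delta> E = 0)"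
  unfolding hausdorff_outer_def le_zero_eq[symmetric] SUP_le_iff by auto

lemma hausdorff_pre_le:
  assumes "E \<subseteq> (\<Union>i. U i)" "\<And>i. bounded (U i)" "\<And>i. diameter (U i) \<le> \<delta>"
  shows "hausdorff_pre s \<delta> E \<le> (\<Sum>i. diam_power s (U i))"
  unfolding hausdorff_pre_def by (rule INF_lower) (use assms in auto)

text \<open>Coverings of the \<open>E n\<close> with sums below \<open>e * (1 / 2) ^ Suc n\<close>
  are merged into one sequence by \<open>prod_decode\<close>.\<close>

lemma hausdorff_pre_Union_eq_0:
  assumes "\<And>n. hausdorff_pre s \<delta> (E n) = 0"
  shows "hausdorff_pre s \<delta> (\<Union>n::nat. E n) = 0"
proof -
  have *: "hausdorff_pre s \<delta> (\<Union>n. E n) \<le> ennreal e" if e: "0 < e" for e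
  proof -
    have "\<exists>U. E n \<subseteq> (\<Union>i::nat. U i) \<and> (\<forall>i. bounded (U i) \<and> diameter (U i) \<le> \<delta>) \<and>
        (\<Sum>i. diam_power s (U i)) < ennreal (e * (1 / 2) ^ Suc n)" for n
    proof -
      have "hausdorff_pre s \<delta> (E n) < ennreal (e * (1 / 2) ^ Suc n)"
        using assms e by simp
      then show ?thesis
        unfolding hausdorff_pre_def INF_less_iff by blast
    qed
    then obtain U where U: "\<And>n. E n \<subseteq> (\<Union>i::nat. U n i)" "\<And>n i. bounded (U n i)" "\<And>n i. diameter (U n i) \<le> \<delta>"
        "\<And>n. (\<Sum>i. diam_power s (U n i)) < ennreal (e * (1 / 2) ^ Suc n)"
      by metis
    have "hausdorff_pre s \<delta> (\<Union>n. E n) \<le> (\<Sum>i. diam_power s (case prod_decode i of (n, i) \<Rightarrow> U n i))"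
    proof (rule hausdorff_pre_le)
      show "(\<Union>n. E n) \<subseteq> (\<Union>i. case prod_decode i of (n, i) \<Rightarrow> U n i)"
      proof
        fix x assume "x \<in> (\<Union>n. E n)"
        then obtain n where "x \<in> E n" by blast
        then obtain i where "x \<in> U n i" using U(1)[of n] by (meson UN_E subsetD)
        then have "x \<in> (case prod_decode (prod_encode (n, i)) of (n, i) \<Rightarrow> U n i)" by simp
        then show "x \<in> (\<Union>i. case prod_decode i of (n, i) \<Rightarrow> U n i)" by (rule UN_I[OF UNIV_I])
      qed
      show "bounded (case prod_decode i of (n, i) \<Rightarrow> U n i)" for i
        by (cases "prod_decode i") (simp add: U(2))
      show "diameter (case prod_decode i of (n, i) \<Rightarrow> U n i) \<le> \<delta>" for i
        by (cases "prod_decode i") (simp add: U(3))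
    qed
    also have "\<dots> = (\<Sum>i. case_prod (\<lambda>n i. diam_power s (U n i)) (prod_decode i))"
      by (intro suminf_cong) (simp split: prod.splits)
    also have "\<dots> = (\<Sum>n. \<Sum>i. diam_power s (U n i))"
      using suminf_ennreal_2dimen[of "\<lambda>n. \<Sum>i. diam_power s (U n i)" "\<lambda>(n, i). diam_power s (U n i)"]
      by (simp add: comp_def)
    also have "\<dots> \<le> (\<Sum>n. ennreal (e * (1 / 2) ^ Suc n))"
      by (intro suminf_le less_imp_le[OF U(4)]) auto
    also have "\<dots> = ennreal e"
      using sums_mult[OF power_half_series, of e] e by (intro suminf_ennreal_eq) auto
    finally show ?thesis .
  qed
  have "hausdorff_pre s \<delta> (\<Union>n. E n) \<le> 0"
  proof (rule ennreal_le_epsilon)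
    fix e :: real assume "0 < e"
    from *[OF this] show "hausdorff_pre s \<delta> (\<Union>n. E n) \<le> 0 + ennreal e" by simp
  qed
  then show ?thesis by simp
qed

lemma hausdorff_outer_Union_eq_0:
  "(\<And>n. hausdorff_outer s (E n) = 0) \<Longrightarrow> hausdorff_outer s (\<Union>n::nat. E n) = 0"
  by (simp add: hausdorff_outer_eq_0_iff hausdorff_pre_Union_eq_0)

lemma diameter_cball_le:
  fixes x :: "'a::metric_space"
  assumes "0 \<le> r"
  shows "diameter (cball x r) \<le> 2 * r"
proof -
  have "dist y z \<le> 2 * r" if "y \<in> cball x r" "z \<in> cball x r" for y z
    using that dist_triangle3[of y z x] by simp
  then have "(SUP (y, z)\<in>cball x r \<times> cball x r. dist y z) \<le> 2 * r"
    by (intro cSUP_least) (use assms in auto)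
  then show ?thesis using assms by (simp add: diameter_def)
qed

text \<open>Coverings by equal balls at arbitrarily small scales suffice, as for the box dimension.
  The single parameter \<open>e\<close> controls both the radius and the sum.\<close>

lemma hausdorff_outer_eq_0_balls:
  fixes E :: "'a::metric_space set"
  assumes s: "0 < s"
    and cover: "\<And>e. 0 < e \<Longrightarrow> \<exists>F r. finite F \<and> 0 < r \<and> r \<le> e \<and> E \<subseteq> (\<Union>x\<in>F. cball x r) \<and>
      real (card F) * (2 * r) powr s \<le> e"
  shows "hausdorff_outer s E = 0"
  unfolding hausdorff_outer_eq_0_iff
proof (intro allI impI)
  fix \<delta> :: real assume \<delta>: "0 < \<delta>"
  have *: "hausdorff_pre s \<delta> E \<le> ennreal e" if e: "0 < e" for e
  proof -
    obtain F r where F: "finite F" "0 < r" "r \<le> min e (\<delta> / 2)" "E \<subseteq> (\<Union>x\<in>F. cball x r)"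
        "real (card F) * (2 * r) powr s \<le> min e (\<delta> / 2)"
      using cover[of "min e (\<delta> / 2)"] e \<delta> by auto
    obtain f where f: "bij_betw f {..<card F} F"
      using bij_betw_from_nat_into_finite[OF F(1)] by blast
    \<comment> \<open>Padding with empty sets turns the finite covering into a sequence; they cost 0
      by the convention in \<open>diam_power\<close>.\<close>
    define U where "U i = (if i < card F then cball (f i) r else {})" for i
    have dU: "diameter (U i) \<le> 2 * r" for i
      unfolding U_def using F(2) by (simp add: diameter_cball_le)
    have "hausdorff_pre s \<delta> E \<le> (\<Sum>i. diam_power s (U i))"
    proof (rule hausdorff_pre_le)
      show "E \<subseteq> (\<Union>i. U i)"
      proof
        fix x assume "x \<in> E"
        then obtain y where y: "y \<in> F" "x \<in> cball y r" using F(4) by blast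
        then obtain i where "i < card F" "y = f i" using f by (auto simp: bij_betw_def)
        with y show "x \<in> (\<Union>i. U i)" by (auto simp: U_def intro!: exI[of _ i])
      qed
      show "bounded (U i)" for i by (simp add: U_def)
      show "diameter (U i) \<le> \<delta>" for i using dU[of i] F(3) by auto
    qed
    also have "\<dots> = (\<Sum>i<card F. diam_power s (U i))"
      by (rule suminf_finite) (auto simp: U_def diam_power_def)
    also have "\<dots> \<le> (\<Sum>i<card F. ennreal ((2 * r) powr s))"
    proof (rule sum_mono)
      fix i
      have "bounded (U i)" by (simp add: U_def)
      then show "diam_power s (U i) \<le> ennreal ((2 * r) powr s)"
        using s dU[of i] by (auto simp: diam_power_def diameter_ge_0 intro!: ennreal_leI powr_mono2)
    qed
    also have "\<dots> = ennreal (real (card F) * (2 * r) powr s)"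
      by (simp add: ennreal_mult ennreal_of_nat_eq_real_of_nat)
    also have "\<dots> \<le> ennreal e" using F(5) by (intro ennreal_leI) auto
    finally show ?thesis .
  qed
  have "hausdorff_pre s \<delta> E \<le> 0"
  proof (rule ennreal_le_epsilon)
    fix e :: real assume "0 < e"
    from *[OF this] show "hausdorff_pre s \<delta> E \<le> 0 + ennreal e" by simp
  qed
  then show "hausdorff_pre s \<delta> E = 0" by simp
qed

lemma hausdorff_dim_le:
  assumes "0 \<le> H" "\<And>s. H < s \<Longrightarrow> hausdorff_outer s E = 0"
  shows "hausdorff_dim E \<le> ereal H"
proof (rule ereal_le_epsilon2)
  fix e :: real assume "0 < e"
  then have "hausdorff_outer (H + e) E = 0" using assms by simp
  then have "hausdorff_dim E \<le> ereal (H + e)"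
    unfolding hausdorff_dim_def using assms \<open>0 < e\<close> by (intro Inf_lower) auto
  then show "hausdorff_dim E \<le> ereal H + ereal e" by simp
qed

lemma hausdorff_dim_ge:
  assumes "\<And>s. 0 \<le> s \<Longrightarrow> s < H \<Longrightarrow> hausdorff_outer s E \<noteq> 0"
  shows "ereal H \<le> hausdorff_dim E"
  unfolding hausdorff_dim_def
proof (rule Inf_greatest)
  fix x assume "x \<in> ereal ` {s. 0 \<le> s \<and> hausdorff_outer s E = 0}"
  then obtain s where "x = ereal s" "0 \<le> s" "hausdorff_outer s E = 0" by blast
  with assms[of s] show "ereal H \<le> x" by fastforce
qed

text \<open>The mass distribution principle with the measure kept on the codes. The bound on balls
  is assumed for centres coming from \<open>B\<close> because in the application energies are
  uniformly bounded only there.\<close>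

lemma mass_distribution:
  fixes f :: "'b \<Rightarrow> 'a::metric_space"
  assumes N: "finite_measure N" and s: "0 \<le> s" and M: "0 \<le> M"
    and B: "B \<in> sets N" "emeasure N B \<noteq> 0" and E: "\<And>x. x \<in> B \<Longrightarrow> f x \<in> E"
    and meas: "\<And>x r. {y \<in> space N. dist (f x) (f y) \<le> r} \<in> sets N"
    and le: "\<And>x r. x \<in> B \<Longrightarrow> 0 < r \<Longrightarrow> r \<le> 1 \<Longrightarrow>
      emeasure N {y \<in> space N. dist (f x) (f y) \<le> r} \<le> ennreal (M * r powr s)"
  shows "hausdorff_outer s E \<noteq> 0"
proof
  assume "hausdorff_outer s E = 0"
  then have pre: "hausdorff_pre s 1 E = 0" by (simp add: hausdorff_outer_eq_0_iff)
  interpret finite_measure N by (rule N)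
  have BN: "B \<subseteq> space N" using B sets.sets_into_space by blast
  have *: "emeasure N B \<le> ennreal M * (\<Sum>i. diam_power s (U i))"
    if U: "E \<subseteq> (\<Union>i. U i)" "\<And>i. bounded (U i)" "\<And>i. diameter (U i) \<le> 1" for U :: "nat \<Rightarrow> 'a set"
  proof -
    \<comment> \<open>A covering set that meets the image of \<open>B\<close> lies in the ball
      around such an image point with the diameter as radius; any other covering set is charged
      nothing.\<close>
    define S where "S i = (if \<exists>x\<in>B. f x \<in> U i then
      {y \<in> space N. dist (f (SOME x. x \<in> B \<and> f x \<in> U i)) (f y) \<le> diameter (U i)} else {})" for i
    have S: "S i \<in> sets N" for i by (simp add: S_def meas)
    have cover: "B \<subseteq> (\<Union>i. S i)"
    proof
      fix y assume y: "y \<in> B"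
      then obtain i where i: "f y \<in> U i" using E U(1) by blast
      define x where "x = (SOME x. x \<in> B \<and> f x \<in> U i)"
      have x: "x \<in> B \<and> f x \<in> U i" unfolding x_def by (rule someI[of _ y]) (use y i in auto)
      have "dist (f x) (f y) \<le> diameter (U i)" using x i U(2) by (intro diameter_bounded_bound) auto
      then have "y \<in> S i" using y i BN by (auto simp: S_def x_def)
      then show "y \<in> (\<Union>i. S i)" by blast
    qed
    have mass: "emeasure N (S i) \<le> ennreal M * diam_power s (U i)" for i
    proof (cases "\<exists>x\<in>B. f x \<in> U i")
      case True
      define x where "x = (SOME x. x \<in> B \<and> f x \<in> U i)"
      have x: "x \<in> B \<and> f x \<in> U i" unfolding x_def by (rule someI_ex) (use True in auto)
      have Si: "S i = {y \<in> space N. dist (f x) (f y) \<le> diameter (U i)}"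
        using True by (simp add: S_def x_def)
      show ?thesis
      proof (cases "diameter (U i) = 0")
        case False
        then have d: "0 < diameter (U i)" using diameter_ge_0[OF U(2)[of i]] by simp
        have "emeasure N (S i) \<le> ennreal (M * diameter (U i) powr s)"
          unfolding Si using x d U(3) by (intro le) auto
        then show ?thesis using x M d by (auto simp: diam_power_def ennreal_mult)
      next
        case d: True
        \<comment> \<open>The bound \<open>le\<close> concerns positive radii, so a set of diameter
          0 is approached by shrinking ones.\<close>
        have r: "emeasure N (S i) \<le> ennreal (M * (1 / real (Suc n)) powr s)" for n
        proof -
          have "emeasure N (S i) \<le> emeasure N {y \<in> space N. dist (f x) (f y) \<le> 1 / real (Suc n)}"
            unfolding Si d by (intro emeasure_mono meas) (auto intro: order_trans)
          also have "\<dots> \<le> ennreal (M * (1 / real (Suc n)) powr s)"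
            using x by (intro le) auto
          finally show ?thesis .
        qed
        \<comment> \<open>For \<open>s = 0\<close> a nonempty set costs 1 even at diameter 0, so a
          single radius will do; for positive \<open>s\<close> the bound has to tend to 0.\<close>
        show ?thesis
        proof (cases "s = 0")
          case True
          then show ?thesis using r[of 0] x by (auto simp: diam_power_def)
        next
          case False
          have "(\<lambda>n. ennreal (M * (1 / real (Suc n)) powr s)) \<longlonglongrightarrow> ennreal (M * 0 powr s)"
            using s False
            by (intro tendsto_ennrealI tendsto_mult tendsto_const tendsto_powr2[OF LIMSEQ_Suc[OF lim_1_over_n]]) auto
          then have "emeasure N (S i) \<le> ennreal (M * 0 powr s)"
            by (rule LIMSEQ_le_const) (use r in blast)
          then show ?thesis using False by simp
        qed
      qed
    qed (simp add: S_def)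
    have "emeasure N B \<le> emeasure N (\<Union>i. S i)"
      using cover S by (intro emeasure_mono) auto
    also have "\<dots> \<le> (\<Sum>i. emeasure N (S i))"
      using S by (intro emeasure_subadditive_countably) auto
    also have "\<dots> \<le> (\<Sum>i. ennreal M * diam_power s (U i))"
      by (intro suminf_le mass) auto
    finally show ?thesis by simp
  qed
  define b where "b = measure N B"
  have b: "0 < b" "emeasure N B = ennreal b"
    using B(2) by (auto simp: b_def emeasure_eq_measure zero_less_measure_iff)
  \<comment> \<open>Since \<open>M / (M + 1) < 1\<close>, a covering this cheap carries less mass
    than \<open>B\<close>; the 1 in the denominator covers the case \<open>M = 0\<close>.\<close>
  have "hausdorff_pre s 1 E < ennreal (b / (M + 1))"
    using pre b M by simp
  then obtain U where U: "E \<subseteq> (\<Union>i::nat. U i)" "\<And>i. bounded (U i)" "\<And>i. diameter (U i) \<le> 1"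
      "(\<Sum>i. diam_power s (U i)) < ennreal (b / (M + 1))"
    unfolding hausdorff_pre_def INF_less_iff by blast
  have "ennreal b \<le> ennreal M * (\<Sum>i. diam_power s (U i))"
    using *[OF U(1-3)] b by simp
  also have "\<dots> \<le> ennreal M * ennreal (b / (M + 1))"
    using U(4) by (intro mult_left_mono) auto
  also have "\<dots> = ennreal (M * (b / (M + 1)))"
    using M b by (subst ennreal_mult) auto
  finally have "b \<le> M * (b / (M + 1))" using M b by (simp add: ennreal_le_iff)
  then show False using M b by (simp add: field_simps)
qed

text \<open>Balls of radius \<open>r / 2\<close> around an \<open>r\<close>-separated set are disjoint, and each of them
  contributes \<open>(r / 2) powr (\<beta> * q)\<close> to the \<open>L\<^sup>q\<close> integral at scale \<open>r\<close>.\<close>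

lemma hausdorff_outer_eq_0_Lq:
  fixes f :: "'b \<Rightarrow> 'a::metric_space"
  assumes N: "finite_measure N" and q: "1 \<le> q" and \<beta>: "0 \<le> \<beta>" and C: "0 \<le> C"
    and meas: "\<And>x r. {y \<in> space N. dist x (f y) \<le> r} \<in> sets N"
    and Lq: "\<And>k::nat. (\<integral>\<^sup>+x. ennreal (measure N {y \<in> space N. dist (f x) (f y) \<le> 1 / 2 ^ k} powr (q - 1)) \<partial>N)
        \<le> ennreal (C * (1 / 2 ^ k) powr \<sigma>)"
    and lower: "\<And>x r. x \<in> E \<Longrightarrow> 0 < r \<Longrightarrow> r \<le> r0 \<Longrightarrow> r powr \<beta> \<le> measure N {y \<in> space N. dist x (f y) \<le> r}"
    and r0: "0 < r0" and s: "0 < s" "\<beta> * q - \<sigma> < s"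
  shows "hausdorff_outer s E = 0"
proof (rule hausdorff_outer_eq_0_balls[OF s(1)])
  interpret finite_measure N by (rule N)
  fix e :: real assume e: "0 < e"
  have bound: "real (card F) \<le> C * 2 powr (\<beta> * q) * (1 / 2 ^ k) powr (\<sigma> - \<beta> * q)"
    if k: "1 / 2 ^ k \<le> r0" and F: "finite F" "F \<subseteq> E" "\<And>x y. x \<in> F \<Longrightarrow> y \<in> F \<Longrightarrow> x \<noteq> y \<Longrightarrow> 1 / 2 ^ k < dist x y"
    for k :: nat and F
  proof -
    define r :: real where "r = 1 / 2 ^ k"
    have r: "0 < r" by (simp add: r_def)
    have r2: "r / 2 \<le> r0" using k r unfolding r_def[symmetric] by linarith
    define S where "S x = {y \<in> space N. dist x (f y) \<le> r / 2}" for x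
    have S: "S x \<in> sets N" for x unfolding S_def by (rule meas)
    define b where "b = (r / 2) powr \<beta>"
    have b: "0 < b" using r by (simp add: b_def)
    have bS: "b \<le> measure N (S x)" if "x \<in> F" for x
      unfolding b_def S_def using that F(2) r2 r by (intro lower) auto
    have "(\<Sum>x\<in>F. ennreal (b powr (q - 1)) * emeasure N (S x)) =
      (\<integral>\<^sup>+y. (\<Sum>x\<in>F. ennreal (b powr (q - 1)) * indicator (S x) y) \<partial>N)"
      using S by (subst nn_integral_sum) (auto simp: nn_integral_cmult)
    also have "\<dots> \<le> (\<integral>\<^sup>+x. ennreal (measure N {y \<in> space N. dist (f x) (f y) \<le> r} powr (q - 1)) \<partial>N)"
    proof (rule nn_integral_mono)
      fix y assume y: "y \<in> space N"
      show "(\<Sum>x\<in>F. ennreal (b powr (q - 1)) * indicator (S x) y) \<le>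
        ennreal (measure N {z \<in> space N. dist (f y) (f z) \<le> r} powr (q - 1))"
      proof (cases "\<exists>x\<in>F. y \<in> S x")
        case True
        then obtain x where x: "x \<in> F" "y \<in> S x" by blast
        have other: "y \<notin> S x'" if "x' \<in> F" "x' \<noteq> x" for x'
        proof
          assume "y \<in> S x'"
          then have "dist x' x \<le> r / 2 + r / 2"
            using x(2) by (intro order_trans[OF dist_triangle2[of _ _ "f y"]] add_mono) (auto simp: S_def)
          then show False using F(3)[OF that(1) x(1) that(2)] by (simp add: r_def)
        qed
        have "(\<Sum>x\<in>F. ennreal (b powr (q - 1)) * indicator (S x) y) = (\<Sum>x'\<in>F. if x' = x then ennreal (b powr (q - 1)) else 0)"
          using x other by (intro sum.cong) (auto simp: indicator_def)
        also have "\<dots> = ennreal (b powr (q - 1))" using F(1) x(1) by simp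
        also have "\<dots> \<le> ennreal (measure N {z \<in> space N. dist (f y) (f z) \<le> r} powr (q - 1))"
        proof (intro ennreal_leI powr_mono2)
          have "S x \<subseteq> {z \<in> space N. dist (f y) (f z) \<le> r}"
          proof
            fix z assume "z \<in> S x"
            then have "dist (f y) (f z) \<le> r / 2 + r / 2"
              using x(2) by (intro order_trans[OF dist_triangle3[of _ _ x]] add_mono) (auto simp: S_def)
            then show "z \<in> {z \<in> space N. dist (f y) (f z) \<le> r}" using \<open>z \<in> S x\<close> by (simp add: S_def)
          qed
          then have "measure N (S x) \<le> measure N {z \<in> space N. dist (f y) (f z) \<le> r}"
            by (intro finite_measure_mono meas)
          then show "b \<le> measure N {z \<in> space N. dist (f y) (f z) \<le> r}" using bS[OF x(1)] by simp
        qed (use q b in auto)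
        finally show ?thesis .
      next
        case False
        then have "(\<Sum>x\<in>F. ennreal (b powr (q - 1)) * indicator (S x) y) = 0" by (intro sum.neutral) auto
        then show ?thesis by simp
      qed
    qed
    also have "\<dots> \<le> ennreal (C * r powr \<sigma>)" unfolding r_def by (rule Lq)
    finally have le: "(\<Sum>x\<in>F. ennreal (b powr (q - 1)) * emeasure N (S x)) \<le> ennreal (C * r powr \<sigma>)" .
    have "(\<Sum>x\<in>F. ennreal (b powr (q - 1)) * emeasure N (S x)) = ennreal (\<Sum>x\<in>F. b powr (q - 1) * measure N (S x))"
      by (simp add: emeasure_eq_measure ennreal_mult[symmetric])
    with le have le': "(\<Sum>x\<in>F. b powr (q - 1) * measure N (S x)) \<le> C * r powr \<sigma>"
      using C by (simp add: ennreal_le_iff)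
    have bq: "b powr (q - 1) * b = b powr q"
    proof -
      have "b powr q = b powr (q - 1) * b powr 1" by (subst powr_add[symmetric]) simp
      then show ?thesis using b by simp
    qed
    have "real (card F) * b powr q = (\<Sum>x\<in>F. b powr (q - 1) * b)" by (simp add: bq)
    also have "\<dots> \<le> (\<Sum>x\<in>F. b powr (q - 1) * measure N (S x))"
      by (intro sum_mono mult_left_mono bS) auto
    also have "\<dots> \<le> C * r powr \<sigma>" by (rule le')
    finally have "real (card F) \<le> C * r powr \<sigma> / b powr q"
      using b by (simp add: field_simps)
    also have "b powr q = r powr (\<beta> * q) / 2 powr (\<beta> * q)"
      using r by (simp add: b_def powr_powr powr_divide)
    also have "C * r powr \<sigma> / (r powr (\<beta> * q) / 2 powr (\<beta> * q)) = C * 2 powr (\<beta> * q) * r powr (\<sigma> - \<beta> * q)"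
      using r by (simp add: powr_diff field_simps)
    finally show ?thesis by (simp add: r_def)
  qed
  \<comment> \<open>The exponent left over when a constant times
    \<open>r powr (\<sigma> - \<beta> * q)\<close> balls of radius \<open>r\<close> are charged
    \<open>(2 * r) powr s\<close> each.\<close>
  define \<kappa> where "\<kappa> = s + \<sigma> - \<beta> * q"
  have \<kappa>: "0 < \<kappa>" using s by (simp add: \<kappa>_def)
  have lim1: "(\<lambda>k. (1 / 2) ^ k :: real) \<longlonglongrightarrow> 0" by (intro LIMSEQ_power_zero) simp
  have lim1': "(\<lambda>k. 1 / 2 ^ k :: real) \<longlonglongrightarrow> 0" using lim1 by (simp add: power_one_over)
  have lim2: "(\<lambda>k. C * 2 powr (\<beta> * q) * 2 powr s * (1 / 2 ^ k) powr \<kappa>) \<longlonglongrightarrow> C * 2 powr (\<beta> * q) * 2 powr s * 0 powr \<kappa>"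
    using \<kappa> by (intro tendsto_mult tendsto_const tendsto_powr2[OF lim1']) auto
  have "\<forall>\<^sub>F k in sequentially. C * 2 powr (\<beta> * q) * 2 powr s * (1 / 2 ^ k) powr \<kappa> < e"
    using order_tendstoD(2)[OF lim2, of e] e \<kappa> by simp
  moreover have "\<forall>\<^sub>F k in sequentially. 1 / 2 ^ k < min e r0"
    using order_tendstoD(2)[OF lim1', of "min e r0"] e r0 by simp
  ultimately have "\<forall>\<^sub>F k in sequentially. C * 2 powr (\<beta> * q) * 2 powr s * (1 / 2 ^ k) powr \<kappa> < e \<and> 1 / 2 ^ k < min e r0"
    by (rule eventually_conj)
  then obtain k :: nat where k: "C * 2 powr (\<beta> * q) * 2 powr s * (1 / 2 ^ k) powr \<kappa> < e" "1 / 2 ^ k < min e r0"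
    by (auto simp: eventually_sequentially)
  define r :: real where "r = 1 / 2 ^ k"
  have r: "0 < r" "r \<le> e" "r \<le> r0" using k by (auto simp: r_def)
  define sep where "sep F \<longleftrightarrow> finite F \<and> F \<subseteq> E \<and> (\<forall>x\<in>F. \<forall>y\<in>F. x \<noteq> y \<longrightarrow> r < dist x y)" for F
  define K where "K = C * 2 powr (\<beta> * q) * r powr (\<sigma> - \<beta> * q)"
  have card: "real (card F) \<le> K" if "sep F" for F
    unfolding K_def r_def by (rule bound) (use that r in \<open>auto simp: sep_def r_def\<close>)
  \<comment> \<open>Separated sets have bounded cardinality, so one of largest size exists. If its
    balls missed a point of \<open>E\<close>, adding that point would enlarge it.\<close>
  have "\<exists>F. sep F \<and> (\<forall>G. sep G \<longrightarrow> card G \<le> card F)"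
  proof -
    have "\<forall>F. sep F \<longrightarrow> card F < Suc (nat \<lceil>K\<rceil>)"
    proof (intro allI impI)
      fix F assume "sep F"
      from card[OF this] show "card F < Suc (nat \<lceil>K\<rceil>)" by linarith
    qed
    moreover have "sep {}" by (simp add: sep_def)
    ultimately show ?thesis by (rule ex_has_greatest_nat[rotated])
  qed
  then obtain F where F: "sep F" "\<And>G. sep G \<Longrightarrow> card G \<le> card F" by blast
  have "E \<subseteq> (\<Union>x\<in>F. cball x r)"
  proof (rule ccontr)
    assume "\<not> ?thesis"
    then obtain x where x0: "x \<in> E" "x \<notin> (\<Union>x\<in>F. cball x r)" by blast
    have x: "x \<in> E" "\<And>y. y \<in> F \<Longrightarrow> r < dist y x"
      using x0 by (force simp: not_le)+
    then have "x \<notin> F" using r(1) by fastforce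
    have "sep (insert x F)"
      using F(1) x by (auto simp: sep_def dist_commute)
    from F(2)[OF this] \<open>x \<notin> F\<close> F(1) show False by (simp add: sep_def)
  qed
  moreover have "real (card F) * (2 * r) powr s \<le> e"
  proof -
    have "real (card F) * (2 * r) powr s \<le> K * (2 * r) powr s"
      using card[OF F(1)] by (rule mult_right_mono) simp
    also have "\<dots> = C * 2 powr (\<beta> * q) * 2 powr s * r powr \<kappa>"
    proof -
      have "r powr (\<sigma> - \<beta> * q) * r powr s = r powr \<kappa>" by (subst powr_add[symmetric]) (simp add: \<kappa>_def algebra_simps)
      then show ?thesis by (simp add: K_def powr_mult mult_ac)
    qed
    finally show ?thesis using k(1) by (simp add: r_def)
  qed
  ultimately show "\<exists>F r. finite F \<and> 0 < r \<and> r \<le> e \<and> E \<subseteq> (\<Union>x\<in>F. cball x r) \<and> real (card F) * (2 * r) powr s \<le> e"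
    using F(1) r by (auto simp: sep_def)
qed

section \<open>Dimension of the level set\<close>

text \<open>Constants are negligible against \<open>ln r\<close>, which tends to minus infinity. As
  \<open>ln r\<close> is negative, the lower bound for \<open>m\<close> becomes the upper bound for
  the quotient.\<close>

lemma local_dim_tendsto:
  fixes m :: "real \<Rightarrow> real"
  assumes lower: "\<And>e. 0 < e \<Longrightarrow> \<exists>c>0. \<forall>r. 0 < r \<longrightarrow> r \<le> 1 \<longrightarrow> c * r powr (\<alpha> + e) \<le> m r"
    and upper: "\<And>e. 0 < e \<Longrightarrow> \<exists>C. \<forall>r. 0 < r \<longrightarrow> r \<le> 1 \<longrightarrow> m r \<le> C * r powr (\<alpha> - e)"
  shows "((\<lambda>r. ln (m r) / ln r) \<longlongrightarrow> \<alpha>) (at_right 0)"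
proof -
  have small: "((\<lambda>r. K / ln r) \<longlongrightarrow> 0) (at_right 0)" for K :: real
    using ln_at_0 by (intro tendsto_divide_0[OF tendsto_const] filterlim_at_bot_imp_at_infinity)
  have ev: "\<forall>\<^sub>F r::real in at_right 0. 0 < r \<and> r < 1"
    by (intro eventually_conj eventually_at_right_less) (auto simp: eventually_at_right_field intro: exI[of _ 1])
  obtain c0 where c0: "0 < c0" "\<And>r. 0 < r \<Longrightarrow> r \<le> 1 \<Longrightarrow> c0 * r powr (\<alpha> + 1) \<le> m r"
    using lower[of 1] by auto
  have mpos: "0 < m r" if "0 < r" "r \<le> 1" for r
    using c0(2)[OF that] c0(1) that by (smt (verit) mult_pos_pos powr_gt_zero)
  show ?thesis
  proof (rule order_tendstoI)
    fix l assume l: "l < \<alpha>"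
    define e where "e = (\<alpha> - l) / 2"
    have e: "0 < e" "\<alpha> - e - e = l" using l by (auto simp: e_def field_simps)
    obtain C where C: "\<And>r. 0 < r \<Longrightarrow> r \<le> 1 \<Longrightarrow> m r \<le> C * r powr (\<alpha> - e)"
      using upper[OF e(1)] by auto
    have Cpos: "0 < C" using C[of 1] mpos[of 1] by simp
    show "\<forall>\<^sub>F r in at_right 0. l < ln (m r) / ln r"
      using ev order_tendstoD(1)[OF small[of "ln C"], of "- e", simplified, OF e(1)]
    proof eventually_elim
      case (elim r)
      have "ln (m r) \<le> ln (C * r powr (\<alpha> - e))"
        using mpos[of r] C[of r] elim by (intro ln_mono) auto
      also have "\<dots> = ln C + (\<alpha> - e) * ln r" using elim Cpos by (simp add: ln_mult ln_powr)
      finally have "(ln C + (\<alpha> - e) * ln r) / ln r \<le> ln (m r) / ln r"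
        using elim by (intro divide_right_mono_neg) auto
      then have "ln C / ln r + (\<alpha> - e) \<le> ln (m r) / ln r"
        using elim by (simp add: add_divide_distrib)
      then show ?case using elim e by linarith
    qed
  next
    fix u assume u: "\<alpha> < u"
    define e where "e = (u - \<alpha>) / 2"
    have e: "0 < e" "\<alpha> + e + e = u" using u by (auto simp: e_def field_simps)
    obtain c where c: "0 < c" "\<And>r. 0 < r \<Longrightarrow> r \<le> 1 \<Longrightarrow> c * r powr (\<alpha> + e) \<le> m r"
      using lower[OF e(1)] by auto
    show "\<forall>\<^sub>F r in at_right 0. ln (m r) / ln r < u"
      using ev order_tendstoD(2)[OF small[of "ln c"], of e, OF e(1)]
    proof eventually_elim
      case (elim r)
      have "ln c + (\<alpha> + e) * ln r = ln (c * r powr (\<alpha> + e))" using elim c(1) by (simp add: ln_mult ln_powr)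
      also have "\<dots> \<le> ln (m r)"
        using c elim by (intro ln_mono) auto
      finally have "ln (m r) / ln r \<le> (ln c + (\<alpha> + e) * ln r) / ln r"
        using elim by (intro divide_right_mono_neg) auto
      then have "ln (m r) / ln r \<le> ln c / ln r + (\<alpha> + e)"
        using elim by (simp add: add_divide_distrib)
      then show ?case using elim e by linarith
    qed
  qed
qed

section \<open>Mass of balls at coded points and the two dimension bounds\<close>

context diag_system
begin

text \<open>The ball contains a cylinder whose largest ratio is comparable to \<open>r\<close>. The
  terms of a summable series are bounded, so the mass of this cylinder is at least a constant times
  its ratio to the power \<open>\<beta>\<close>.\<close>

lemma measure_near_lower:
  assumes P: "\<And>i. 0 < pmf P i" and \<beta>: "0 \<le> \<beta>"
    and sm: "summable (\<lambda>n. stream_prod (\<lambda>i. ratio i powr \<beta> / pmf P i) n I)"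
  shows "\<exists>e>0. \<forall>r. 0 < r \<longrightarrow> r \<le> 1 \<longrightarrow>
    e * r powr \<beta> \<le> measure (stream_space (measure_pmf P)) (near a r I)"
proof -
  interpret prob_space "stream_space (measure_pmf P)" by (rule prob_space_stream_pmf)
  obtain M where M: "0 < M" "\<And>n. \<bar>stream_prod (\<lambda>i. ratio i powr \<beta> / pmf P i) n I\<bar> \<le> M"
    using summable_imp_Bseq[OF sm] unfolding Bseq_def by (auto simp: real_norm_def)
  define tm where "tm = Min (range ratio)"
  have tm: "tm \<le> ratio i" for i unfolding tm_def by (rule Min_le) auto
  have tm0: "0 < tm" unfolding tm_def using t_pos by (subst Min_gr_iff) auto
  have tm1: "tm \<le> 1" using tm[of undefined] first_le[of undefined] c_less_1 by linarith
  \<comment> \<open>\<open>K\<close> bounds the diameter of a cylinder in units of its largest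
    ratio; the summand 1 keeps it positive for \<open>a = 0\<close>.\<close>
  define K where "K = real CARD('d) * (2 * norm a / (1 - c)) + 1"
  have K: "1 \<le> K" using c_less_1 by (simp add: K_def)
  define e where "e = (tm / K) powr \<beta> / M"
  show ?thesis
  proof (intro exI[of _ e] conjI allI impI)
    show "0 < e" using tm0 K M(1) by (simp add: e_def)
    fix r :: real assume r: "0 < r" "r \<le> 1"
    have tau_pos: "0 < stream_prod ratio n I" for n by (rule stream_prod_pos) (rule t_pos)
    have ex: "\<exists>n. K * stream_prod ratio n I \<le> r"
    proof -
      obtain n where n: "c ^ n < r / K"
        using real_arch_pow_inv[of "r / K" c] r K c_less_1 by auto
      have "stream_prod ratio n I \<le> c ^ n"
        using t_pos first_le by (intro stream_prod_le_power) (auto intro: less_imp_le)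
      then have "stream_prod ratio n I \<le> r / K" using n by simp
      then show ?thesis using K by (intro exI[of _ n]) (simp add: field_simps)
    qed
    \<comment> \<open>The first cylinder that fits. Its parent does not fit, so at most a factor
      \<open>tm\<close> is lost; if there is no parent, \<open>r \<le> 1\<close> helps.\<close>
    define n where "n = (LEAST n. K * stream_prod ratio n I \<le> r)"
    have n: "K * stream_prod ratio n I \<le> r" unfolding n_def by (rule LeastI_ex[OF ex])
    have big: "tm / K * r \<le> stream_prod ratio n I"
    proof (cases n)
      case 0
      have "tm / K * r \<le> 1 * 1" using tm0 tm1 K r by (intro mult_mono) (auto simp: field_simps)
      then show ?thesis by (simp add: 0)
    next
      case (Suc m)
      have "\<not> K * stream_prod ratio m I \<le> r"
        using not_less_Least[of m "\<lambda>n. K * stream_prod ratio n I \<le> r"] Suc by (simp add: n_def)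
      then have "r / K \<le> stream_prod ratio m I" using K by (simp add: field_simps)
      then have "r / K * tm \<le> stream_prod ratio m I * ratio (I !! m)"
        using r K tm tm0 tau_pos[of m] by (intro mult_mono) auto
      then show ?thesis by (simp add: Suc stream_prod_Suc mult.commute)
    qed
    have p: "0 < stream_prod (pmf P) n I" by (rule stream_prod_pos) (rule P)
    have "e * r powr \<beta> = (tm / K * r) powr \<beta> / M"
      unfolding e_def powr_mult by simp
    also have "\<dots> \<le> stream_prod ratio n I powr \<beta> / M"
      using big \<beta> tm0 K r M(1) by (intro divide_right_mono powr_mono2) auto
    also have "\<dots> \<le> stream_prod (pmf P) n I"
    proof -
      have "stream_prod ratio n I powr \<beta> = stream_prod (\<lambda>i. ratio i powr \<beta> / pmf P i * pmf P i) n I"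
        using P by (simp add: stream_prod_powr less_imp_le[OF t_pos] less_imp_neq[THEN not_sym])
      also have "\<dots> = stream_prod (\<lambda>i. ratio i powr \<beta> / pmf P i) n I * stream_prod (pmf P) n I"
        by (rule stream_prod_mult)
      also have "\<dots> \<le> M * stream_prod (pmf P) n I"
        using M(2)[of n] p by (intro mult_right_mono) auto
      finally show ?thesis using M(1) by (simp add: field_simps)
    qed
    also have "\<dots> \<le> measure (stream_space (measure_pmf P)) (near a r I)"
    proof -
      have "{J. \<forall>k<n. J !! k = I !! k} \<subseteq> near a r I"
      proof
        fix J assume "J \<in> {J. \<forall>k<n. J !! k = I !! k}"
        then have "dist (coding_map t a I) (coding_map t a J) \<le> (K - 1) * stream_prod ratio n I"
          using dist_coding_map_le[of n I J a] by (simp add: K_def)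
        also have "\<dots> \<le> K * stream_prod ratio n I"
          using tau_pos[of n] by (intro mult_right_mono) auto
        finally show "J \<in> near a r I" using n by (simp add: near_def)
      qed
      then have "measure (stream_space (measure_pmf P)) {J. \<forall>k<n. J !! k = I !! k} \<le>
          measure (stream_space (measure_pmf P)) (near a r I)"
        by (intro finite_measure_mono) (simp_all add: sets_stream_pmf sets_near)
      then show ?thesis
        using p by (simp add: measure_def emeasure_stream_prefix)
    qed
    finally show "e * r powr \<beta> \<le> measure (stream_space (measure_pmf P)) (near a r I)" .
  qed
qed

lemma measure_near_mono:
  assumes "r \<le> r'"
  shows "measure (stream_space (measure_pmf P)) (near a r I) \<le> measure (stream_space (measure_pmf P)) (near a r' I)"
proof -
  interpret prob_space "stream_space (measure_pmf P)" by (rule prob_space_stream_pmf)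
  have "near a r I \<subseteq> near a r' I" using assms by (auto simp: near_def)
  then show ?thesis by (rule finite_measure_mono) (simp add: sets_stream_pmf sets_near)
qed

text \<open>Rounding \<open>r\<close> up to a power of 1/2 at most doubles it, which costs the
  factor \<open>2 powr \<sigma>\<close>.\<close>

lemma measure_near_upper:
  assumes fin: "energy P 2 \<sigma> a I \<noteq> \<infinity>" and \<sigma>: "0 \<le> \<sigma>" and r: "0 < r" "r \<le> 1"
  shows "measure (stream_space (measure_pmf P)) (near a r I) \<le> enn2real (energy P 2 \<sigma> a I) * 2 powr \<sigma> * r powr \<sigma>"
proof -
  interpret prob_space "stream_space (measure_pmf P)" by (rule prob_space_stream_pmf)
  define C where "C = enn2real (energy P 2 \<sigma> a I)"
  have C: "0 \<le> C" by (simp add: C_def)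
  have le: "measure (stream_space (measure_pmf P)) (near a (1 / 2 ^ k) I) \<le> C * (1 / 2 ^ k) powr \<sigma>" for k
    using energy_bound[OF fin, of k] by (simp add: C_def)
    have ex: "\<exists>n. (1 / 2) ^ n < r" using real_arch_pow_inv[of r "1/2"] r by auto
    define n where "n = (LEAST n. (1 / 2) ^ n < r)"
    have n: "(1 / 2) ^ n < r" unfolding n_def by (rule LeastI_ex[OF ex])
    \<comment> \<open>\<open>n\<close> is positive, as \<open>n = 0\<close> would mean
      \<open>1 < r\<close>.\<close>
    obtain k where k: "n = Suc k" using n r by (cases n) auto
    have rk: "r \<le> (1 / 2) ^ k"
      using not_less_Least[of k "\<lambda>n. (1 / 2) ^ n < r"] k by (simp add: n_def)
    have k2: "(1 / 2) ^ k \<le> 2 * r" using n k by simp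
    have "measure (stream_space (measure_pmf P)) (near a r I) \<le>
        measure (stream_space (measure_pmf P)) (near a (1 / 2 ^ k) I)"
      using rk by (intro measure_near_mono) (simp add: power_one_over)
    also have "\<dots> \<le> C * (1 / 2 ^ k) powr \<sigma>" by (rule le)
    also have "\<dots> \<le> C * (2 * r) powr \<sigma>"
      using k2 C \<sigma> by (intro mult_left_mono powr_mono2) (auto simp: power_one_over)
    finally show ?thesis
      using r by (simp add: powr_mult C_def)
qed

abbreviation "coded_measure P a \<equiv> distr (stream_space (measure_pmf P)) borel (coding_map t a)"

lemma measure_coded_cball:
  "measure (coded_measure P a) (cball x r) =
    measure (stream_space (measure_pmf P)) {J. dist x (coding_map t a J) \<le> r}"
  by (subst measure_distr) (simp_all add: vimage_def)

lemma sets_dist_coding: "{J. dist x (coding_map t a J) \<le> r} \<in> sets (stream_space (count_space UNIV))"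
  using measurable_sets[OF measurable_coding_map, of "cball x r" a]
  by (simp add: vimage_def space_stream_space)

text \<open>At points of the level set small balls have mass at least
  \<open>r powr (\<alpha> + e)\<close>, and the integrated energy limits the number of disjoint
  balls of this kind. The radius from which on the bound holds depends on the point, hence the
  countable decomposition into the sets \<open>E n\<close>.\<close>

lemma hausdorff_dim_level_set_le:
  assumes \<alpha>: "0 \<le> \<alpha>" and q: "2 \<le> q" and H: "0 \<le> \<alpha> * q - D"
    and en: "\<And>n::nat. (\<integral>\<^sup>+I. energy P q (max 0 (D - 1 / real (Suc n))) a I \<partial>stream_space (measure_pmf P)) \<noteq> \<infinity>"
  shows "hausdorff_dim (local_dim_level_set (coded_measure P a) \<alpha>) \<le> ereal (\<alpha> * q - D)"
proof (rule hausdorff_dim_le[OF H])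
  let ?P = "stream_space (measure_pmf P)"
  interpret prob_space ?P by (rule prob_space_stream_pmf)
  fix s assume s: "\<alpha> * q - D < s"
  \<comment> \<open>Raising \<open>\<alpha>\<close> to \<open>\<beta>\<close> costs
    \<open>e * q\<close> and lowering \<open>D\<close> to \<open>\<sigma>\<close> costs less than
    \<open>e\<close>; together they fit into \<open>s - (\<alpha> * q - D)\<close>.\<close>
  define e where "e = (s - (\<alpha> * q - D)) / (q + 1)"
  have e: "0 < e" using s q by (simp add: e_def)
  have e2: "e * q + e = s - (\<alpha> * q - D)"
  proof -
    have "e * (q + 1) = s - (\<alpha> * q - D)" using q by (simp add: e_def)
    then show ?thesis by (simp add: distrib_left)
  qed
  obtain n :: nat where n: "1 / real (Suc n) < e" using e by (meson nat_approx_posE)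
  define \<sigma> where "\<sigma> = max 0 (D - 1 / real (Suc n))"
  define \<beta> where "\<beta> = \<alpha> + e"
  have \<beta>s: "\<beta> * q - \<sigma> < s"
  proof -
    have "D - e < \<sigma>" using n by (simp add: \<sigma>_def)
    then show ?thesis using e2 by (simp add: \<beta>_def algebra_simps)
  qed
  define X where "X = (\<integral>\<^sup>+I. energy P q \<sigma> a I \<partial>?P)"
  have X: "X \<noteq> \<infinity>" unfolding X_def \<sigma>_def by (rule en)
  have Lq: "(\<integral>\<^sup>+I. ennreal (measure ?P {J \<in> space ?P. dist (coding_map t a I) (coding_map t a J) \<le> 1 / 2 ^ k} powr (q - 1)) \<partial>?P)
      \<le> ennreal (enn2real X * (1 / 2 ^ k) powr \<sigma>)" for k :: nat
  proof -
    have "(\<integral>\<^sup>+I. ennreal (measure ?P {J \<in> space ?P. dist (coding_map t a I) (coding_map t a J) \<le> 1 / 2 ^ k} powr (q - 1)) \<partial>?P)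
      \<le> (\<integral>\<^sup>+I. ennreal ((1 / 2 ^ k) powr \<sigma>) * energy P q \<sigma> a I \<partial>?P)"
    proof (rule nn_integral_mono)
      fix I
      let ?m = "measure ?P (near a (1 / 2 ^ k) I) powr (q - 1)"
      have "ennreal ?m = ennreal ((1 / 2 ^ k) powr \<sigma>) * (ennreal ((2 ^ k) powr \<sigma>) * ennreal ?m)"
        by (simp add: ennreal_mult[symmetric] mult.assoc[symmetric] powr_mult[symmetric])
      also have "\<dots> \<le> ennreal ((1 / 2 ^ k) powr \<sigma>) * energy P q \<sigma> a I"
        unfolding energy_def
        using sum_le_suminf[of "\<lambda>k. ennreal ((2 ^ k) powr \<sigma>) *
          ennreal (measure ?P (near a (1 / 2 ^ k) I) powr (q - 1))" "{k}"]
        by (intro mult_left_mono) auto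
      finally show "ennreal (measure ?P {J \<in> space ?P. dist (coding_map t a I) (coding_map t a J) \<le> 1 / 2 ^ k} powr (q - 1)) \<le>
        ennreal ((1 / 2 ^ k) powr \<sigma>) * energy P q \<sigma> a I"
        by (simp add: near_def)
    qed
    also have "\<dots> = ennreal ((1 / 2 ^ k) powr \<sigma>) * X"
      unfolding X_def by (rule nn_integral_cmult) (simp add: measurable_cong_sets[OF sets_stream_pmf refl])
    also have "\<dots> = ennreal (enn2real X * (1 / 2 ^ k) powr \<sigma>)"
      using X by (simp add: ennreal_mult mult.commute less_top)
    finally show ?thesis .
  qed
  define E where "E n = {x. \<forall>r. 0 < r \<longrightarrow> r \<le> 1 / real (Suc n) \<longrightarrow>
    r powr \<beta> \<le> measure ?P {J \<in> space ?P. dist x (coding_map t a J) \<le> r}}" for n :: nat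
  have "hausdorff_outer s (E n) = 0" for n
  proof (rule hausdorff_outer_eq_0_Lq[where N = ?P and f = "coding_map t a" and q = q and \<beta> = \<beta> and \<sigma> = \<sigma>
        and C = "enn2real X" and ?r0.0 = "1 / real (Suc n)"])
    show "finite_measure ?P" by unfold_locales
    show "{J \<in> space ?P. dist x (coding_map t a J) \<le> r} \<in> sets ?P" for x r
      by (simp add: sets_stream_pmf sets_dist_coding)
    show "r powr \<beta> \<le> measure ?P {J \<in> space ?P. dist x (coding_map t a J) \<le> r}"
      if "x \<in> E n" "0 < r" "r \<le> 1 / real (Suc n)" for x r
      using that by (simp add: E_def)
  qed (use q \<alpha> e s H \<beta>s Lq in \<open>auto simp: \<beta>_def\<close>)
  then have "hausdorff_outer s (\<Union>n. E n) = 0" by (rule hausdorff_outer_Union_eq_0)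
  moreover have "local_dim_level_set (coded_measure P a) \<alpha> \<subseteq> (\<Union>n. E n)"
  proof
    fix x assume x: "x \<in> local_dim_level_set (coded_measure P a) \<alpha>"
    define m where "m r = measure (coded_measure P a) (cball x r)" for r
    have pos: "0 < m r" if "0 < r" for r using x that by (simp add: local_dim_level_set_def m_def)
    have lim: "((\<lambda>r. ln (m r) / ln r) \<longlongrightarrow> \<alpha>) (at_right 0)"
      using x by (simp add: local_dim_level_set_def m_def)
    have "\<forall>\<^sub>F r in at_right 0. ln (m r) / ln r < \<beta>"
      using order_tendstoD(2)[OF lim, of \<beta>] e by (simp add: \<beta>_def)
    then obtain b where b: "0 < b" "\<And>r. 0 < r \<Longrightarrow> r < b \<Longrightarrow> ln (m r) / ln r < \<beta>"
      by (auto simp: eventually_at_right_field)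
    obtain n where n: "1 / real (Suc n) < min b 1" using b(1) by (meson nat_approx_posE min_less_iff_conj zero_less_one)
    have "x \<in> E n"
      unfolding E_def
    proof (intro CollectI allI impI)
      fix r :: real assume r: "0 < r" "r \<le> 1 / real (Suc n)"
      have "r < min b 1" using r(2) n by (rule le_less_trans)
      then have r1: "r < b" "r < 1" by auto
      have "ln (m r) / ln r < \<beta>" using b(2) r r1 by simp
      then have "\<beta> * ln r < ln (m r)" using r r1 by (simp add: neg_divide_less_eq)
      then have "exp (\<beta> * ln r) < exp (ln (m r))" by simp
      then have "r powr \<beta> \<le> m r" using r pos[OF r(1)] by (simp add: powr_def)
      then show "r powr \<beta> \<le> measure ?P {J \<in> space ?P. dist x (coding_map t a J) \<le> r}"
        by (simp add: m_def measure_coded_cball)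
    qed
    then show "x \<in> (\<Union>n. E n)" by blast
  qed
  ultimately show "hausdorff_outer s (local_dim_level_set (coded_measure P a) \<alpha>) = 0"
    using hausdorff_outer_mono[of _ _ s] by (metis le_zero_eq)
qed

lemma coded_point_in_level_set:
  assumes lower: "\<And>n::nat. \<exists>e>0. \<forall>r. 0 < r \<longrightarrow> r \<le> 1 \<longrightarrow>
      e * r powr (\<alpha> + 1 / real (Suc n)) \<le> measure (stream_space (measure_pmf P)) (near a r I)"
    and upper: "\<And>n::nat. \<exists>C\<ge>0. \<forall>r. 0 < r \<longrightarrow> r \<le> 1 \<longrightarrow>
      measure (stream_space (measure_pmf P)) (near a r I) \<le> C * r powr (max 0 (\<alpha> - 1 / real (Suc n)))"
  shows "coding_map t a I \<in> local_dim_level_set (coded_measure P a) \<alpha>"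
proof -
  interpret prob_space "stream_space (measure_pmf P)" by (rule prob_space_stream_pmf)
  define m where "m r = measure (stream_space (measure_pmf P)) (near a r I)" for r
  have m_eq: "measure (coded_measure P a) (cball (coding_map t a I) r) = m r" for r
    by (simp add: measure_coded_cball m_def near_def)
  have mono: "m r \<le> m r'" if "r \<le> r'" for r r'
    unfolding m_def using that by (rule measure_near_mono)
  have pos: "0 < m r" if r: "0 < r" for r
  proof -
    obtain e where e: "0 < e" "\<And>r. 0 < r \<Longrightarrow> r \<le> 1 \<Longrightarrow> e * r powr (\<alpha> + 1) \<le> m r"
      using lower[of 0] by (auto simp: m_def)
    have "0 < e * min r 1 powr (\<alpha> + 1)" using e r by simp
    also have "\<dots> \<le> m (min r 1)" using r by (intro e) auto
    also have "\<dots> \<le> m r" by (rule mono) simp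
    finally show ?thesis .
  qed
  have "((\<lambda>r. ln (m r) / ln r) \<longlongrightarrow> \<alpha>) (at_right 0)"
  proof (rule local_dim_tendsto)
    fix e :: real assume "0 < e"
    then obtain n where n: "1 / real (Suc n) < e" by (meson nat_approx_posE)
    obtain k where k: "0 < k" "\<And>r. 0 < r \<Longrightarrow> r \<le> 1 \<Longrightarrow> k * r powr (\<alpha> + 1 / real (Suc n)) \<le> m r"
      using lower[of n] by (auto simp: m_def)
    have "k * r powr (\<alpha> + e) \<le> m r" if "0 < r" "r \<le> 1" for r
    proof -
      have "k * r powr (\<alpha> + e) \<le> k * r powr (\<alpha> + 1 / real (Suc n))"
        using that n k(1) by (intro mult_left_mono powr_mono') auto
      then show ?thesis using k(2)[OF that] by simp
    qed
    with k(1) show "\<exists>k>0. \<forall>r. 0 < r \<longrightarrow> r \<le> 1 \<longrightarrow> k * r powr (\<alpha> + e) \<le> m r" by blast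
    obtain C where C: "0 \<le> C" "\<And>r. 0 < r \<Longrightarrow> r \<le> 1 \<Longrightarrow> m r \<le> C * r powr (max 0 (\<alpha> - 1 / real (Suc n)))"
      using upper[of n] by (auto simp: m_def)
    have "m r \<le> C * r powr (\<alpha> - e)" if "0 < r" "r \<le> 1" for r
    proof -
      have "C * r powr (max 0 (\<alpha> - 1 / real (Suc n))) \<le> C * r powr (\<alpha> - e)"
        using that n C(1) by (intro mult_left_mono powr_mono') auto
      then show ?thesis using C(2)[OF that] by simp
    qed
    then show "\<exists>C. \<forall>r. 0 < r \<longrightarrow> r \<le> 1 \<longrightarrow> m r \<le> C * r powr (\<alpha> - e)" by blast
  qed
  then show ?thesis using pos by (simp add: local_dim_level_set_def m_eq)
qed

text \<open>The energy is finite almost everywhere, but with no uniform bound. On one of the sets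
  \<open>B k\<close>, of positive measure, it is at most \<open>k\<close>, and this set serves in
  \<open>mass_distribution\<close>.\<close>

lemma hausdorff_dim_ge_energy:
  assumes E: "AE I in stream_space (measure_pmf W). coding_map t a I \<in> E"
    and en: "\<And>n::nat. AE I in stream_space (measure_pmf W). energy W 2 (max 0 (H - 1 / real (Suc n))) a I \<noteq> \<infinity>"
  shows "E \<noteq> {}" and "ereal H \<le> hausdorff_dim E"
proof -
  let ?W = "stream_space (measure_pmf W)"
  interpret prob_space ?W by (rule prob_space_stream_pmf)
  show "E \<noteq> {}"
  proof
    assume "E = {}"
    with E have "AE I in ?W. False" by simp
    then show False by simp
  qed
  show "ereal H \<le> hausdorff_dim E"
  proof (rule hausdorff_dim_ge)
    fix s assume s: "0 \<le> s" "s < H"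
    then obtain n where n: "1 / real (Suc n) < H - s" by (meson nat_approx_posE diff_gt_0_iff_gt)
    define \<sigma> where "\<sigma> = max 0 (H - 1 / real (Suc n))"
    have \<sigma>: "0 \<le> \<sigma>" "s \<le> \<sigma>" using n s by (auto simp: \<sigma>_def)
    have "AE I in ?W. coding_map t a I \<in> E \<and> energy W 2 \<sigma> a I \<noteq> \<infinity>"
      using E en[of n] unfolding \<sigma>_def by eventually_elim simp
    then obtain Z where Z: "{I \<in> space ?W. \<not> (coding_map t a I \<in> E \<and> energy W 2 \<sigma> a I \<noteq> \<infinity>)} \<subseteq> Z"
        "emeasure ?W Z = 0" "Z \<in> sets ?W"
      by (rule AE_E)
    \<comment> \<open>The codes whose points lie in \<open>E\<close> need not form a measurable set,
      so the measurable null set \<open>Z\<close> is removed instead.\<close>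
    define B where "B k = {I. energy W 2 \<sigma> a I \<le> of_nat k} - Z" for k
    have B: "B k \<in> sets ?W" for k
    proof -
      have "{I \<in> space (stream_space (count_space UNIV)). energy W 2 \<sigma> a I \<le> of_nat k} \<in> sets (stream_space (count_space UNIV))"
        by measurable
      then show ?thesis using Z(3) unfolding B_def sets_stream_pmf by (simp add: space_stream_space sets.Diff)
    qed
    have "\<exists>k. emeasure ?W (B k) \<noteq> 0"
    proof (rule ccontr)
      assume "\<not> ?thesis"
      then have "(\<Union>k. B k) \<in> null_sets ?W" using B by (intro null_sets_UN) auto
      then have "(\<Union>k. B k) \<union> Z \<in> null_sets ?W" using Z by (intro null_sets.Un) auto
      moreover have "(\<Union>k. B k) \<union> Z = space ?W"
      proof -
        have "I \<in> (\<Union>k. B k)" if "I \<notin> Z" for I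
        proof -
          have "energy W 2 \<sigma> a I \<noteq> \<infinity>" using Z(1) that by auto
          then obtain k :: nat where "energy W 2 \<sigma> a I \<le> of_nat k"
            using ennreal_Ex_less_of_nat[of "energy W 2 \<sigma> a I"] by (auto simp: less_top intro: less_imp_le)
          then show ?thesis using that by (auto simp: B_def)
        qed
        then show ?thesis by auto
      qed
      ultimately show False using emeasure_space_1 by (simp add: null_sets_def)
    qed
    then obtain k where k: "emeasure ?W (B k) \<noteq> 0" by blast
    define M where "M = real k * 2 powr \<sigma>"
    show "hausdorff_outer s E \<noteq> 0"
    proof (rule mass_distribution[where N = ?W and f = "coding_map t a" and B = "B k" and M = M])
      show "finite_measure ?W" by unfold_locales
      show "coding_map t a I \<in> E" if "I \<in> B k" for I using that Z(1) by (auto simp: B_def)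
      show "{J \<in> space ?W. dist (coding_map t a I) (coding_map t a J) \<le> r} \<in> sets ?W" for I r
        by (simp add: sets_stream_pmf sets_dist_coding)
      fix I and r :: real assume I: "I \<in> B k" and r: "0 < r" "r \<le> 1"
      have en_le: "energy W 2 \<sigma> a I \<le> of_nat k" using I by (simp add: B_def)
      then have fin: "energy W 2 \<sigma> a I \<noteq> \<infinity>" by (auto simp: top_unique)
      have "enn2real (energy W 2 \<sigma> a I) \<le> real k"
        using enn2real_mono[OF en_le] of_nat_less_top[of k] by simp
      then have "enn2real (energy W 2 \<sigma> a I) * 2 powr \<sigma> * r powr \<sigma> \<le> M * r powr \<sigma>"
        unfolding M_def by (intro mult_right_mono) auto
      then have "measure ?W (near a r I) \<le> M * r powr \<sigma>"
        using measure_near_upper[OF fin \<sigma>(1) r] by (rule order_trans[rotated])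
      also have "\<dots> \<le> M * r powr s"
        using r \<sigma> by (intro mult_left_mono powr_mono') (auto simp: M_def)
      finally show "emeasure ?W {J \<in> space ?W. dist (coding_map t a I) (coding_map t a J) \<le> r} \<le> ennreal (M * r powr s)"
        by (simp add: near_def emeasure_eq_measure ennreal_leI)
    qed (use s k B in \<open>auto simp: M_def\<close>)
  qed
qed

end

lemma pmf_less_1:
  fixes P :: "'m::finite pmf"
  assumes "CARD('m) \<ge> 2" "\<And>i. 0 < pmf P i"
  shows "pmf P i < 1"
proof -
  have "\<exists>j. j \<noteq> i"
  proof (rule ccontr)
    assume "\<not> ?thesis"
    then have "(UNIV :: 'm set) = {i}" by auto
    then have "CARD('m) = card {i}" by (rule arg_cong)
    also have "\<dots> = 1" by simp
    finally have "CARD('m) = 1" .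
    with assms(1) show False by simp
  qed
  then obtain j where j: "j \<noteq> i" by blast
  have "(\<Sum>k\<in>{i, j}. pmf P k) \<le> (\<Sum>k\<in>UNIV. pmf P k)" by (intro sum_mono2) auto
  then have "pmf P i + pmf P j \<le> 1" using j by (simp add: sum_pmf_eq_1)
  then show ?thesis using assms(2)[of j] by simp
qed

lemma pmf_of_weights:
  fixes w :: "'m::finite \<Rightarrow> real"
  assumes "\<And>i. 0 \<le> w i" "(\<Sum>i\<in>UNIV. w i) = 1"
  shows "\<exists>W. pmf W = w"
proof -
  have "(\<integral>\<^sup>+i. ennreal (w i) \<partial>count_space UNIV) = 1"
    using assms by (simp add: nn_integral_count_space_finite)
  then have "pmf (embed_pmf w) = w"
    using assms by (intro ext pmf_embed_pmf) auto
  then show ?thesis by blast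
qed

section \<open>Almost sure dimension of the level set from the weights\<close>

context diag_system
begin

text \<open>\<open>en_P\<close> and \<open>low\<close> place \<open>W\<close>-typical points in the
  level set, \<open>en_W\<close> bounds its dimension from below and \<open>en_q\<close> from
  above.\<close>

lemma dim_level_set:
  fixes P :: "'m pmf" and q D \<alpha> :: real
  defines "w \<equiv> \<lambda>i. pmf P i powr q * ratio i powr - D"
  assumes card: "CARD('m) \<ge> 2" and P: "\<And>i. 0 < pmf P i"
    and q: "2 \<le> q" and D: "0 < D" "D < 1" and root: "(\<Sum>i\<in>UNIV. w i) = 1"
    and \<alpha>: "\<alpha> * (\<Sum>i\<in>UNIV. w i * ln (ratio i)) = (\<Sum>i\<in>UNIV. w i * ln (pmf P i))"
    and H: "0 < \<alpha> * q - D" "\<alpha> * q - D < 1"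
  shows "AE a in lborel. local_dim_level_set (coded_measure P a) \<alpha> \<noteq> {} \<and>
    hausdorff_dim (local_dim_level_set (coded_measure P a) \<alpha>) = ereal (\<alpha> * q - D)"
proof -
  have P1: "pmf P i < 1" for i by (rule pmf_less_1[OF card P])
  have w_pos: "0 < w i" for i using P t_pos[of i j0] by (simp add: w_def less_imp_neq[THEN not_sym])
  obtain W where W: "pmf W = w" using pmf_of_weights[of w] w_pos root by (auto intro: less_imp_le)
  have W0: "0 < pmf W i" for i by (simp add: W w_pos)
  have W1: "pmf W i < 1" for i by (rule pmf_less_1[OF card W0])
  have ratio1: "ratio i < 1" for i using first_le[of i] c_less_1 by simp
  define L where "L = (\<Sum>i\<in>UNIV. w i * ln (ratio i))"
  define A where "A = (\<Sum>i\<in>UNIV. w i * ln (pmf P i))"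
  have \<alpha>L: "\<alpha> * L = A" using \<alpha> by (simp add: L_def A_def)
  have "L < (\<Sum>i\<in>(UNIV :: 'm set). 0)"
    unfolding L_def using w_pos ratio1 t_pos by (intro sum_strict_mono) (auto simp: mult_pos_neg)
  then have L: "L < 0" by simp
  define H' where "H' = \<alpha> * q - D"
  have \<alpha>0: "0 < \<alpha>"
    using H(1) D(1) q by (meson add_pos_pos diff_gt_0_iff_gt le_less_trans less_trans not_le mult_nonpos_nonneg zero_le_numeral order_trans)
  have \<alpha>1: "\<alpha> < 1"
  proof (rule ccontr)
    assume "\<not> \<alpha> < 1"
    then have "1 * 2 \<le> \<alpha> * q" using q by (intro mult_mono) auto
    then show False using H(2) D(2) by simp
  qed
  have ln_w: "ln (w i) = q * ln (pmf P i) - D * ln (ratio i)" for i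
    using P[of i] t_pos[of i j0] by (simp add: w_def ln_mult ln_powr)
  have sum_w: "(\<Sum>i\<in>UNIV. pmf W i * ln (w i * ratio i powr - s)) = (H' - s) * L" for s
  proof -
    have "pmf W i * ln (w i * ratio i powr - s) = q * (w i * ln (pmf P i)) - (D + s) * (w i * ln (ratio i))" for i
      using w_pos[of i] t_pos[of i j0] by (simp add: ln_mult ln_powr ln_w W algebra_simps)
    then have "(\<Sum>i\<in>UNIV. pmf W i * ln (w i * ratio i powr - s)) = q * A - (D + s) * L"
      by (simp add: sum_subtractf sum_distrib_left[symmetric] A_def L_def)
    also have "\<dots> = (H' - s) * L" by (simp add: \<alpha>L[symmetric] H'_def algebra_simps)
    finally show ?thesis .
  qed
  have sum_p: "(\<Sum>i\<in>UNIV. pmf W i * ln (pmf P i * ratio i powr - s)) = (\<alpha> - s) * L" for s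
  proof -
    have "pmf W i * ln (pmf P i * ratio i powr - s) = w i * ln (pmf P i) - s * (w i * ln (ratio i))" for i
      using P[of i] t_pos[of i j0] by (simp add: ln_mult ln_powr W algebra_simps)
    then have "(\<Sum>i\<in>UNIV. pmf W i * ln (pmf P i * ratio i powr - s)) = A - s * L"
      by (simp add: sum_subtractf sum_distrib_left[symmetric] A_def L_def)
    also have "\<dots> = (\<alpha> - s) * L" by (simp add: \<alpha>L[symmetric] algebra_simps)
    finally show ?thesis .
  qed
  \<comment> \<open>Room for two strict inequalities: the dyadic sum needs an exponent above the one
    in the energy, the sum over prefixes one below the critical \<open>x\<close>.\<close>
  have between: "\<exists>s. 0 \<le> s \<and> s \<le> 1 \<and> max 0 (x - 1 / real (Suc n)) < s \<and> s < x" if "0 < x" "x < 1" for x :: real and n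
  proof -
    define y where "y = max 0 (x - 1 / real (Suc n))"
    have "0 \<le> y" "y < x" using that by (auto simp: y_def)
    then show ?thesis using that unfolding y_def[symmetric] by (intro exI[of _ "(y + x) / 2"]) auto
  qed
  have en_P: "AE a in lborel. AE I in stream_space (measure_pmf W).
      energy P 2 (max 0 (\<alpha> - 1 / real (Suc n))) a I \<noteq> \<infinity>" for n
  proof -
    obtain s where s: "0 \<le> s" "s \<le> 1" "max 0 (\<alpha> - 1 / real (Suc n)) < s" "s < \<alpha>"
      using between[OF \<alpha>0 \<alpha>1] by blast
    show ?thesis
      by (rule AE_AE_energy_finite[OF P P1 s(1-3)]) (use s L in \<open>simp add: sum_p mult_pos_neg\<close>)
  qed
  have en_W: "AE a in lborel. AE I in stream_space (measure_pmf W).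
      energy W 2 (max 0 (H' - 1 / real (Suc n))) a I \<noteq> \<infinity>" for n
  proof -
    obtain s where s: "0 \<le> s" "s \<le> 1" "max 0 (H' - 1 / real (Suc n)) < s" "s < H'"
      using between[of H'] H unfolding H'_def by blast
    show ?thesis
      by (rule AE_AE_energy_finite[OF W0 W1 s(1-3)])
         (use s L sum_w[of s] in \<open>simp add: W mult_pos_neg\<close>)
  qed
  \<comment> \<open>The weights sum to 1 at exponent \<open>D\<close> and increase strictly with the
    exponent, so the sum is below 1 at \<open>s\<close>.\<close>
  have en_q: "AE a in lborel. (\<integral>\<^sup>+I. energy P q (max 0 (D - 1 / real (Suc n))) a I \<partial>stream_space (measure_pmf P)) \<noteq> \<infinity>" for n
  proof -
    obtain s where s: "0 \<le> s" "s \<le> 1" "max 0 (D - 1 / real (Suc n)) < s" "s < D"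
      using between[OF D] by blast
    have "(\<Sum>i\<in>UNIV. pmf P i powr q * ratio i powr - s) < (\<Sum>i\<in>UNIV. w i)"
    proof (rule sum_strict_mono)
      fix i
      have "ratio i powr - s < ratio i powr - D"
        using t_pos[of i j0] ratio1[of i] s by (intro powr_less_mono') auto
      then show "pmf P i powr q * ratio i powr - s < w i"
        unfolding w_def using P[of i] by (intro mult_strict_left_mono) auto
    qed auto
    then show ?thesis
      by (intro AE_integral_energy_finite[OF P P1 q s(1-3)]) (simp add: root)
  qed
  \<comment> \<open>The added \<open>1 / real (Suc n)\<close> tilts the mean of the logarithms from
    0 to \<open>L / real (Suc n)\<close>, which is negative.\<close>
  have low: "AE I in stream_space (measure_pmf W). summable (\<lambda>k. stream_prod (\<lambda>i. ratio i powr (\<alpha> + 1 / real (Suc n)) / pmf P i) k I)" for n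
  proof (rule AE_summable_stream_prod)
    show "0 < ratio i powr (\<alpha> + 1 / real (Suc n)) / pmf P i" for i
      using P[of i] t_pos[of i j0] by simp
    have "pmf W i * ln (ratio i powr (\<alpha> + 1 / real (Suc n)) / pmf P i) =
        (\<alpha> + 1 / real (Suc n)) * (w i * ln (ratio i)) - w i * ln (pmf P i)" for i
      using P[of i] t_pos[of i j0] by (simp add: ln_div ln_powr W algebra_simps)
    then have "(\<Sum>i\<in>UNIV. pmf W i * ln (ratio i powr (\<alpha> + 1 / real (Suc n)) / pmf P i)) =
        (\<alpha> + 1 / real (Suc n)) * L - A"
      by (simp only: sum_subtractf sum_distrib_left[symmetric] A_def L_def)
    also have "\<dots> = 1 / real (Suc n) * L" by (simp add: \<alpha>L[symmetric] distrib_right)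
    also have "\<dots> < 0" using L by (intro mult_pos_neg) auto
    finally show "(\<Sum>i\<in>UNIV. pmf W i * ln (ratio i powr (\<alpha> + 1 / real (Suc n)) / pmf P i)) < 0" .
  qed
  \<comment> \<open>The exceptional translations depend on \<open>n\<close>; their countable union
    is a single null set.\<close>
  have "AE a in lborel. (\<forall>n::nat. AE I in stream_space (measure_pmf W). energy P 2 (max 0 (\<alpha> - 1 / real (Suc n))) a I \<noteq> \<infinity>)"
    unfolding AE_all_countable by (intro allI en_P)
  moreover have "AE a in lborel. (\<forall>n::nat. AE I in stream_space (measure_pmf W). energy W 2 (max 0 (H' - 1 / real (Suc n))) a I \<noteq> \<infinity>)"
    unfolding AE_all_countable by (intro allI en_W)
  moreover have "AE a in lborel. (\<forall>n::nat. (\<integral>\<^sup>+I. energy P q (max 0 (D - 1 / real (Suc n))) a I \<partial>stream_space (measure_pmf P)) \<noteq> \<infinity>)"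
    unfolding AE_all_countable by (intro allI en_q)
  ultimately show ?thesis
  proof eventually_elim
    case (elim a)
    let ?E = "local_dim_level_set (coded_measure P a) \<alpha>"
    have "AE I in stream_space (measure_pmf W). \<forall>n::nat. energy P 2 (max 0 (\<alpha> - 1 / real (Suc n))) a I \<noteq> \<infinity>"
      unfolding AE_all_countable using elim(1) .
    moreover have "AE I in stream_space (measure_pmf W). \<forall>n::nat. summable (\<lambda>k. stream_prod (\<lambda>i. ratio i powr (\<alpha> + 1 / real (Suc n)) / pmf P i) k I)"
      unfolding AE_all_countable using low by blast
    ultimately have E: "AE I in stream_space (measure_pmf W). coding_map t a I \<in> ?E"
    proof eventually_elim
      case (elim I)
      show ?case
      proof (rule coded_point_in_level_set)
        fix n :: nat
        show "\<exists>e>0. \<forall>r. 0 < r \<longrightarrow> r \<le> 1 \<longrightarrow>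
            e * r powr (\<alpha> + 1 / real (Suc n)) \<le> measure (stream_space (measure_pmf P)) (near a r I)"
          using elim(2) \<alpha>0 by (intro measure_near_lower P) auto
        let ?s = "max 0 (\<alpha> - 1 / real (Suc n))"
        show "\<exists>C\<ge>0. \<forall>r. 0 < r \<longrightarrow> r \<le> 1 \<longrightarrow>
            measure (stream_space (measure_pmf P)) (near a r I) \<le> C * r powr ?s"
        proof (intro exI[of _ "enn2real (energy P 2 ?s a I) * 2 powr ?s"] conjI allI impI)
          show "measure (stream_space (measure_pmf P)) (near a r I) \<le>
              enn2real (energy P 2 ?s a I) * 2 powr ?s * r powr ?s" if "0 < r" "r \<le> 1" for r
            by (rule measure_near_upper) (use elim(1) that in auto)
        qed simp
      qed
    qed
    have "?E \<noteq> {}" "ereal H' \<le> hausdorff_dim ?E"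
      using hausdorff_dim_ge_energy[OF E, of H'] elim(2) by auto
    moreover have "hausdorff_dim ?E \<le> ereal H'"
      unfolding H'_def using elim(3) \<alpha>0 q H by (intro hausdorff_dim_level_set_le) auto
    ultimately show ?case by (simp add: H'_def)
  qed
qed

end

section \<open>Singular values and the function \<open>D\<close>\<close>

lemma diag_matrix_mult: "diag_matrix u ** diag_matrix v = diag_matrix (\<lambda>j. u j * v j)"
proof -
  have "(\<Sum>k\<in>UNIV. (if i = k then u i else 0) * (if k = j then v k else 0)) = (if i = j then u i * v i else 0)" for i j
  proof -
    have "(\<Sum>k\<in>UNIV. (if i = k then u i else 0) * (if k = j then v k else 0)) =
      (\<Sum>k\<in>UNIV. if k = i then (if i = j then u i * v i else 0) else 0)"
      by (rule sum.cong) auto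
    then show ?thesis by simp
  qed
  then show ?thesis by (simp add: diag_matrix_def matrix_matrix_mult_def vec_eq_iff)
qed

lemma matrix_word_diag:
  "matrix_word (\<lambda>i. diag_matrix (t i)) I = diag_matrix (\<lambda>j. prod_list (map (\<lambda>i. t i j) I))"
proof (induction I)
  case Nil
  show ?case by (simp add: matrix_word_def diag_matrix_def mat_def)
next
  case (Cons i I)
  then show ?case by (simp add: matrix_word_def diag_matrix_mult)
qed

context
  fixes u :: "'n::finite \<Rightarrow> real" and j0 :: 'n
  assumes u_inj: "inj u" and u_pos: "\<And>j. 0 < u j" and u_le: "\<And>j. u j \<le> u j0"
begin

lemma sv_eigenspace_diag:
  assumes "0 \<le> s"
  shows "sv_eigenspace (diag_matrix u) s = {x. \<forall>j. u j \<noteq> s \<longrightarrow> x $ j = 0}"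
proof -
  have tr: "transpose (diag_matrix u) = diag_matrix u"
    by (simp add: diag_matrix_def transpose_def vec_eq_iff)
  have mult: "(diag_matrix (\<lambda>j. u j * u j) *v x) $ j = u j * u j * x $ j" for x j
    by (simp add: diag_matrix_def matrix_vector_mult_def if_distrib[of "\<lambda>y. y * _"] cong: if_cong)
  have sq: "u j * u j = s\<^sup>2 \<longleftrightarrow> u j = s" for j
    using u_pos[of j] assms by (metis power2_eq_square power2_eq_imp_eq less_imp_le)
  show ?thesis
    by (auto simp: sv_eigenspace_def tr diag_matrix_mult vec_eq_iff mult sq)
qed

text \<open>Distinct positive entries give simple eigenvalues, so each is listed once. The strict
  inequalities between the diagonal entries enter through \<open>inj u\<close>.\<close>

lemma singular_values_diag:
  "singular_values (diag_matrix u) = rev (sorted_list_of_set (range u))"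
proof -
  have eig: "sv_eigenspace (diag_matrix u) (u j) = span {axis j 1}" for j
  proof -
    have "sv_eigenspace (diag_matrix u) (u j) = {x. \<forall>k. k \<noteq> j \<longrightarrow> x $ k = 0}"
      using u_inj u_pos by (subst sv_eigenspace_diag) (auto simp: less_imp_le inj_eq)
    also have "\<dots> = range (\<lambda>c. c *\<^sub>R axis j (1::real))"
    proof (intro equalityI subsetI)
      fix x :: "real^'n" assume "x \<in> {x. \<forall>k. k \<noteq> j \<longrightarrow> x $ k = 0}"
      then have "x = (x $ j) *\<^sub>R axis j 1" by (auto simp: vec_eq_iff axis_def)
      then show "x \<in> range (\<lambda>c. c *\<^sub>R axis j 1)" by blast
    qed (auto simp: axis_def)
    finally show ?thesis by (simp add: span_singleton)
  qed
  have dim: "dim (sv_eigenspace (diag_matrix u) (u j)) = 1" for j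
    by (simp add: eig axis_eq_0_iff)
  have set: "{s. 0 \<le> s \<and> (\<exists>x\<in>sv_eigenspace (diag_matrix u) s. x \<noteq> 0)} = range u"
  proof (intro equalityI subsetI)
    fix s assume "s \<in> {s. 0 \<le> s \<and> (\<exists>x\<in>sv_eigenspace (diag_matrix u) s. x \<noteq> 0)}"
    then obtain x i where "0 \<le> s" "x \<in> sv_eigenspace (diag_matrix u) s" "x $ i \<noteq> 0" by (auto simp: vec_eq_iff)
    then have "u i = s" by (auto simp: sv_eigenspace_diag)
    then show "s \<in> range u" by blast
  next
    fix s assume "s \<in> range u"
    then obtain j where "s = u j" by blast
    moreover have "axis j 1 \<in> sv_eigenspace (diag_matrix u) (u j)" unfolding eig by (simp add: span_base)
    ultimately show "s \<in> {s. 0 \<le> s \<and> (\<exists>x\<in>sv_eigenspace (diag_matrix u) s. x \<noteq> 0)}"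
      using u_pos[of j] by (auto simp: less_imp_le intro!: bexI[of _ "axis j 1"])
  qed
  have "map (\<lambda>s. replicate (dim (sv_eigenspace (diag_matrix u) s)) s) (rev (sorted_list_of_set (range u))) =
    map (\<lambda>s. [s]) (rev (sorted_list_of_set (range u)))"
    by (rule map_cong) (auto simp: dim)
  then show ?thesis
    unfolding singular_values_def set by (simp only: concat_map_singleton list.map_ident)
qed

lemma singular_values_diag_facts:
  defines "\<alpha> \<equiv> singular_values (diag_matrix u)"
  shows "length \<alpha> = CARD('n)" "\<And>x. x \<in> set \<alpha> \<Longrightarrow> 0 < x \<and> x \<le> u j0" "\<alpha> ! 0 = u j0"
proof -
  have set: "set \<alpha> = range u" by (simp add: \<alpha>_def singular_values_diag)
  show len: "length \<alpha> = CARD('n)" using u_inj by (simp add: \<alpha>_def singular_values_diag card_image)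
  show bds: "0 < x \<and> x \<le> u j0" if "x \<in> set \<alpha>" for x using that u_pos u_le by (auto simp: set)
  obtain i where i: "i < length \<alpha>" "\<alpha> ! i = u j0"
    using set by (metis in_set_conv_nth rangeI)
  have "\<alpha> ! i \<le> \<alpha> ! 0"
    by (rule sorted_rev_nth_mono) (use i in \<open>simp_all add: \<alpha>_def singular_values_diag\<close>)
  moreover have "\<alpha> ! 0 \<in> set \<alpha>" using i by (intro nth_mem) auto
  ultimately show "\<alpha> ! 0 = u j0" using i bds by fastforce
qed

text \<open>Every factor is at most the largest singular value and the exponents add up to
  \<open>s\<close>; for \<open>s \<le> 1\<close> the largest singular value is the only one that
  occurs.\<close>

lemma sv_function_diag:
  assumes "0 \<le> s"
  shows "0 < sv_function s (diag_matrix u)" "sv_function s (diag_matrix u) \<le> u j0 powr s"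
    and "s \<le> 1 \<Longrightarrow> sv_function s (diag_matrix u) = u j0 powr s"
proof -
  define \<alpha> where "\<alpha> = singular_values (diag_matrix u)"
  define b where "b = u j0"
  have len: "length \<alpha> = CARD('n)" and bds: "\<And>x. x \<in> set \<alpha> \<Longrightarrow> 0 < x \<and> x \<le> b" and \<alpha>0: "\<alpha> ! 0 = b"
    using singular_values_diag_facts by (auto simp: \<alpha>_def b_def)
  have b: "0 < b" by (simp add: b_def u_pos)
  have pl: "0 < prod_list xs \<and> prod_list xs \<le> b ^ length xs" if "\<And>x. x \<in> set xs \<Longrightarrow> 0 < x \<and> x \<le> b" for xs
    using that
  proof (induction xs)
    case (Cons x xs)
    then have "0 < x" "x \<le> b" "0 < prod_list xs" "prod_list xs \<le> b ^ length xs" by auto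
    then show ?case using b by (auto intro: mult_mono)
  qed simp
  have card: "0 < CARD('n)" by simp
  consider "s = 0" | "0 < s" "real CARD('n) \<le> s" | "0 < s" "s < real CARD('n)" using assms by linarith
  then have "0 < sv_function s (diag_matrix u) \<and> sv_function s (diag_matrix u) \<le> b powr s \<and>
    (s \<le> 1 \<longrightarrow> sv_function s (diag_matrix u) = b powr s)"
  proof cases
    case 1
    then show ?thesis using b by (simp add: sv_function_def)
  next
    case 2
    have eq: "sv_function s (diag_matrix u) = prod_list \<alpha> powr (s / real CARD('n))"
      using 2 by (simp add: sv_function_def \<alpha>_def)
    have P: "0 < prod_list \<alpha>" "prod_list \<alpha> \<le> b ^ CARD('n)" using pl[of \<alpha>] bds len by auto
    have "prod_list \<alpha> powr (s / real CARD('n)) \<le> (b ^ CARD('n)) powr (s / real CARD('n))"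
      using P 2 by (intro powr_mono2) auto
    also have "\<dots> = b powr s"
      using b card by (simp add: powr_powr flip: powr_realpow)
    finally have le: "sv_function s (diag_matrix u) \<le> b powr s" unfolding eq .
    \<comment> \<open>Both conditions on \<open>s\<close> together force dimension 1, where the
      product has a single factor.\<close>
    have "sv_function s (diag_matrix u) = b powr s" if "s \<le> 1"
    proof -
      have "real CARD('n) \<le> 1" using 2 that by linarith
      then have c1: "CARD('n) = 1" using card by linarith
      then have "length \<alpha> = 1" using len by simp
      then obtain x where "\<alpha> = [x]" by (auto simp: length_Suc_conv)
      then show ?thesis using \<alpha>0 c1 by (simp add: eq)
    qed
    then show ?thesis using P le by (simp add: eq)
  next
    case 3
    define k where "k = nat \<lceil>s\<rceil>"
    have k: "1 \<le> k" "k \<le> CARD('n)" "real k - 1 < s" "s \<le> real k"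
      using 3 unfolding k_def by linarith+
    have eq: "sv_function s (diag_matrix u) = (\<Prod>i<k - 1. \<alpha> ! i) * (\<alpha> ! (k - 1)) powr (s - real k + 1)"
      using 3 by (simp add: sv_function_def \<alpha>_def k_def Let_def)
    have nth: "0 < \<alpha> ! i \<and> \<alpha> ! i \<le> b" if "i < k" for i
      using bds[of "\<alpha> ! i"] that k len by simp
    have "0 < (\<Prod>i<k - 1. \<alpha> ! i)" using nth by (intro prod_pos) auto
    moreover have "(\<Prod>i<k - 1. \<alpha> ! i) \<le> (\<Prod>i<k - 1. b)"
      using nth by (intro prod_mono) (auto simp: less_imp_le)
    moreover have "0 < (\<alpha> ! (k - 1)) powr (s - real k + 1)" using nth[of "k - 1"] k by simp
    moreover have "(\<alpha> ! (k - 1)) powr (s - real k + 1) \<le> b powr (s - real k + 1)"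
      using nth[of "k - 1"] k by (intro powr_mono2) auto
    ultimately have "0 < sv_function s (diag_matrix u)"
        "sv_function s (diag_matrix u) \<le> b ^ (k - 1) * b powr (s - real k + 1)"
      unfolding eq using b by (auto intro!: mult_mono)
    moreover have "b ^ (k - 1) * b powr (s - real k + 1) = b powr s"
      using b k by (simp add: of_nat_diff flip: powr_realpow powr_add)
    moreover have "sv_function s (diag_matrix u) = b powr s" if "s \<le> 1"
    proof -
      have "k = 1" using k 3 that by linarith
      then show ?thesis by (simp add: eq \<alpha>0)
    qed
    ultimately show ?thesis by simp
  qed
  then show "0 < sv_function s (diag_matrix u)" "sv_function s (diag_matrix u) \<le> u j0 powr s"
    and "s \<le> 1 \<Longrightarrow> sv_function s (diag_matrix u) = u j0 powr s"
    by (auto simp: b_def)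
qed

end

section \<open>Sums over words and the pressure function\<close>

lemma sum_lists_length:
  fixes f :: "'m::finite \<Rightarrow> real"
  shows "(\<Sum>I\<in>{I. length I = k}. prod_list (map f I)) = (\<Sum>i\<in>UNIV. f i) ^ k"
proof (induction k)
  case (Suc k)
  have eq: "{I :: 'm list. length I = Suc k} = (\<lambda>(I, i). i # I) ` ({I. length I = k} \<times> UNIV)"
    using lists_length_Suc_eq[of "UNIV :: 'm set" k] by simp
  have "(\<Sum>I\<in>{I. length I = Suc k}. prod_list (map f I)) =
    (\<Sum>(I, i)\<in>{I. length I = k} \<times> UNIV. f i * prod_list (map f I))"
    unfolding eq by (subst sum.reindex) (auto simp: inj_on_def case_prod_beta)
  also have "\<dots> = (\<Sum>i\<in>UNIV. f i) ^ Suc k"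
    by (simp add: sum.cartesian_product[symmetric] Suc flip: sum_distrib_right sum_distrib_left)
  finally show ?case .
qed simp

lemma prod_list_powr:
  fixes f :: "'m \<Rightarrow> real"
  assumes "\<And>i. 0 < f i"
  shows "prod_list (map f I) powr s = prod_list (map (\<lambda>i. f i powr s) I)"
  by (induction I) (simp_all add: powr_mult)

lemma prod_list_pos: "(\<And>i. 0 < f i) \<Longrightarrow> 0 < prod_list (map f I)" for f :: "'m \<Rightarrow> real"
  by (induction I) simp_all

lemma prod_list_mult:
  fixes f g :: "'m \<Rightarrow> real"
  shows "prod_list (map f I) * prod_list (map g I) = prod_list (map (\<lambda>i. f i * g i) I)"
  by (induction I) (simp_all add: mult_ac)

text \<open>The sum of \<open>p i powr x * u i powr - y\<close> for positive arguments, in a form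
  with continuity and derivatives at hand. With the largest entries as \<open>u\<close>, D is the
  implicit function at level 1 wherever D(x) < x - 1.\<close>

definition pressure :: "('m::finite \<Rightarrow> real) \<Rightarrow> ('m \<Rightarrow> real) \<Rightarrow> real \<Rightarrow> real \<Rightarrow> real" where
  "pressure p u x y = (\<Sum>i\<in>UNIV. exp (x * ln (p i) - y * ln (u i)))"

context
  fixes p u :: "'m::finite \<Rightarrow> real"
  assumes p: "\<And>i. 0 < p i" "\<And>i. p i < 1" and sum_p: "(\<Sum>i\<in>UNIV. p i) = 1"
    and u: "\<And>i. 0 < u i" "\<And>i. u i < 1"
begin

lemma pressure_powr: "pressure p u x y = (\<Sum>i\<in>UNIV. p i powr x * u i powr - y)"
  unfolding pressure_def
  using p u by (intro sum.cong) (auto simp: powr_def less_imp_neq[THEN not_sym] exp_diff exp_minus field_simps)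

lemma pressure_strict_mono:
  assumes "y < y'"
  shows "pressure p u x y < pressure p u x y'"
  unfolding pressure_def
proof (rule sum_strict_mono)
  fix i
  have "y' * ln (u i) < y * ln (u i)" using assms u[of i] by (intro mult_strict_right_mono_neg) auto
  then show "exp (x * ln (p i) - y * ln (u i)) < exp (x * ln (p i) - y' * ln (u i))" by simp
qed auto

lemma pressure_less_iff: "pressure p u x y < pressure p u x y' \<longleftrightarrow> y < y'"
  by (metis pressure_strict_mono less_asym linorder_neqE_linordered_idom)

lemma pressure_root:
  assumes x: "1 < x"
  obtains y where "0 < y" "pressure p u x y = 1"
proof -
  have "pressure p u x 0 < (\<Sum>i\<in>UNIV. p i)"
    unfolding pressure_powr
  proof (rule sum_strict_mono)
    fix i
    have "p i powr x < p i powr 1" using p x by (intro powr_less_mono') auto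
    then show "p i powr x * u i powr - 0 < p i" using p[of i] u[of i] by simp
  qed auto
  then have G0: "pressure p u x 0 < 1" by (simp add: sum_p)
  obtain i :: 'm where True by blast
  \<comment> \<open>Solves \<open>p i powr x * u i powr - y1 = 1\<close> for one letter, so the
    whole sum is at least 1 there and the intermediate value theorem applies.\<close>
  define y1 where "y1 = x * ln (p i) / ln (u i)"
  have ln_u: "ln (u i) < 0" using u[of i] by simp
  have ln_p: "ln (p i) < 0" using p[of i] by simp
  have y1: "0 \<le> y1" unfolding y1_def using ln_u ln_p x by (intro divide_nonpos_nonpos mult_nonneg_nonpos) auto
  have "exp (x * ln (p i) - y1 * ln (u i)) = 1" using ln_u by (simp add: y1_def)
  moreover have "exp (x * ln (p i) - y1 * ln (u i)) \<le> pressure p u x y1"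
    unfolding pressure_def by (rule member_le_sum) auto
  ultimately have G1: "1 \<le> pressure p u x y1" by simp
  have "continuous_on {0..y1} (pressure p u x)"
    unfolding pressure_def by (intro continuous_intros)
  then obtain y where y: "0 \<le> y" "pressure p u x y = 1"
    using IVT'[of "pressure p u x" 0 1 y1] G0 G1 y1 by auto
  with G0 have "0 < y" by (cases "y = 0") auto
  with y show thesis by (intro that)
qed

end

section \<open>D as a root of the pressure, and its derivative\<close>

context
  fixes p :: "'m::finite \<Rightarrow> real" and t :: "'m \<Rightarrow> 'd::finite \<Rightarrow> real" and j0 :: 'd
  assumes p: "\<And>i. 0 < p i" "\<And>i. p i < 1" and sum_p: "(\<Sum>i\<in>UNIV. p i) = 1"
    and t: "\<And>i j. 0 < t i j" "\<And>i. t i j0 < 1"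
    and t_le: "\<And>i j. j \<noteq> j0 \<Longrightarrow> t i j < t i j0"
    and t_inj: "\<And>I. inj (\<lambda>j. prod_list (map (\<lambda>i. t i j) I)) \<or> I = []"
begin

abbreviation "D_diag \<equiv> D_fun (\<lambda>i. diag_matrix (t i)) p"
abbreviation "first_pressure \<equiv> pressure p (\<lambda>i. t i j0)"

lemma word_le: "prod_list (map (\<lambda>i. t i j) I) \<le> prod_list (map (\<lambda>i. t i j0) I)"
proof (induction I)
  case (Cons i I)
  have "t i j \<le> t i j0" using t_le[of j i] by (cases "j = j0") auto
  then show ?case using Cons t(1) prod_list_pos[of "\<lambda>i. t i j" I] by (auto intro!: mult_mono simp: less_imp_le)
qed simp

text \<open>The exponent \<open>1 - q\<close> is negative, which turns the upper bound for the
  singular value function into a lower bound for the series. The words are nonempty, so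
  \<open>t_inj\<close> makes their diagonal entries distinct.\<close>

lemma word_sum_bounds:
  fixes s q :: real
  defines "g \<equiv> \<lambda>k. \<Sum>I\<in>{I :: 'm list. length I = Suc k}.
     sv_function s (matrix_word (\<lambda>i. diag_matrix (t i)) I) powr (1 - q) * prob_word p I powr q"
  assumes s: "0 \<le> s" and q: "1 < q"
  shows "first_pressure q (s * (q - 1)) ^ Suc k \<le> g k" and "s \<le> 1 \<Longrightarrow> g k = first_pressure q (s * (q - 1)) ^ Suc k"
proof -
  have eq: "first_pressure q (s * (q - 1)) ^ Suc k = (\<Sum>I\<in>{I. length I = Suc k}.
      (prod_list (map (\<lambda>i. t i j0) I) powr s) powr (1 - q) * prob_word p I powr q)"
  proof -
    have "(prod_list (map (\<lambda>i. t i j0) I) powr s) powr (1 - q) * prob_word p I powr q =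
        prod_list (map (\<lambda>i. p i powr q * t i j0 powr - (s * (q - 1))) I)" for I
    proof -
      have e: "s * (1 - q) = - (s * (q - 1))" by (simp add: algebra_simps)
      show ?thesis
        unfolding powr_powr e prob_word_def using p(1) t(1)
        by (simp add: prod_list_powr prod_list_mult mult.commute)
    qed
    then show ?thesis
      using pressure_powr[of p "\<lambda>i. t i j0" q "s * (q - 1)"] p sum_p t by (simp add: sum_lists_length)
  qed
  have sv: "0 < sv_function s (matrix_word (\<lambda>i. diag_matrix (t i)) I)"
      "sv_function s (matrix_word (\<lambda>i. diag_matrix (t i)) I) \<le> prod_list (map (\<lambda>i. t i j0) I) powr s"
      "s \<le> 1 \<Longrightarrow> sv_function s (matrix_word (\<lambda>i. diag_matrix (t i)) I) = prod_list (map (\<lambda>i. t i j0) I) powr s"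
    if "length I = Suc k" for I
  proof -
    have inj: "inj (\<lambda>j. prod_list (map (\<lambda>i. t i j) I))" using t_inj[of I] that by auto
    note sv = sv_function_diag[OF inj prod_list_pos[OF t(1)] word_le s]
    show "0 < sv_function s (matrix_word (\<lambda>i. diag_matrix (t i)) I)"
      "sv_function s (matrix_word (\<lambda>i. diag_matrix (t i)) I) \<le> prod_list (map (\<lambda>i. t i j0) I) powr s"
      unfolding matrix_word_diag by (rule sv)+
    show "s \<le> 1 \<Longrightarrow> sv_function s (matrix_word (\<lambda>i. diag_matrix (t i)) I) = prod_list (map (\<lambda>i. t i j0) I) powr s"
      unfolding matrix_word_diag by (rule sv)
  qed
  show "first_pressure q (s * (q - 1)) ^ Suc k \<le> g k"
    unfolding eq g_def using sv q by (intro sum_mono mult_right_mono powr_mono2') auto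
  show "s \<le> 1 \<Longrightarrow> g k = first_pressure q (s * (q - 1)) ^ Suc k"
    unfolding eq g_def using sv by (intro sum.cong) auto
qed

lemma first_pressure_nonneg: "0 \<le> first_pressure x y"
  unfolding pressure_def by (intro sum_nonneg) auto

text \<open>Comparison with a geometric series: the series diverges from \<open>y / (x - 1)\<close>
  on, whereas convergence below is obtained for \<open>s \<le> 1\<close>. So a root below
  \<open>x - 1\<close> determines \<open>D_diag x\<close>, and a root of at least
  \<open>x - 1\<close> would put all of \<open>{0..<1}\<close> into \<open>S\<close>.\<close>

lemma D_eq:
  assumes x: "1 < x" and y: "0 < y" "first_pressure x y = 1"
  shows "y < x - 1 \<Longrightarrow> D_diag x = y" and "D_diag x < x - 1 \<Longrightarrow> y < x - 1"
proof -
  define S where "S = {s. 0 \<le> s \<and> summable (\<lambda>k. \<Sum>I\<in>{I :: 'm list. length I = Suc k}.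
       sv_function s (matrix_word (\<lambda>i. diag_matrix (t i)) I) powr (1 - x) * prob_word p I powr x)}"
  have D: "D_diag x = (x - 1) * Sup S" by (simp add: D_fun_def S_def)
  have less_iff: "first_pressure x (s * (x - 1)) < 1 \<longleftrightarrow> s < y / (x - 1)" for s
  proof -
    have "first_pressure x (s * (x - 1)) < 1 \<longleftrightarrow> s * (x - 1) < y"
      using pressure_less_iff[of p "\<lambda>i. t i j0" x "s * (x - 1)" y] p sum_p t y by simp
    then show ?thesis using x by (simp add: pos_less_divide_eq)
  qed
  have S1: "s < y / (x - 1)" if "s \<in> S" for s
  proof -
    have s: "0 \<le> s" using that by (simp add: S_def)
    have "summable (\<lambda>k. first_pressure x (s * (x - 1)) ^ Suc k)"
    proof (rule summable_comparison_test')
      show "summable (\<lambda>k. \<Sum>I\<in>{I :: 'm list. length I = Suc k}.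
       sv_function s (matrix_word (\<lambda>i. diag_matrix (t i)) I) powr (1 - x) * prob_word p I powr x)"
        using that by (simp add: S_def)
      show "norm (first_pressure x (s * (x - 1)) ^ Suc k) \<le> (\<Sum>I\<in>{I :: 'm list. length I = Suc k}.
       sv_function s (matrix_word (\<lambda>i. diag_matrix (t i)) I) powr (1 - x) * prob_word p I powr x)" for k
        using word_sum_bounds(1)[OF s x, of k] first_pressure_nonneg by (simp add: norm_power del: power_Suc)
    qed
    then have "first_pressure x (s * (x - 1)) < 1"
      using first_pressure_nonneg[of x "s * (x - 1)"] by (simp only: summable_Suc_iff summable_geometric_iff) simp
    then show ?thesis by (simp add: less_iff)
  qed
  have S2: "s \<in> S" if "0 \<le> s" "s < y / (x - 1)" "s \<le> 1" for s
  proof -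
    have "first_pressure x (s * (x - 1)) < 1" using that less_iff by simp
    then have "summable (\<lambda>k. first_pressure x (s * (x - 1)) ^ k)" using first_pressure_nonneg by simp
    then have "summable (\<lambda>k. first_pressure x (s * (x - 1)) ^ Suc k)" by (simp only: summable_Suc_iff)
    then show ?thesis using word_sum_bounds(2)[OF that(1) x that(3)] that(1) by (simp add: S_def)
  qed
  show "D_diag x = y" if "y < x - 1"
  proof -
    have "y / (x - 1) < 1" using x that by simp
    then have "S = {0..<y / (x - 1)}"
      using S1 S2 by (fastforce simp: S_def)
    then have "Sup S = y / (x - 1)" using x y by simp
    then show ?thesis using x by (simp add: D)
  qed
  show "y < x - 1" if "D_diag x < x - 1"
  proof (rule ccontr)
    assume "\<not> y < x - 1"
    then have ge: "1 \<le> y / (x - 1)" using x by simp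
    have "bdd_above S" using S1 by (intro bdd_aboveI[of _ "y / (x - 1)"]) (auto intro: less_imp_le)
    then have "Sup {0..<1} \<le> Sup S"
      using S2 ge by (intro cSup_subset_mono) auto
    then have "x - 1 \<le> D_diag x" using x by (simp add: D)
    with that show False by simp
  qed
qed

lemma D_root:
  assumes "1 < x" "D_diag x < x - 1"
  shows "first_pressure x (D_diag x) = 1"
proof -
  obtain y where "0 < y" "first_pressure x y = 1"
    using pressure_root[of p "\<lambda>i. t i j0" x] p sum_p t assms by blast
  then show ?thesis using D_eq[of x y] assms by simp
qed

text \<open>For \<open>b\<close> slightly larger (smaller) than \<open>\<alpha>\<close> the function \<open>x \<mapsto> first_pressure x (D_diag q + b * (x - q))\<close> is
  increasing (decreasing) at \<open>q\<close>, which squeezes \<open>D_diag\<close> between two lines.\<close>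

lemma D_has_derivative:
  fixes q \<alpha> :: real
  defines "w \<equiv> \<lambda>i. p i powr q * t i j0 powr - D_diag q"
  assumes q: "1 < q" and Dq: "0 < D_diag q" "D_diag q < q - 1"
    and \<alpha>: "\<alpha> * (\<Sum>i\<in>UNIV. w i * ln (t i j0)) = (\<Sum>i\<in>UNIV. w i * ln (p i))"
  shows "(D_diag has_real_derivative \<alpha>) (at q)"
proof -
  define L where "L = (\<Sum>i\<in>UNIV. w i * ln (t i j0))"
  have w: "w i = exp (q * ln (p i) - D_diag q * ln (t i j0))" for i
    unfolding w_def using p(1)[of i] t(1)[of i j0]
    by (simp add: powr_def less_imp_neq[THEN not_sym] exp_diff exp_minus divide_inverse)
  have "L < (\<Sum>i\<in>(UNIV :: 'm set). 0)"
    unfolding L_def using t by (intro sum_strict_mono) (auto simp: w mult_pos_neg)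
  then have L: "L < 0" by simp
  define h where "h b x = first_pressure x (D_diag q + b * (x - q))" for b x
  have hq: "h b q = 1" for b using D_root[OF q Dq(2)] by (simp add: h_def)
  have dh: "(h b has_real_derivative (\<alpha> - b) * L) (at q)" for b
  proof -
    have "(h b has_real_derivative (\<Sum>i\<in>UNIV. exp (q * ln (p i) - (D_diag q + b * (q - q)) * ln (t i j0)) * (ln (p i) - b * ln (t i j0)))) (at q)"
      unfolding h_def pressure_def
      by (auto intro!: derivative_eq_intros sum.cong)
    also have "(\<Sum>i\<in>UNIV. exp (q * ln (p i) - (D_diag q + b * (q - q)) * ln (t i j0)) * (ln (p i) - b * ln (t i j0))) =
      (\<Sum>i\<in>UNIV. w i * ln (p i) - b * (w i * ln (t i j0)))"
      by (rule sum.cong) (simp_all add: w algebra_simps)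
    also have "\<dots> = (\<alpha> - b) * L"
      by (simp add: sum_subtractf sum_distrib_left[symmetric] \<alpha>[symmetric] L_def left_diff_distrib)
    finally show ?thesis .
  qed
  have squeeze: "\<forall>\<^sub>F x in at q. \<bar>(D_diag x - D_diag q) / (x - q) - \<alpha>\<bar> < e" if e: "0 < e" for e
  proof -
    have up: "0 < (\<alpha> - (\<alpha> + e)) * L" and down: "(\<alpha> - (\<alpha> - e)) * L < 0"
      using e L by (auto simp: mult_neg_neg mult_pos_neg)
    obtain d1 where d1: "0 < d1" "\<And>k. 0 < k \<Longrightarrow> k < d1 \<Longrightarrow> h (\<alpha> + e) q < h (\<alpha> + e) (q + k)"
      using DERIV_pos_inc_right[OF dh up] by blast
    obtain d2 where d2: "0 < d2" "\<And>k. 0 < k \<Longrightarrow> k < d2 \<Longrightarrow> h (\<alpha> + e) (q - k) < h (\<alpha> + e) q"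
      using DERIV_pos_inc_left[OF dh up] by blast
    obtain d3 where d3: "0 < d3" "\<And>k. 0 < k \<Longrightarrow> k < d3 \<Longrightarrow> h (\<alpha> - e) (q + k) < h (\<alpha> - e) q"
      using DERIV_neg_dec_right[OF dh down] by blast
    obtain d4 where d4: "0 < d4" "\<And>k. 0 < k \<Longrightarrow> k < d4 \<Longrightarrow> h (\<alpha> - e) q < h (\<alpha> - e) (q - k)"
      using DERIV_neg_dec_left[OF dh down] by blast
    \<comment> \<open>\<open>D_eq\<close> yields \<open>D_diag x\<close> for roots below
      \<open>x - 1\<close>. Near \<open>q\<close> both lines stay below it, because
      \<open>D_diag q < q - 1\<close>, and so does the root squeezed between them.\<close>
    have lim: "((\<lambda>x. x - 1 - (D_diag q + b * (x - q))) \<longlongrightarrow> q - 1 - (D_diag q + b * (q - q))) (at q)" for b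
      by (intro tendsto_intros)
    have "\<forall>\<^sub>F x in at q. 0 < x - 1 - (D_diag q + b * (x - q))" for b
      using order_tendstoD(1)[OF lim, of 0 b] Dq by simp
    then have "\<forall>\<^sub>F x in at q. 0 < x - 1 - (D_diag q + (\<alpha> + e) * (x - q)) \<and> 0 < x - 1 - (D_diag q + (\<alpha> - e) * (x - q))"
      by (intro eventually_conj)
    moreover define d where "d = min (min d1 d2) (min (min d3 d4) (q - 1))"
    have "0 < d" using d1(1) d2(1) d3(1) d4(1) q by (simp add: d_def)
    then have "\<forall>\<^sub>F x in at q. x \<noteq> q \<and> dist x q < d"
      unfolding eventually_at by (intro exI[of _ d]) auto
    ultimately show ?thesis
    proof eventually_elim
      case (elim x)
      then have dx: "x \<noteq> q" "\<bar>x - q\<bar> < d1" "\<bar>x - q\<bar> < d2" "\<bar>x - q\<bar> < d3" "\<bar>x - q\<bar> < d4" "\<bar>x - q\<bar> < q - 1"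
        by (auto simp: dist_real_def d_def)
      then have x1: "1 < x" by linarith
      obtain y where y: "0 < y" "first_pressure x y = 1"
        using pressure_root[of p "\<lambda>i. t i j0" x] p sum_p t x1 by blast
      have less: "first_pressure x z < 1 \<longleftrightarrow> z < y" "1 < first_pressure x z \<longleftrightarrow> y < z" for z
        using pressure_less_iff[of p "\<lambda>i. t i j0" x z y] pressure_less_iff[of p "\<lambda>i. t i j0" x y z] p sum_p t y by simp_all
      show ?case
      proof (cases "q < x")
        case True
        have "1 < h (\<alpha> + e) x" "h (\<alpha> - e) x < 1"
          using d1(2)[of "x - q"] d3(2)[of "x - q"] True dx hq by auto
        then have yy: "y < D_diag q + (\<alpha> + e) * (x - q)" "D_diag q + (\<alpha> - e) * (x - q) < y"
          by (auto simp: h_def less)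
        then have "D_diag x = y" using elim by (intro D_eq(1)[OF x1 y]) auto
        then show ?thesis using yy True by (auto simp: abs_less_iff field_simps)
      next
        case False
        then have xq: "x < q" using dx by simp
        have "h (\<alpha> + e) x < 1" "1 < h (\<alpha> - e) x"
          using d2(2)[of "q - x"] d4(2)[of "q - x"] xq dx hq by auto
        then have yy: "D_diag q + (\<alpha> + e) * (x - q) < y" "y < D_diag q + (\<alpha> - e) * (x - q)"
          by (auto simp: h_def less)
        then have "D_diag x = y" using elim by (intro D_eq(1)[OF x1 y]) auto
        then show ?thesis using yy xq by (auto simp: abs_less_iff field_simps)
      qed
    qed
  qed
  have "((\<lambda>x. (D_diag x - D_diag q) / (x - q)) \<longlongrightarrow> \<alpha>) (at q)"
    by (rule tendstoI) (use squeeze in \<open>simp add: dist_real_def\<close>)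
  then show ?thesis by (simp add: has_field_derivative_iff)
qed

end

text \<open>\<open>\<alpha>\<close> is bound in the conclusion, so the condition on it stands there
  as a premise; derivatives being unique, it is D'(q).\<close>

theorem theorem6p3:
  fixes t :: "'m::finite \<Rightarrow> 'd::{finite,linorder} \<Rightarrow> real"
    and T :: "'m \<Rightarrow> real^('d::{finite,linorder})^('d::{finite,linorder})"
    and p :: "'m \<Rightarrow> real"
    and q :: real
  assumes "CARD('m) \<ge> 2"
    and "\<And>i. T i = diag_matrix (t i)"
    and "\<And>i j. t i j < 1 / 2"
    and "\<And>i j k. j < k \<Longrightarrow> t i k < t i j"
    and "\<And>i j. 0 < t i j"
    and "\<And>i. 0 < p i"
    and "(\<Sum>i\<in>UNIV. p i) = 1"
    and "q \<ge> 2"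
    and "D_fun T p q < q - 1"
    and "tau_fun T p q < 1"
    and "0 < D_fun T p q / (q - 1)"
    and "D_fun T p q / (q - 1) < 1"
  shows "\<exists>\<alpha>. (D_fun T p has_real_derivative \<alpha>) (at q) \<and>
    (0 < \<alpha> * q - D_fun T p q \<and> \<alpha> * q - D_fun T p q < 1 \<longrightarrow>
      (AE a in (lebesgue :: ((real^('d::{finite,linorder}))^'m) measure).
         local_dim_level_set (self_affine_measure T p a) \<alpha> \<noteq> {} \<and>
         hausdorff_dim (local_dim_level_set (self_affine_measure T p a) \<alpha>)
           = ereal (\<alpha> * q - tau_fun T p q)))"
proof -
  \<comment> \<open>Entries decrease along the order of the index type, so its least element carries
    the largest entry of every word.\<close>
  define j0 :: 'd where "j0 = Min UNIV"
  have T: "T = (\<lambda>i. diag_matrix (t i))" using assms(2) by (intro ext)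
  have j0: "j0 < j" if "j \<noteq> j0" for j
    using that Min_le[of UNIV j] by (simp add: j0_def order_less_le)
  have t_first: "t i j < t i j0" if "j \<noteq> j0" for i j
    using assms(4) j0[OF that] by blast
  obtain P where P: "pmf P = p"
    using pmf_of_weights[of p] assms(6,7) by (auto intro: less_imp_le)
  have P0: "0 < pmf P i" for i using assms(6) P by simp
  have p1: "p i < 1" for i using pmf_less_1[OF assms(1) P0] P by simp
  define c where "c = Max (range (\<lambda>i. t i j0))"
  have c: "t i j0 \<le> c" for i unfolding c_def by (rule Max_ge) auto
  have "c \<in> range (\<lambda>i. t i j0)" unfolding c_def by (rule Max_in) auto
  then have c2: "c < 1 / 2" using assms(3) by auto
  interpret diag_system t j0 c
  proof
    show "t i j \<le> t i j0" for i j using t_first[of j i] by (cases "j = j0") auto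
  qed (use assms(5) c c2 in auto)
  \<comment> \<open>Strictness survives products along nonempty words, so their diagonal entries
    stay distinct.\<close>
  have word_less: "I \<noteq> [] \<Longrightarrow> prod_list (map (\<lambda>i. t i k) I) < prod_list (map (\<lambda>i. t i j) I)" if "j < k" for j k I
  proof (induction I)
    case (Cons i I)
    have "prod_list (map (\<lambda>i. t i k) I) \<le> prod_list (map (\<lambda>i. t i j) I)"
      using Cons.IH by (cases "I = []") auto
    moreover have "0 < prod_list (map (\<lambda>i. t i k) I)" by (rule prod_list_pos) (rule assms(5))
    ultimately show ?case
      using assms(4)[OF that, of i] assms(5)[of i k] by (auto intro!: mult_less_le_imp_less)
  qed simp
  have t_inj: "inj (\<lambda>j. prod_list (map (\<lambda>i. t i j) I)) \<or> I = []" for I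
    using word_less by (intro disjCI linorder_injI) (metis less_irrefl)
  have ratio1: "t i j0 < 1" for i using assms(3)[of i j0] by simp
  note facts = assms(6) p1 assms(7,5) ratio1 t_first t_inj
  have q: "1 < q" "0 < q - 1" using assms(8) by auto
  define D where "D = D_fun T p q"
  have D: "0 < D" "D < q - 1" using assms(9,11) q by (auto simp: D_def zero_less_divide_iff)
  \<comment> \<open>The quotient is below 1 and hence below the dimension, so it is the minimum; the
    bound on \<open>tau_fun T p q\<close> then becomes \<open>D < 1\<close>.\<close>
  have tau: "tau_fun T p q = D"
  proof -
    have "1 \<le> CARD('d)" by (simp add: Suc_leI)
    then have "D_fun T p q / (q - 1) \<le> real CARD('d)" using assms(12) by linarith
    then show ?thesis using q by (simp add: tau_fun_def D_def min_absorb1)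
  qed
  have D1: "D < 1" using assms(10) tau by simp
  define w where "w i = pmf P i powr q * t i j0 powr - D" for i
  have w0: "0 < w i" for i using P0[of i] assms(5)[of i j0] by (simp add: w_def less_imp_neq[THEN not_sym])
  have root: "(\<Sum>i\<in>UNIV. w i) = 1"
    using D_root[OF facts q(1)] D pressure_powr[OF assms(6) p1 assms(7) assms(5) ratio1, where x = q and y = D]
    by (simp add: D_def T w_def P)
  define L where "L = (\<Sum>i\<in>UNIV. w i * ln (t i j0))"
  have "L < (\<Sum>i\<in>(UNIV :: 'm set). 0)"
    unfolding L_def using w0 assms(5) ratio1 by (intro sum_strict_mono) (auto simp: mult_pos_neg)
  then have L: "L < 0" by simp
  define \<alpha> where "\<alpha> = (\<Sum>i\<in>UNIV. w i * ln (pmf P i)) / L"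
  have \<alpha>: "\<alpha> * (\<Sum>i\<in>UNIV. w i * ln (t i j0)) = (\<Sum>i\<in>UNIV. w i * ln (pmf P i))"
    using L by (simp add: \<alpha>_def flip: L_def)
  have "(D_fun T p has_real_derivative \<alpha>) (at q)"
    unfolding T using D \<alpha> by (intro D_has_derivative[OF facts q(1)]) (simp_all add: D_def T w_def P)
  moreover have "AE a in (lebesgue :: ((real^('d::{finite,linorder}))^'m) measure).
         local_dim_level_set (self_affine_measure T p a) \<alpha> \<noteq> {} \<and>
         hausdorff_dim (local_dim_level_set (self_affine_measure T p a) \<alpha>)
           = ereal (\<alpha> * q - tau_fun T p q)"
    if H: "0 < \<alpha> * q - D_fun T p q \<and> \<alpha> * q - D_fun T p q < 1"
  proof (rule AE_completion)
    have "AE a in lborel. local_dim_level_set (coded_measure P a) \<alpha> \<noteq> {} \<and>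
      hausdorff_dim (local_dim_level_set (coded_measure P a) \<alpha>) = ereal (\<alpha> * q - D)"
      using \<alpha> root H unfolding w_def
      by (intro dim_level_set assms P0 D D1) (auto simp: D_def)
    then show "AE a in lborel. local_dim_level_set (self_affine_measure T p a) \<alpha> \<noteq> {} \<and>
         hausdorff_dim (local_dim_level_set (self_affine_measure T p a) \<alpha>)
           = ereal (\<alpha> * q - tau_fun T p q)"
      using self_affine_measure_eq[of P] by (simp add: T P tau[unfolded T])
  qed
  ultimately show ?thesis by blast
qed

end
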